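(* Let $\mathscr{C}$ be a Frobenius extriangulated category satisfying condition (WIC), let $T$ be an $n$-cluster tilting object of $\mathscr{C}$, put $\mathcal{T}=\operatorname{add}T$, and let $C=\mathrm{End}_{\mathcal{A}}(T)^{\mathrm{opp}}$, where $\mathcal{A}=\mathscr{C}/\mathcal{P}$ is the stable category. Then the map $$\Phi: K_0^{\mathrm{sp}}(\mathrm{mod}\, C)\to K_0^{\mathrm{sp}}(\mathcal{T}),\qquad [\mathbb{H}(M)]\mapsto \Theta(M)\quad (M\in\mathscr{C}),$$ descends to the Grothendieck group $K_0(\mathrm{mod}\, C)$; that is, for every short exact sequence $0\to x\to l\to m\to 0$ in $\mathrm{mod}\,C$ one has $\Phi([x])-\Phi([l])+\Phi([m])=0$, so that $\Phi$ induces a map $K_0(\mathrm{mod}\,C)\to K_0^{\mathrm{sp}}(\mathcal{T})$.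
   Context: Conventions: $k$ is an algebraically closed field; all categories are skeletally small, $k$-linear and Krull–Schmidt; subcategories are full and closed under isomorphisms; $\operatorname{add}X$ is the full subcategory of finite direct sums of direct summands of $X$; $\mathrm{mod}\,\Lambda$ is the category of finitely generated modules over a $k$-algebra $\Lambda$. Extriangulated category $(\mathscr{C},\mathbb{E},\mathfrak{s})$: in the sense of Nakaoka–Palu. An $\mathbb{E}$-triangle $X\xrightarrow{f}Y\xrightarrow{g}Z\dashrightarrow$ is a sequence realizing an element of $\mathbb{E}(Z,X)$; then $f$ is an inflation, $g$ a deflation. (WIC): for composable $f,g$, if $gf$ is an inflation then $f$ is an inflation, and if $gf$ is a deflation then $g$ is a deflation. An object $P$ is projective if $\mathbb{E}(P,\mathscr{C})=0$ and injective if $\mathbb{E}(\mathscr{C},P)=0$; $\mathscr{C}$ is Frobenius if it has enough projectives (every $M$ admits an $\mathbb{E}$-triangle $A\to P\to M\dashrightarrow$ with $P$ projective), enough injectives (dually), and projectives coincide with injectives. $\mathcal{P}$ is the full subcategory of projective objects. The stable category $\mathcal{A}=\mathscr{C}/\mathcal{P}$ (morphisms modulo those factoring through $\mathcal{P}$) is triangulated; its suspension $\Sigma$ is given by $\mathbb{E}$-triangles $X\to I\to \Sigma X\dashrightarrow$ with $I\in\mathcal{P}$, and its distinguished triangles are those induced by $\mathbb{E}$-triangles of $\mathscr{C}$. $\pi:\mathscr{C}\to\mathcal{A}$ is the projection functor. The higher extensions are $\mathbb{E}^i(M,N)\cong\mathbb{E}(M,\Sigma^{i-1}N)$, $i\ge1$.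 A subcategory $\mathcal{T}$ is $n$-cluster tilting if it is functorially finite and $\mathcal{T}=\{M:\mathbb{E}^i(\mathcal{T},M)=0,\ 1\le i\le n-1\}=\{M:\mathbb{E}^i(M,\mathcal{T})=0,\ 1\le i\le n-1\}$. An object $T$ is $n$-cluster tilting if $\operatorname{add}T$ is. $K_0^{\mathrm{sp}}(-)$ is the split Grothendieck group: the free abelian group on isomorphism classes modulo $[X\oplus Y]=[X]+[Y]$. $K_0(\mathrm{mod}\,C)$ is the usual Grothendieck group, the quotient of $K_0^{\mathrm{sp}}(\mathrm{mod}\,C)$ by the relations $[x]-[l]+[m]$ for short exact sequences $0\to x\to l\to m\to0$. Index: for $M\in\mathscr{C}$ there are $\mathbb{E}$-triangles $K_{i+1}\to T_i\xrightarrow{f_i}K_i\dashrightarrow$ for $0\le i\le n-2$, with $K_0=M$, $T_i\in\mathcal{T}$, $f_i$ a minimal right $\mathcal{T}$-approximation, and $K_{n-1}=:T_{n-1}\in\mathcal{T}$. Set $\mathrm{ind}_{\mathcal{T}}(M)=\sum_{i=0}^{n-1}(-1)^i[T_i]\in K_0^{\mathrm{sp}}(\mathcal{T})$. For $X\in\mathscr{C}$ choose an $\mathbb{E}$-triangle $X'\to P\to X\dashrightarrow$ with $P\in\mathcal{P}$ and set $\Theta(X)=\mathrm{ind}_{\mathcal{T}}(X')-[P]+\mathrm{ind}_{\mathcal{T}}(X)\in K_0^{\mathrm{sp}}(\mathcal{T})$; this depends only on $X$. $\mathbb{G}=\mathrm{Hom}_{\mathcal{A}}(T,-):\mathcal{A}\to\mathrm{mod}\,C$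 and $\mathbb{H}=\mathbb{G}\pi:\mathscr{C}\to\mathrm{mod}\,C$. Every $m\in\mathrm{mod}\,C$ is isomorphic to $\mathbb{H}(M)$ for some $M\in\mathscr{C}$, and $\Phi$ is the well-defined map with $\Phi([\mathbb{H}(M)])=\Theta(M)$. *)

theory Defs
  imports "HOL-Algebra.Algebra"
begin

text \<open>The library reserves the letter \<open>X\<close> for the polynomial variable.\<close>

no_notation var (\<open>X\<index>\<close>)

section \<open>Linear categories\<close>

text \<open>
  A category is given by a carrier set of objects and a carrier set of arrows; since every
  arrow determines its source and target, distinct Hom sets are disjoint.  Every skeletally small
  category is equivalent to one of this form.
\<close>

record ('o, 'm, 'k) lincat =
  objs :: "'o set"
  arrs :: "'m set"
  src :: "'m \<Rightarrow> 'o"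
  tgt :: "'m \<Rightarrow> 'o"
  ident :: "'o \<Rightarrow> 'm"
  cmp :: "'m \<Rightarrow> 'm \<Rightarrow> 'm" (infixr \<open>\<bullet>\<index>\<close> 75)
  zarr :: "'o \<Rightarrow> 'o \<Rightarrow> 'm"
  aplus :: "'m \<Rightarrow> 'm \<Rightarrow> 'm"
  ascale :: "'k \<Rightarrow> 'm \<Rightarrow> 'm"

definition Hom :: "('o, 'm, 'k, 'z) lincat_scheme \<Rightarrow> 'o \<Rightarrow> 'o \<Rightarrow> 'm set" where
  "Hom \<C> X Y = {f \<in> arrs \<C>. src \<C> f = X \<and> tgt \<C> f = Y}"

text \<open>The Hom space as a module record; the library's record carries a multiplication and a unit
  that are irrelevant for modules.\<close>

definition hom_module :: "('o, 'm, 'k, 'z) lincat_scheme \<Rightarrow> 'o \<Rightarrow> 'o \<Rightarrow> ('k, 'm) module" where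
  "hom_module \<C> X Y =
     \<lparr>carrier = Hom \<C> X Y, monoid.mult = (\<lambda>_ _. undefined), one = undefined,
      ring.zero = zarr \<C> X Y, add = aplus \<C>, smult = ascale \<C>\<rparr>"

locale linear_category = K?: field K for K :: "('k, 'r) ring_scheme" +
  fixes \<C> :: "('o, 'm, 'k, 'z) lincat_scheme" (structure)
  assumes src_obj: "f \<in> arrs \<C> \<Longrightarrow> src \<C> f \<in> objs \<C>"
    and tgt_obj: "f \<in> arrs \<C> \<Longrightarrow> tgt \<C> f \<in> objs \<C>"
    and ident_hom: "X \<in> objs \<C> \<Longrightarrow> ident \<C> X \<in> Hom \<C> X X"
    and cmp_hom: "f \<in> Hom \<C> X Y \<Longrightarrow> g \<in> Hom \<C> Y Z \<Longrightarrow> g \<bullet> f \<in> Hom \<C> X Z"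
    and cmp_ident_right: "f \<in> Hom \<C> X Y \<Longrightarrow> f \<bullet> ident \<C> X = f"
    and cmp_ident_left: "f \<in> Hom \<C> X Y \<Longrightarrow> ident \<C> Y \<bullet> f = f"
    and cmp_assoc: "f \<in> Hom \<C> W X \<Longrightarrow> g \<in> Hom \<C> X Y \<Longrightarrow> h \<in> Hom \<C> Y Z \<Longrightarrow>
          (h \<bullet> g) \<bullet> f = h \<bullet> (g \<bullet> f)"
    and hom_module: "X \<in> objs \<C> \<Longrightarrow> Y \<in> objs \<C> \<Longrightarrow> module K (hom_module \<C> X Y)"
    and cmp_plus_right: "f \<in> Hom \<C> X Y \<Longrightarrow> f' \<in> Hom \<C> X Y \<Longrightarrow> g \<in> Hom \<C> Y Z \<Longrightarrow>
          g \<bullet> aplus \<C> f f' = aplus \<C> (g \<bullet> f) (g \<bullet> f')"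
    and cmp_plus_left: "f \<in> Hom \<C> X Y \<Longrightarrow> g \<in> Hom \<C> Y Z \<Longrightarrow> g' \<in> Hom \<C> Y Z \<Longrightarrow>
          aplus \<C> g g' \<bullet> f = aplus \<C> (g \<bullet> f) (g' \<bullet> f)"
    and cmp_scale_right: "a \<in> carrier K \<Longrightarrow> f \<in> Hom \<C> X Y \<Longrightarrow> g \<in> Hom \<C> Y Z \<Longrightarrow>
          g \<bullet> ascale \<C> a f = ascale \<C> a (g \<bullet> f)"
    and cmp_scale_left: "a \<in> carrier K \<Longrightarrow> f \<in> Hom \<C> X Y \<Longrightarrow> g \<in> Hom \<C> Y Z \<Longrightarrow>
          ascale \<C> a g \<bullet> f = ascale \<C> a (g \<bullet> f)"

definition is_iso :: "('o, 'm, 'k, 'z) lincat_scheme \<Rightarrow> 'm \<Rightarrow> bool" where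
  "is_iso \<C> f \<longleftrightarrow> f \<in> arrs \<C> \<and>
     (\<exists>g \<in> Hom \<C> (tgt \<C> f) (src \<C> f).
        g \<bullet>\<^bsub>\<C>\<^esub> f = ident \<C> (src \<C> f) \<and> f \<bullet>\<^bsub>\<C>\<^esub> g = ident \<C> (tgt \<C> f))"

definition isomorphic :: "('o, 'm, 'k, 'z) lincat_scheme \<Rightarrow> 'o \<Rightarrow> 'o \<Rightarrow> bool" where
  "isomorphic \<C> X Y \<longleftrightarrow> (\<exists>f \<in> Hom \<C> X Y. is_iso \<C> f)"

text \<open>\<open>i\<close>, \<open>j\<close> are the injections and \<open>p\<close>, \<open>q\<close> the projections of \<open>Z = X \<oplus> Y\<close>.\<close>

definition biproduct ::
  "('o, 'm, 'k, 'z) lincat_scheme \<Rightarrow> 'o \<Rightarrow> 'o \<Rightarrow> 'o \<Rightarrow> 'm \<Rightarrow> 'm \<Rightarrow> 'm \<Rightarrow> 'm \<Rightarrow> bool" where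
  "biproduct \<C> X Y Z i j p q \<longleftrightarrow>
     X \<in> objs \<C> \<and> Y \<in> objs \<C> \<and> Z \<in> objs \<C> \<and>
     i \<in> Hom \<C> X Z \<and> j \<in> Hom \<C> Y Z \<and> p \<in> Hom \<C> Z X \<and> q \<in> Hom \<C> Z Y \<and>
     p \<bullet>\<^bsub>\<C>\<^esub> i = ident \<C> X \<and> q \<bullet>\<^bsub>\<C>\<^esub> j = ident \<C> Y \<and>
     q \<bullet>\<^bsub>\<C>\<^esub> i = zarr \<C> X Y \<and> p \<bullet>\<^bsub>\<C>\<^esub> j = zarr \<C> Y X \<and>
     aplus \<C> (i \<bullet>\<^bsub>\<C>\<^esub> p) (j \<bullet>\<^bsub>\<C>\<^esub> q) = ident \<C> Z"

definition is_dsum :: "('o, 'm, 'k, 'z) lincat_scheme \<Rightarrow> 'o \<Rightarrow> 'o \<Rightarrow> 'o \<Rightarrow> bool" where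
  "is_dsum \<C> X Y Z \<longleftrightarrow> (\<exists>i j p q. biproduct \<C> X Y Z i j p q)"

definition is_finite_dsum :: "('o, 'm, 'k, 'z) lincat_scheme \<Rightarrow> 'o list \<Rightarrow> 'o \<Rightarrow> bool" where
  "is_finite_dsum \<C> Xs Z \<longleftrightarrow>
     set Xs \<subseteq> objs \<C> \<and> Z \<in> objs \<C> \<and>
     (\<exists>\<iota> \<pi>. (\<forall>a < length Xs. \<iota> a \<in> Hom \<C> (Xs ! a) Z \<and> \<pi> a \<in> Hom \<C> Z (Xs ! a)) \<and>
        (\<forall>a < length Xs. \<forall>b < length Xs.
           \<pi> a \<bullet>\<^bsub>\<C>\<^esub> \<iota> b = (if a = b then ident \<C> (Xs ! a) else zarr \<C> (Xs ! b) (Xs ! a))) \<and>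
        finsum (hom_module \<C> Z Z) (\<lambda>a. \<iota> a \<bullet>\<^bsub>\<C>\<^esub> \<pi> a) {..<length Xs} = ident \<C> Z)"

locale additive_category = linear_category +
  assumes zero_object: "\<exists>Z \<in> objs \<C>. ident \<C> Z = zarr \<C> Z Z"
    and biproducts: "X \<in> objs \<C> \<Longrightarrow> Y \<in> objs \<C> \<Longrightarrow> \<exists>Z. is_dsum \<C> X Y Z"

definition local_endomorphism_ring :: "('o, 'm, 'k, 'z) lincat_scheme \<Rightarrow> 'o \<Rightarrow> bool" where
  "local_endomorphism_ring \<C> X \<longleftrightarrow>
     ident \<C> X \<noteq> zarr \<C> X X \<and>
     (\<forall>f \<in> Hom \<C> X X. \<forall>g \<in> Hom \<C> X X. \<not> is_iso \<C> f \<longrightarrow> \<not> is_iso \<C> g \<longrightarrow> \<not> is_iso \<C> (aplus \<C> f g))"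

definition krull_schmidt :: "('o, 'm, 'k, 'z) lincat_scheme \<Rightarrow> bool" where
  "krull_schmidt \<C> \<longleftrightarrow>
     (\<forall>X \<in> objs \<C>. \<exists>Xs. is_finite_dsum \<C> Xs X \<and> (\<forall>Y \<in> set Xs. local_endomorphism_ring \<C> Y))"

definition is_summand :: "('o, 'm, 'k, 'z) lincat_scheme \<Rightarrow> 'o \<Rightarrow> 'o \<Rightarrow> bool" where
  "is_summand \<C> Y X \<longleftrightarrow> (\<exists>W. is_dsum \<C> Y W X)"

definition add_closure :: "('o, 'm, 'k, 'z) lincat_scheme \<Rightarrow> 'o \<Rightarrow> 'o set" where
  "add_closure \<C> X = {Y. \<exists>Ys. (\<forall>W \<in> set Ys. is_summand \<C> W X) \<and> is_finite_dsum \<C> Ys Y}"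

text \<open>Full subcategories are represented by their sets of objects.\<close>

definition right_approx :: "('o, 'm, 'k, 'z) lincat_scheme \<Rightarrow> 'o set \<Rightarrow> 'm \<Rightarrow> bool" where
  "right_approx \<C> S f \<longleftrightarrow> f \<in> arrs \<C> \<and> src \<C> f \<in> S \<and>
     (\<forall>X \<in> S. \<forall>g \<in> Hom \<C> X (tgt \<C> f). \<exists>h \<in> Hom \<C> X (src \<C> f). f \<bullet>\<^bsub>\<C>\<^esub> h = g)"

definition left_approx :: "('o, 'm, 'k, 'z) lincat_scheme \<Rightarrow> 'o set \<Rightarrow> 'm \<Rightarrow> bool" where
  "left_approx \<C> S f \<longleftrightarrow> f \<in> arrs \<C> \<and> tgt \<C> f \<in> S \<and>
     (\<forall>X \<in> S. \<forall>g \<in> Hom \<C> (src \<C> f) X. \<exists>h \<in> Hom \<C> (tgt \<C> f) X. h \<bullet>\<^bsub>\<C>\<^esub> f = g)"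

definition right_minimal :: "('o, 'm, 'k, 'z) lincat_scheme \<Rightarrow> 'm \<Rightarrow> bool" where
  "right_minimal \<C> f \<longleftrightarrow> (\<forall>h \<in> Hom \<C> (src \<C> f) (src \<C> f). f \<bullet>\<^bsub>\<C>\<^esub> h = f \<longrightarrow> is_iso \<C> h)"

definition functorially_finite :: "('o, 'm, 'k, 'z) lincat_scheme \<Rightarrow> 'o set \<Rightarrow> bool" where
  "functorially_finite \<C> S \<longleftrightarrow>
     (\<forall>M \<in> objs \<C>. (\<exists>f. tgt \<C> f = M \<and> right_approx \<C> S f) \<and> (\<exists>f. src \<C> f = M \<and> left_approx \<C> S f))"

subsection \<open>Quotient by the ideal of morphisms factoring through a subcategory\<close>

definition factoring :: "('o, 'm, 'k, 'z) lincat_scheme \<Rightarrow> 'o set \<Rightarrow> 'o \<Rightarrow> 'o \<Rightarrow> 'm set" where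
  "factoring \<C> S X Y = {g \<bullet>\<^bsub>\<C>\<^esub> f | Q f g. Q \<in> S \<and> f \<in> Hom \<C> X Q \<and> g \<in> Hom \<C> Q Y}"

definition arr_class :: "('o, 'm, 'k, 'z) lincat_scheme \<Rightarrow> 'o set \<Rightarrow> 'm \<Rightarrow> 'm set" where
  "arr_class \<C> S f =
     factoring \<C> S (src \<C> f) (tgt \<C> f) +>\<^bsub>hom_module \<C> (src \<C> f) (tgt \<C> f)\<^esub> f"

text \<open>Operations on classes are given by the union of the classes of the results over all
  representatives, which avoids choosing representatives.\<close>

definition quotient_category ::
  "('o, 'm, 'k, 'z) lincat_scheme \<Rightarrow> 'o set \<Rightarrow> ('o, 'm set, 'k) lincat" where
  "quotient_category \<C> S =
     \<lparr>objs = objs \<C>,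
      arrs = arr_class \<C> S ` arrs \<C>,
      src = (\<lambda>F. the_elem (src \<C> ` F)),
      tgt = (\<lambda>F. the_elem (tgt \<C> ` F)),
      ident = (\<lambda>X. arr_class \<C> S (ident \<C> X)),
      cmp = (\<lambda>G F. \<Union>g \<in> G. \<Union>f \<in> F. arr_class \<C> S (g \<bullet>\<^bsub>\<C>\<^esub> f)),
      zarr = (\<lambda>X Y. arr_class \<C> S (zarr \<C> X Y)),
      aplus = (\<lambda>F G. \<Union>f \<in> F. \<Union>g \<in> G. arr_class \<C> S (aplus \<C> f g)),
      ascale = (\<lambda>a F. \<Union>f \<in> F. arr_class \<C> S (ascale \<C> a f))\<rparr>"

section \<open>Extriangulated categories (Nakaoka--Palu)\<close>

text \<open>
  \<open>Ext E Z X\<close> is \<open>\<E>(Z, X)\<close>, \<open>push E a d\<close> is \<open>a\<^sub>* d\<close>, \<open>pull E c d\<close> is \<open>c\<^sup>* d\<close>, and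
  \<open>realization E d\<close> is the equivalence class of sequences realizing \<open>d\<close>, a sequence
  \<open>X \<rightarrow> Y \<rightarrow> Z\<close> being given by its pair of morphisms.  An element of \<open>Ext E Z X\<close> is required
  to determine \<open>Z\<close> and \<open>X\<close>: an extension is a triple in Nakaoka--Palu.
\<close>

record ('o, 'm, 'k, 'e) extcat = "('o, 'm, 'k) lincat" +
  Ext :: "'o \<Rightarrow> 'o \<Rightarrow> 'e set"
  ezero :: "'o \<Rightarrow> 'o \<Rightarrow> 'e"
  eplus :: "'e \<Rightarrow> 'e \<Rightarrow> 'e"
  push :: "'m \<Rightarrow> 'e \<Rightarrow> 'e"
  pull :: "'m \<Rightarrow> 'e \<Rightarrow> 'e"
  realization :: "'e \<Rightarrow> ('m \<times> 'm) set"

definition ext_group ::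
  "('o, 'm, 'k, 'e, 'z) extcat_scheme \<Rightarrow> 'o \<Rightarrow> 'o \<Rightarrow> 'e monoid" where
  "ext_group E Z X = \<lparr>carrier = Ext E Z X, monoid.mult = eplus E, one = ezero E Z X\<rparr>"

definition etriangle ::
  "('o, 'm, 'k, 'e, 'z) extcat_scheme \<Rightarrow> 'o \<Rightarrow> 'm \<Rightarrow> 'o \<Rightarrow> 'm \<Rightarrow> 'o \<Rightarrow> 'e \<Rightarrow> bool" where
  "etriangle E X f Y g Z d \<longleftrightarrow>
     X \<in> objs E \<and> Y \<in> objs E \<and> Z \<in> objs E \<and> f \<in> Hom E X Y \<and> g \<in> Hom E Y Z \<and>
     d \<in> Ext E Z X \<and> (f, g) \<in> realization E d"

definition inflation :: "('o, 'm, 'k, 'e, 'z) extcat_scheme \<Rightarrow> 'm \<Rightarrow> bool" where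
  "inflation E f \<longleftrightarrow> (\<exists>X Y g Z d. etriangle E X f Y g Z d)"

definition deflation :: "('o, 'm, 'k, 'e, 'z) extcat_scheme \<Rightarrow> 'm \<Rightarrow> bool" where
  "deflation E g \<longleftrightarrow> (\<exists>X f Y Z d. etriangle E X f Y g Z d)"

locale extriangulated_category = additive_category K E
  for K :: "('k, 'r) ring_scheme" and E :: "('o, 'm, 'k, 'e, 'z) extcat_scheme" (structure) +
  \<comment> \<open>(ET1): an additive bifunctor\<close>
  assumes ext_disjoint: "d \<in> Ext E Z X \<Longrightarrow> d \<in> Ext E Z' X' \<Longrightarrow>
          Z \<in> objs E \<Longrightarrow> X \<in> objs E \<Longrightarrow> Z' \<in> objs E \<Longrightarrow> X' \<in> objs E \<Longrightarrow> Z = Z' \<and> X = X'"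
    and ext_comm_group: "Z \<in> objs E \<Longrightarrow> X \<in> objs E \<Longrightarrow> comm_group (ext_group E Z X)"
    and push_hom: "a \<in> Hom E X X' \<Longrightarrow> Z \<in> objs E \<Longrightarrow>
          push E a \<in> hom (ext_group E Z X) (ext_group E Z X')"
    and pull_hom: "c \<in> Hom E Z' Z \<Longrightarrow> X \<in> objs E \<Longrightarrow>
          pull E c \<in> hom (ext_group E Z X) (ext_group E Z' X)"
    and push_ident: "Z \<in> objs E \<Longrightarrow> X \<in> objs E \<Longrightarrow> d \<in> Ext E Z X \<Longrightarrow> push E (ident E X) d = d"
    and pull_ident: "Z \<in> objs E \<Longrightarrow> X \<in> objs E \<Longrightarrow> d \<in> Ext E Z X \<Longrightarrow> pull E (ident E Z) d = d"
    and push_cmp: "a \<in> Hom E X X' \<Longrightarrow> a' \<in> Hom E X' X'' \<Longrightarrow> Z \<in> objs E \<Longrightarrow> d \<in> Ext E Z X \<Longrightarrow>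
          push E (a' \<bullet> a) d = push E a' (push E a d)"
    and pull_cmp: "c \<in> Hom E Z' Z \<Longrightarrow> c' \<in> Hom E Z'' Z' \<Longrightarrow> X \<in> objs E \<Longrightarrow> d \<in> Ext E Z X \<Longrightarrow>
          pull E (c \<bullet> c') d = pull E c' (pull E c d)"
    and push_pull: "a \<in> Hom E X X' \<Longrightarrow> c \<in> Hom E Z' Z \<Longrightarrow> d \<in> Ext E Z X \<Longrightarrow>
          push E a (pull E c d) = pull E c (push E a d)"
    and push_plus: "a \<in> Hom E X X' \<Longrightarrow> a' \<in> Hom E X X' \<Longrightarrow> Z \<in> objs E \<Longrightarrow> d \<in> Ext E Z X \<Longrightarrow>
          push E (aplus E a a') d = eplus E (push E a d) (push E a' d)"
    and pull_plus: "c \<in> Hom E Z' Z \<Longrightarrow> c' \<in> Hom E Z' Z \<Longrightarrow> X \<in> objs E \<Longrightarrow> d \<in> Ext E Z X \<Longrightarrow>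
          pull E (aplus E c c') d = eplus E (pull E c d) (pull E c' d)"
  \<comment> \<open>(ET2): \<open>realization\<close> is an additive realization\<close>
    and real_class: "Z \<in> objs E \<Longrightarrow> X \<in> objs E \<Longrightarrow> d \<in> Ext E Z X \<Longrightarrow>
          \<exists>Y \<in> objs E. \<exists>f \<in> Hom E X Y. \<exists>g \<in> Hom E Y Z. realization E d =
            {(f', g'). \<exists>Y' \<in> objs E. f' \<in> Hom E X Y' \<and> g' \<in> Hom E Y' Z \<and>
               (\<exists>b \<in> Hom E Y Y'. is_iso E b \<and> b \<bullet> f = f' \<and> g' \<bullet> b = g)}"
    and real_morphism: "etriangle E X f Y g Z d \<Longrightarrow> etriangle E X' f' Y' g' Z' d' \<Longrightarrow>
          a \<in> Hom E X X' \<Longrightarrow> c \<in> Hom E Z Z' \<Longrightarrow> push E a d = pull E c d' \<Longrightarrow>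
          \<exists>b \<in> Hom E Y Y'. b \<bullet> f = f' \<bullet> a \<and> g' \<bullet> b = c \<bullet> g"
    and real_zero: "biproduct E X Z Y i j p q \<Longrightarrow> (i, q) \<in> realization E (ezero E Z X)"
    and real_sum: "etriangle E X f Y g Z d \<Longrightarrow> etriangle E X' f' Y' g' Z' d' \<Longrightarrow>
          biproduct E X X' X'' i\<^sub>X j\<^sub>X p\<^sub>X q\<^sub>X \<Longrightarrow> biproduct E Y Y' Y'' i\<^sub>Y j\<^sub>Y p\<^sub>Y q\<^sub>Y \<Longrightarrow>
          biproduct E Z Z' Z'' i\<^sub>Z j\<^sub>Z p\<^sub>Z q\<^sub>Z \<Longrightarrow>
          (aplus E (i\<^sub>Y \<bullet> f \<bullet> p\<^sub>X) (j\<^sub>Y \<bullet> f' \<bullet> q\<^sub>X), aplus E (i\<^sub>Z \<bullet> g \<bullet> p\<^sub>Y) (j\<^sub>Z \<bullet> g' \<bullet> q\<^sub>Y))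
            \<in> realization E (eplus E (push E i\<^sub>X (pull E p\<^sub>Z d)) (push E j\<^sub>X (pull E q\<^sub>Z d')))"
    and ET3: "etriangle E X f Y g Z d \<Longrightarrow> etriangle E X' f' Y' g' Z' d' \<Longrightarrow>
          a \<in> Hom E X X' \<Longrightarrow> b \<in> Hom E Y Y' \<Longrightarrow> b \<bullet> f = f' \<bullet> a \<Longrightarrow>
          \<exists>c \<in> Hom E Z Z'. push E a d = pull E c d' \<and> c \<bullet> g = g' \<bullet> b"
    and ET3_op: "etriangle E X f Y g Z d \<Longrightarrow> etriangle E X' f' Y' g' Z' d' \<Longrightarrow>
          b \<in> Hom E Y Y' \<Longrightarrow> c \<in> Hom E Z Z' \<Longrightarrow> g' \<bullet> b = c \<bullet> g \<Longrightarrow>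
          \<exists>a \<in> Hom E X X'. push E a d = pull E c d' \<and> b \<bullet> f = f' \<bullet> a"
    \<comment> \<open>composing inflations \<open>f : A \<rightarrow> B\<close> and \<open>g : B \<rightarrow> W\<close>\<close>
    and ET4: "etriangle E A f B f' D d \<Longrightarrow> etriangle E B g W g' F d' \<Longrightarrow>
          \<exists>G h' u v d''. etriangle E A (g \<bullet> f) W h' G d'' \<and>
            etriangle E D u G v F (push E f' d') \<and>
            u \<bullet> f' = h' \<bullet> g \<and> v \<bullet> h' = g' \<and>
            pull E u d'' = d \<and> push E f d'' = pull E v d'"
    \<comment> \<open>composing deflations \<open>f : A \<rightarrow> B\<close> and \<open>g : B \<rightarrow> W\<close>\<close>
    and ET4_op: "etriangle E D f' A f B d \<Longrightarrow> etriangle E F g' B g W d' \<Longrightarrow>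
          \<exists>G h' u v d''. etriangle E G h' A (g \<bullet> f) W d'' \<and>
            etriangle E D u G v F (pull E g' d) \<and>
            h' \<bullet> u = f' \<and> f \<bullet> h' = g' \<bullet> v \<and>
            push E v d'' = d' \<and> push E u d = pull E g d''"

definition WIC :: "('o, 'm, 'k, 'e, 'z) extcat_scheme \<Rightarrow> bool" where
  "WIC E \<longleftrightarrow>
     (\<forall>f \<in> arrs E. \<forall>g \<in> arrs E. tgt E f = src E g \<longrightarrow>
        (inflation E (g \<bullet>\<^bsub>E\<^esub> f) \<longrightarrow> inflation E f) \<and> (deflation E (g \<bullet>\<^bsub>E\<^esub> f) \<longrightarrow> deflation E g))"

definition projectives :: "('o, 'm, 'k, 'e, 'z) extcat_scheme \<Rightarrow> 'o set" where
  "projectives E = {P \<in> objs E. \<forall>X \<in> objs E. trivial_group (ext_group E P X)}"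

definition injectives :: "('o, 'm, 'k, 'e, 'z) extcat_scheme \<Rightarrow> 'o set" where
  "injectives E = {I \<in> objs E. \<forall>X \<in> objs E. trivial_group (ext_group E X I)}"

locale frobenius_extriangulated_category = extriangulated_category +
  assumes enough_projectives:
      "M \<in> objs E \<Longrightarrow> \<exists>A f P g d. P \<in> projectives E \<and> etriangle E A f P g M d"
    and enough_injectives:
      "M \<in> objs E \<Longrightarrow> \<exists>I f A g d. I \<in> injectives E \<and> etriangle E M f I g A d"
    and projectives_eq_injectives: "projectives E = injectives E"

definition stable_category ::
  "('o, 'm, 'k, 'e, 'z) extcat_scheme \<Rightarrow> ('o, 'm set, 'k) lincat" where
  "stable_category E = quotient_category E (projectives E)"

text \<open>\<open>suspension E\<close> is \<open>\<Sigma>\<close> on objects, with a choice made for every object.\<close>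

definition suspension :: "('o, 'm, 'k, 'e, 'z) extcat_scheme \<Rightarrow> 'o \<Rightarrow> 'o" where
  "suspension E X = (SOME Y. \<exists>I f g d. I \<in> projectives E \<and> etriangle E X f I g Y d)"

definition higher_ext ::
  "('o, 'm, 'k, 'e, 'z) extcat_scheme \<Rightarrow> nat \<Rightarrow> 'o \<Rightarrow> 'o \<Rightarrow> 'e monoid" where
  "higher_ext E i M N = ext_group E M ((suspension E ^^ (i - 1)) N)"

definition cluster_tilting :: "('o, 'm, 'k, 'e, 'z) extcat_scheme \<Rightarrow> nat \<Rightarrow> 'o set \<Rightarrow> bool" where
  "cluster_tilting E n S \<longleftrightarrow>
     functorially_finite E S \<and>
     S = {M \<in> objs E. \<forall>X \<in> S. \<forall>i. 1 \<le> i \<and> i \<le> n - 1 \<longrightarrow> trivial_group (higher_ext E i X M)} \<and>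
     S = {M \<in> objs E. \<forall>X \<in> S. \<forall>i. 1 \<le> i \<and> i \<le> n - 1 \<longrightarrow> trivial_group (higher_ext E i M X)}"

definition cluster_tilting_object ::
  "('o, 'm, 'k, 'e, 'z) extcat_scheme \<Rightarrow> nat \<Rightarrow> 'o \<Rightarrow> bool" where
  "cluster_tilting_object E n T \<longleftrightarrow> T \<in> objs E \<and> cluster_tilting E n (add_closure E T)"

section \<open>Finitely generated left modules over a noncommutative ring\<close>

locale left_module = R?: ring R + M?: abelian_group M
  for R :: "('a, 'r) ring_scheme" (structure) and M :: "('a, 'b, 'c) module_scheme" (structure) +
  assumes smult_closed: "a \<in> carrier R \<Longrightarrow> x \<in> carrier M \<Longrightarrow> a \<odot>\<^bsub>M\<^esub> x \<in> carrier M"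
    and smult_l_distr: "a \<in> carrier R \<Longrightarrow> b \<in> carrier R \<Longrightarrow> x \<in> carrier M \<Longrightarrow>
          (a \<oplus>\<^bsub>R\<^esub> b) \<odot>\<^bsub>M\<^esub> x = a \<odot>\<^bsub>M\<^esub> x \<oplus>\<^bsub>M\<^esub> b \<odot>\<^bsub>M\<^esub> x"
    and smult_r_distr: "a \<in> carrier R \<Longrightarrow> x \<in> carrier M \<Longrightarrow> y \<in> carrier M \<Longrightarrow>
          a \<odot>\<^bsub>M\<^esub> (x \<oplus>\<^bsub>M\<^esub> y) = a \<odot>\<^bsub>M\<^esub> x \<oplus>\<^bsub>M\<^esub> a \<odot>\<^bsub>M\<^esub> y"
    and smult_assoc: "a \<in> carrier R \<Longrightarrow> b \<in> carrier R \<Longrightarrow> x \<in> carrier M \<Longrightarrow>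
          (a \<otimes>\<^bsub>R\<^esub> b) \<odot>\<^bsub>M\<^esub> x = a \<odot>\<^bsub>M\<^esub> (b \<odot>\<^bsub>M\<^esub> x)"
    and smult_one: "x \<in> carrier M \<Longrightarrow> \<one>\<^bsub>R\<^esub> \<odot>\<^bsub>M\<^esub> x = x"

definition fg_modules :: "('a, 'r) ring_scheme \<Rightarrow> ('a, 'b) module set" where
  "fg_modules R = {M. left_module R M \<and>
     (\<exists>B. finite B \<and> B \<subseteq> carrier M \<and>
        (\<forall>x \<in> carrier M. \<exists>c \<in> B \<rightarrow> carrier R. x = finsum M (\<lambda>b. c b \<odot>\<^bsub>M\<^esub> b) B))}"

definition module_hom ::
  "('a, 'r) ring_scheme \<Rightarrow> ('a, 'b, 'c) module_scheme \<Rightarrow> ('a, 'd, 'f) module_scheme \<Rightarrow>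
     ('b \<Rightarrow> 'd) set" where
  "module_hom R M N = {h \<in> carrier M \<rightarrow> carrier N.
     (\<forall>x \<in> carrier M. \<forall>y \<in> carrier M. h (x \<oplus>\<^bsub>M\<^esub> y) = h x \<oplus>\<^bsub>N\<^esub> h y) \<and>
     (\<forall>a \<in> carrier R. \<forall>x \<in> carrier M. h (a \<odot>\<^bsub>M\<^esub> x) = a \<odot>\<^bsub>N\<^esub> h x)}"

definition module_iso ::
  "('a, 'r) ring_scheme \<Rightarrow> ('a, 'b, 'c) module_scheme \<Rightarrow> ('a, 'd, 'f) module_scheme \<Rightarrow> bool" where
  "module_iso R M N \<longleftrightarrow> (\<exists>h \<in> module_hom R M N. bij_betw h (carrier M) (carrier N))"

definition module_prod ::
  "('a, 'b) module \<Rightarrow> ('a, 'd) module \<Rightarrow> ('a, 'b \<times> 'd) module" where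
  "module_prod M N =
     \<lparr>carrier = carrier M \<times> carrier N, monoid.mult = (\<lambda>_ _. undefined), one = undefined,
      ring.zero = (\<zero>\<^bsub>M\<^esub>, \<zero>\<^bsub>N\<^esub>), add = (\<lambda>(x, y) (x', y'). (x \<oplus>\<^bsub>M\<^esub> x', y \<oplus>\<^bsub>N\<^esub> y')),
      smult = (\<lambda>a (x, y). (a \<odot>\<^bsub>M\<^esub> x, a \<odot>\<^bsub>N\<^esub> y))\<rparr>"

definition module_ses ::
  "('a, 'r) ring_scheme \<Rightarrow> ('a, 'b) module \<Rightarrow> ('b \<Rightarrow> 'b) \<Rightarrow> ('a, 'b) module \<Rightarrow> ('b \<Rightarrow> 'b) \<Rightarrow>
     ('a, 'b) module \<Rightarrow> bool" where
  "module_ses R x f l g m \<longleftrightarrow>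
     x \<in> fg_modules R \<and> l \<in> fg_modules R \<and> m \<in> fg_modules R \<and>
     f \<in> module_hom R x l \<and> g \<in> module_hom R l m \<and>
     inj_on f (carrier x) \<and> g ` carrier l = carrier m \<and>
     f ` carrier x = {v \<in> carrier l. g v = \<zero>\<^bsub>m\<^esub>}"

section \<open>Grothendieck groups\<close>

text \<open>As for the library's free Abelian groups, these groups are written multiplicatively.\<close>

definition iso_class :: "'x set \<Rightarrow> ('x \<Rightarrow> 'x \<Rightarrow> bool) \<Rightarrow> 'x \<Rightarrow> 'x set" where
  "iso_class S eqv x = {y \<in> S. eqv x y}"

abbreviation free_on_classes :: "'x set \<Rightarrow> ('x \<Rightarrow> 'x \<Rightarrow> bool) \<Rightarrow> ('x set \<Rightarrow>\<^sub>0 int) monoid" where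
  "free_on_classes S eqv \<equiv> free_Abelian_group (iso_class S eqv ` S)"

text \<open>\<open>sumrel x y z\<close> says that \<open>z\<close> is a direct sum of \<open>x\<close> and \<open>y\<close>.\<close>

definition split_relations ::
  "'x set \<Rightarrow> ('x \<Rightarrow> 'x \<Rightarrow> bool) \<Rightarrow> ('x \<Rightarrow> 'x \<Rightarrow> 'x \<Rightarrow> bool) \<Rightarrow> ('x set \<Rightarrow>\<^sub>0 int) set" where
  "split_relations S eqv sumrel = generate (free_on_classes S eqv)
     {frag_of (iso_class S eqv z) - (frag_of (iso_class S eqv x) + frag_of (iso_class S eqv y))
       | x y z. x \<in> S \<and> y \<in> S \<and> z \<in> S \<and> sumrel x y z}"

definition K0_split ::
  "'x set \<Rightarrow> ('x \<Rightarrow> 'x \<Rightarrow> bool) \<Rightarrow> ('x \<Rightarrow> 'x \<Rightarrow> 'x \<Rightarrow> bool) \<Rightarrow> ('x set \<Rightarrow>\<^sub>0 int) set monoid" where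
  "K0_split S eqv sumrel = free_on_classes S eqv Mod split_relations S eqv sumrel"

definition K0_split_class ::
  "'x set \<Rightarrow> ('x \<Rightarrow> 'x \<Rightarrow> bool) \<Rightarrow> ('x \<Rightarrow> 'x \<Rightarrow> 'x \<Rightarrow> bool) \<Rightarrow> 'x \<Rightarrow> ('x set \<Rightarrow>\<^sub>0 int) set" where
  "K0_split_class S eqv sumrel x =
     split_relations S eqv sumrel #>\<^bsub>free_on_classes S eqv\<^esub> frag_of (iso_class S eqv x)"

definition K0sp_sub :: "('o, 'm, 'k, 'z) lincat_scheme \<Rightarrow> 'o set \<Rightarrow> ('o set \<Rightarrow>\<^sub>0 int) set monoid" where
  "K0sp_sub \<C> S = K0_split S (isomorphic \<C>) (is_dsum \<C>)"

definition class_sub ::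
  "('o, 'm, 'k, 'z) lincat_scheme \<Rightarrow> 'o set \<Rightarrow> 'o \<Rightarrow> ('o set \<Rightarrow>\<^sub>0 int) set" where
  "class_sub \<C> S X = K0_split_class S (isomorphic \<C>) (is_dsum \<C>) X"

definition module_dsum ::
  "('a, 'r) ring_scheme \<Rightarrow> ('a, 'b) module \<Rightarrow> ('a, 'b) module \<Rightarrow> ('a, 'b) module \<Rightarrow> bool" where
  "module_dsum R M N L \<longleftrightarrow> module_iso R (module_prod M N) L"

definition K0sp_mod :: "('a, 'r) ring_scheme \<Rightarrow> (('a, 'b) module set \<Rightarrow>\<^sub>0 int) set monoid" where
  "K0sp_mod R = K0_split (fg_modules R) (module_iso R) (module_dsum R)"

definition class_mod ::
  "('a, 'r) ring_scheme \<Rightarrow> ('a, 'b) module \<Rightarrow> (('a, 'b) module set \<Rightarrow>\<^sub>0 int) set" where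
  "class_mod R M = K0_split_class (fg_modules R) (module_iso R) (module_dsum R) M"

definition ses_relations ::
  "('a, 'r) ring_scheme \<Rightarrow> (('a, 'b) module set \<Rightarrow>\<^sub>0 int) set set" where
  "ses_relations R = generate (K0sp_mod R)
     {class_mod R x \<otimes>\<^bsub>K0sp_mod R\<^esub> inv\<^bsub>K0sp_mod R\<^esub> class_mod R l \<otimes>\<^bsub>K0sp_mod R\<^esub> class_mod R m
       | x f l g m. module_ses R x f l g m}"

definition K0_mod :: "('a, 'r) ring_scheme \<Rightarrow> (('a, 'b) module set \<Rightarrow>\<^sub>0 int) set set monoid" where
  "K0_mod R = K0sp_mod R Mod ses_relations R"

section \<open>The functor to modules, the index and the map \<open>\<Theta>\<close>\<close>

definition endomorphism_ring :: "('o, 'm, 'k, 'z) lincat_scheme \<Rightarrow> 'o \<Rightarrow> 'm ring" where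
  "endomorphism_ring A X =
     \<lparr>carrier = Hom A X X, monoid.mult = cmp A, one = ident A X,
      ring.zero = zarr A X X, add = aplus A\<rparr>"

definition opposite_ring :: "('a, 'r) ring_scheme \<Rightarrow> ('a, 'r) ring_scheme" where
  "opposite_ring R = R\<lparr>monoid.mult := (\<lambda>a b. b \<otimes>\<^bsub>R\<^esub> a)\<rparr>"

text \<open>
  The algebra \<open>End\<^sub>A(T)\<^sup>o\<^sup>p\<^sup>p\<close>.  In what follows mod \<open>C\<close> consists of the finitely generated left
  \<open>C\<close>-modules whose elements have the type \<open>'m set\<close> of the stable morphisms.  This loses nothing:
  every finitely generated \<open>C\<close>-module is a quotient of some \<open>C\<^sup>r\<close>, which is isomorphic to
  \<open>Hom\<^sub>A(T, T\<^sup>r)\<close>, a set of elements of that type; so it is isomorphic to a module of this kind.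
\<close>

definition stable_algebra :: "('o, 'm, 'k, 'e, 'z) extcat_scheme \<Rightarrow> 'o \<Rightarrow> 'm set ring" where
  "stable_algebra E T = opposite_ring (endomorphism_ring (stable_category E) T)"

definition G_functor :: "('o, 'm, 'k, 'z) lincat_scheme \<Rightarrow> 'o \<Rightarrow> 'o \<Rightarrow> ('m, 'm) module" where
  "G_functor A T X =
     \<lparr>carrier = Hom A T X, monoid.mult = (\<lambda>_ _. undefined), one = undefined,
      ring.zero = zarr A T X, add = aplus A, smult = (\<lambda>c f. f \<bullet>\<^bsub>A\<^esub> c)\<rparr>"

text \<open>The projection functor to the stable category is the identity on objects.\<close>

definition H_functor ::
  "('o, 'm, 'k, 'e, 'z) extcat_scheme \<Rightarrow> 'o \<Rightarrow> 'o \<Rightarrow> ('m set, 'm set) module" where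
  "H_functor E T M = G_functor (stable_category E) T M"

text \<open>\<open>L 0, \<dots>, L (n - 1)\<close> are the terms from the subcategory, \<open>K 0 = M, \<dots>, K (n - 1)\<close> the
  successive kernel terms.\<close>

definition index_resolution ::
  "('o, 'm, 'k, 'e, 'z) extcat_scheme \<Rightarrow> 'o set \<Rightarrow> nat \<Rightarrow> 'o \<Rightarrow> (nat \<Rightarrow> 'o) \<Rightarrow> (nat \<Rightarrow> 'o) \<Rightarrow> bool"
  where
  "index_resolution E S n M K L \<longleftrightarrow>
     K 0 = M \<and>
     (\<forall>i < n - 1. L i \<in> S \<and>
        (\<exists>h f d. etriangle E (K (Suc i)) h (L i) f (K i) d \<and>
                 right_approx E S f \<and> right_minimal E f)) \<and>
     K (n - 1) = L (n - 1) \<and> L (n - 1) \<in> S"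

definition index ::
  "('o, 'm, 'k, 'e, 'z) extcat_scheme \<Rightarrow> 'o set \<Rightarrow> nat \<Rightarrow> 'o \<Rightarrow> ('o set \<Rightarrow>\<^sub>0 int) set" where
  "index E S n M = (SOME v. \<exists>K L. index_resolution E S n M K L \<and>
     v = finprod (K0sp_sub E S) (\<lambda>i. class_sub E S (L i) [^]\<^bsub>K0sp_sub E S\<^esub> ((-1) ^ i :: int)) {..<n})"

definition Theta ::
  "('o, 'm, 'k, 'e, 'z) extcat_scheme \<Rightarrow> 'o set \<Rightarrow> nat \<Rightarrow> 'o \<Rightarrow> ('o set \<Rightarrow>\<^sub>0 int) set" where
  "Theta E S n X = (SOME v. \<exists>X' h P f d. P \<in> projectives E \<and> etriangle E X' h P f X d \<and>
     v = index E S n X' \<otimes>\<^bsub>K0sp_sub E S\<^esub> inv\<^bsub>K0sp_sub E S\<^esub> class_sub E S P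
           \<otimes>\<^bsub>K0sp_sub E S\<^esub> index E S n X)"

end

theory Submission
  imports Defs
begin

text \<open>
  Write \<open>\<T>\<close> for \<open>add T\<close> and \<open>H\<close> for \<open>Hom(T, -)\<close> in the stable category.  The map \<open>\<Theta>\<close> sends \<open>X\<close> to
  \<open>ind X' - [P] + ind X\<close> with \<open>X'\<close> a syzygy of \<open>X\<close>, so the point is to control how the index behaves
  on \<open>\<E>\<close>-triangles, and then to present every short exact sequence of modules by a good triangle.

  The index is additive on a triangle \<open>X \<rightarrow> Y \<rightarrow> Z\<close> as soon as \<open>Hom(S, Y) \<rightarrow> Hom(S, Z)\<close> is onto for all
  \<open>S\<close> in \<open>\<T>\<close> (\<open>resolution_class_additive\<close>).  Approximations of \<open>X\<close> and \<open>Z\<close> then combine to one of \<open>Y\<close>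
  (\<open>horseshoe\<close>), the kernels form a triangle again, and since extensions of objects of \<open>\<T>\<close> by
  these kernels vanish, the condition is inherited.  Two approximations of the same object are
  compared by their pullback (\<open>pullback_of_deflations\<close>).  Both arguments run in one induction,
  which therefore also shows that all resolutions of an object have the same class.  Applied to
  \<open>X \<rightarrow> Y \<rightarrow> Z\<close> and to the triangle of syzygies, this makes \<open>\<Theta>\<close> additive whenever
  \<open>0 \<rightarrow> H X \<rightarrow> H Y \<rightarrow> H Z \<rightarrow> 0\<close> is exact: surjectivity serves for the triangle itself, and injectivity
  for the syzygies (\<open>Theta_additive\<close>).

  It remains to realize an exact sequence \<open>0 \<rightarrow> x \<rightarrow> l \<rightarrow> m \<rightarrow> 0\<close> in this way.  For \<open>n \<ge> 2\<close> the object
  representing \<open>x\<close> can be replaced by the cone \<open>X\<close> of an arrow \<open>T1 \<rightarrow> T0\<close> in \<open>\<T>\<close> (\<open>presentation\<close>), from which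
  every module homomorphism lifts to an arrow \<open>X \<rightarrow> L\<close> (\<open>full_on_presented\<close>).  The cokernel of an
  inflation \<open>X \<rightarrow> L \<oplus> J\<close> with \<open>J\<close> injective need not represent \<open>m\<close>; but \<open>H\<close> kills the suspension
  \<open>U\<close> of \<open>T1\<close>, and adding the connecting arrow \<open>X \<rightarrow> U\<close> of the cone as a further component repairs
  this (\<open>exact_triangle\<close>).  For \<open>n = 1\<close> all objects lie in \<open>\<T>\<close>, so all modules are projective, and
  the sequence splits (\<open>ses_splits\<close>).
\<close>

section \<open>Arithmetic of arrows\<close>

lemma in_Hom: "f \<in> Hom \<C> X Y \<longleftrightarrow> f \<in> arrs \<C> \<and> src \<C> f = X \<and> tgt \<C> f = Y"
  by (simp add: Hom_def)

context linear_category
begin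

lemma obj_src [simp]: "f \<in> arrs \<C> \<Longrightarrow> src \<C> f \<in> objs \<C>"
  and obj_tgt [simp]: "f \<in> arrs \<C> \<Longrightarrow> tgt \<C> f \<in> objs \<C>"
  by (simp_all add: src_obj tgt_obj)

lemma Hom_obj: "f \<in> Hom \<C> X Y \<Longrightarrow> X \<in> objs \<C> \<and> Y \<in> objs \<C>"
  by (auto simp: in_Hom)

lemma arr_cmp [simp]:
  assumes "f \<in> arrs \<C>" "g \<in> arrs \<C>" "tgt \<C> f = src \<C> g"
  shows "g \<bullet> f \<in> arrs \<C>" "src \<C> (g \<bullet> f) = src \<C> f" "tgt \<C> (g \<bullet> f) = tgt \<C> g"
  using cmp_hom[of f "src \<C> f" "tgt \<C> f" g "tgt \<C> g"] assms by (auto simp: in_Hom)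

lemma arr_ident [simp]:
  assumes "X \<in> objs \<C>"
  shows "ident \<C> X \<in> arrs \<C>" "src \<C> (ident \<C> X) = X" "tgt \<C> (ident \<C> X) = X"
  using ident_hom[OF assms] by (auto simp: in_Hom)

lemma cmp_ident [simp]:
  assumes "f \<in> arrs \<C>"
  shows "src \<C> f = X \<Longrightarrow> f \<bullet> ident \<C> X = f" "tgt \<C> f = Y \<Longrightarrow> ident \<C> Y \<bullet> f = f"
  using cmp_ident_right[of f "src \<C> f" "tgt \<C> f"] cmp_ident_left[of f "src \<C> f" "tgt \<C> f"] assms
  by (auto simp: in_Hom)

lemma cmp_assoc' [simp]:
  assumes "f \<in> arrs \<C>" "g \<in> arrs \<C>" "h \<in> arrs \<C>" "tgt \<C> f = src \<C> g" "tgt \<C> g = src \<C> h"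
  shows "(h \<bullet> g) \<bullet> f = h \<bullet> g \<bullet> f"
  using cmp_assoc[of f "src \<C> f" "tgt \<C> f" g "tgt \<C> g" h "tgt \<C> h"] assms by (auto simp: in_Hom)

lemma hom_group:
  assumes "X \<in> objs \<C>" "Y \<in> objs \<C>"
  shows "abelian_group (hom_module \<C> X Y)"
  using hom_module[OF assms] by (simp add: module_def)

lemma hom_module_simps [simp]:
  "carrier (hom_module \<C> X Y) = Hom \<C> X Y" "add (hom_module \<C> X Y) = aplus \<C>"
  "ring.zero (hom_module \<C> X Y) = zarr \<C> X Y" "smult (hom_module \<C> X Y) = ascale \<C>"
  by (simp_all add: hom_module_def)

lemma arr_plus [simp]:
  assumes "f \<in> arrs \<C>" "g \<in> arrs \<C>" "src \<C> g = src \<C> f" "tgt \<C> g = tgt \<C> f"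
  shows "aplus \<C> f g \<in> arrs \<C>" "src \<C> (aplus \<C> f g) = src \<C> f" "tgt \<C> (aplus \<C> f g) = tgt \<C> f"
proof -
  interpret abelian_group "hom_module \<C> (src \<C> f) (tgt \<C> f)" using assms by (simp add: hom_group)
  have "aplus \<C> f g \<in> Hom \<C> (src \<C> f) (tgt \<C> f)"
    using a_closed[of f g] assms by (simp add: in_Hom)
  then show "aplus \<C> f g \<in> arrs \<C>" "src \<C> (aplus \<C> f g) = src \<C> f" "tgt \<C> (aplus \<C> f g) = tgt \<C> f"
    by (auto simp: in_Hom)
qed

lemma arr_zero [simp]:
  assumes "X \<in> objs \<C>" "Y \<in> objs \<C>"
  shows "zarr \<C> X Y \<in> arrs \<C>" "src \<C> (zarr \<C> X Y) = X" "tgt \<C> (zarr \<C> X Y) = Y"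
proof -
  interpret abelian_group "hom_module \<C> X Y" using assms by (rule hom_group)
  show "zarr \<C> X Y \<in> arrs \<C>" "src \<C> (zarr \<C> X Y) = X" "tgt \<C> (zarr \<C> X Y) = Y"
    using zero_closed by (auto simp: in_Hom)
qed

text \<open>Negation as multiplication by the scalar \<open>-1\<close>: a single function on all Hom groups, which passes through
  composition by bilinearity.\<close>

definition neg :: "'m \<Rightarrow> 'm" where "neg f = ascale \<C> (\<ominus>\<^bsub>K\<^esub> \<one>\<^bsub>K\<^esub>) f"

lemma neg_eq:
  assumes "f \<in> Hom \<C> X Y" shows "neg f = \<ominus>\<^bsub>hom_module \<C> X Y\<^esub> f"
proof -
  interpret module K "hom_module \<C> X Y" using assms Hom_obj by (blast intro: hom_module)
  show ?thesis using assms smult_l_minus[of "\<one>\<^bsub>K\<^esub>" f] smult_one[of f] by (simp add: neg_def)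
qed

lemma arr_neg [simp]:
  assumes "f \<in> arrs \<C>"
  shows "neg f \<in> arrs \<C>" "src \<C> (neg f) = src \<C> f" "tgt \<C> (neg f) = tgt \<C> f"
proof -
  have f: "f \<in> Hom \<C> (src \<C> f) (tgt \<C> f)" using assms by (simp add: in_Hom)
  interpret abelian_group "hom_module \<C> (src \<C> f) (tgt \<C> f)" using assms by (simp add: hom_group)
  have "neg f \<in> Hom \<C> (src \<C> f) (tgt \<C> f)" using a_inv_closed[of f] f by (simp add: neg_eq[OF f])
  then show "neg f \<in> arrs \<C>" "src \<C> (neg f) = src \<C> f" "tgt \<C> (neg f) = tgt \<C> f"
    by (auto simp: in_Hom)
qed

lemma plus_comm:
  assumes "f \<in> arrs \<C>" "g \<in> arrs \<C>" "src \<C> g = src \<C> f" "tgt \<C> g = tgt \<C> f"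
  shows "aplus \<C> f g = aplus \<C> g f"
proof -
  interpret abelian_group "hom_module \<C> (src \<C> f) (tgt \<C> f)" using assms by (simp add: hom_group)
  show ?thesis using a_comm[of f g] assms by (simp add: in_Hom)
qed

lemma plus_assoc [simp]:
  assumes "f \<in> arrs \<C>" "g \<in> arrs \<C>" "h \<in> arrs \<C>"
    "src \<C> g = src \<C> f" "tgt \<C> g = tgt \<C> f" "src \<C> h = src \<C> f" "tgt \<C> h = tgt \<C> f"
  shows "aplus \<C> (aplus \<C> f g) h = aplus \<C> f (aplus \<C> g h)"
proof -
  interpret abelian_group "hom_module \<C> (src \<C> f) (tgt \<C> f)" using assms by (simp add: hom_group)
  show ?thesis using a_assoc[of f g h] assms by (simp add: in_Hom)
qed

lemma plus_left_comm:
  assumes "f \<in> arrs \<C>" "g \<in> arrs \<C>" "h \<in> arrs \<C>"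
    "src \<C> g = src \<C> f" "tgt \<C> g = tgt \<C> f" "src \<C> h = src \<C> f" "tgt \<C> h = tgt \<C> f"
  shows "aplus \<C> f (aplus \<C> g h) = aplus \<C> g (aplus \<C> f h)"
proof -
  have "aplus \<C> (aplus \<C> f g) h = aplus \<C> (aplus \<C> g f) h" using plus_comm[of f g] assms by simp
  then show ?thesis using assms by simp
qed

lemma plus_zero [simp]:
  assumes "f \<in> arrs \<C>" "src \<C> f = X" "tgt \<C> f = Y"
  shows "aplus \<C> f (zarr \<C> X Y) = f" "aplus \<C> (zarr \<C> X Y) f = f"
proof -
  interpret abelian_group "hom_module \<C> X Y" using assms by (auto intro: hom_group)
  show "aplus \<C> f (zarr \<C> X Y) = f" "aplus \<C> (zarr \<C> X Y) f = f"
    using r_zero[of f] l_zero[of f] assms by (simp_all add: in_Hom)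
qed

lemma plus_neg [simp]:
  assumes "f \<in> arrs \<C>"
  shows "aplus \<C> f (neg f) = zarr \<C> (src \<C> f) (tgt \<C> f)"
    "aplus \<C> (neg f) f = zarr \<C> (src \<C> f) (tgt \<C> f)"
proof -
  have f: "f \<in> Hom \<C> (src \<C> f) (tgt \<C> f)" using assms by (simp add: in_Hom)
  interpret abelian_group "hom_module \<C> (src \<C> f) (tgt \<C> f)" using assms by (simp add: hom_group)
  show "aplus \<C> f (neg f) = zarr \<C> (src \<C> f) (tgt \<C> f)"
    using r_neg[of f] f by (simp add: neg_eq[OF f])
  then show "aplus \<C> (neg f) f = zarr \<C> (src \<C> f) (tgt \<C> f)"
    using plus_comm[of f "neg f"] assms by simp
qed

lemma plus_neg_cancel [simp]:
  assumes "f \<in> arrs \<C>" "g \<in> arrs \<C>" "src \<C> g = src \<C> f" "tgt \<C> g = tgt \<C> f"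
  shows "aplus \<C> f (aplus \<C> (neg f) g) = g" "aplus \<C> (neg f) (aplus \<C> f g) = g"
  using plus_assoc[of f "neg f" g] plus_assoc[of "neg f" f g] assms by (simp_all del: plus_assoc)

lemma plus_cancel:
  assumes "f \<in> arrs \<C>" "g \<in> arrs \<C>" "h \<in> arrs \<C>"
    "src \<C> g = src \<C> f" "tgt \<C> g = tgt \<C> f" "src \<C> h = src \<C> f" "tgt \<C> h = tgt \<C> f"
  shows "aplus \<C> f g = aplus \<C> f h \<longleftrightarrow> g = h"
proof
  assume *: "aplus \<C> f g = aplus \<C> f h"
  have "g = aplus \<C> (neg f) (aplus \<C> f g)" using assms by simp
  also have "\<dots> = h" unfolding * using assms by simp
  finally show "g = h" .
qed simp

lemma eq_iff_diff_zero:
  assumes "f \<in> arrs \<C>" "g \<in> arrs \<C>" "src \<C> g = src \<C> f" "tgt \<C> g = tgt \<C> f"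
  shows "aplus \<C> f (neg g) = zarr \<C> (src \<C> f) (tgt \<C> f) \<longleftrightarrow> f = g"
proof
  assume *: "aplus \<C> f (neg g) = zarr \<C> (src \<C> f) (tgt \<C> f)"
  have "f = aplus \<C> (aplus \<C> f (neg g)) g" using assms by simp
  also have "\<dots> = g" using assms by (simp add: * del: plus_assoc)
  finally show "f = g" .
qed (use assms in simp)

lemma neg_zero [simp]:
  assumes "X \<in> objs \<C>" "Y \<in> objs \<C>" shows "neg (zarr \<C> X Y) = zarr \<C> X Y"
proof -
  have "neg (zarr \<C> X Y) = aplus \<C> (zarr \<C> X Y) (neg (zarr \<C> X Y))"
    using assms by (simp del: plus_neg)
  then show ?thesis using assms by simp
qed

lemma neg_neg [simp]:
  assumes "f \<in> arrs \<C>" shows "neg (neg f) = f"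
  using plus_neg_cancel(2)[of "neg f" f] plus_neg(1)[of "neg f"] assms
  by (metis arr_neg plus_neg(2) plus_neg_cancel(1) plus_zero(1))

lemma neg_plus [simp]:
  assumes "f \<in> arrs \<C>" "g \<in> arrs \<C>" "src \<C> g = src \<C> f" "tgt \<C> g = tgt \<C> f"
  shows "neg (aplus \<C> f g) = aplus \<C> (neg f) (neg g)"
proof -
  have "aplus \<C> (aplus \<C> f g) (aplus \<C> (neg f) (neg g)) = zarr \<C> (src \<C> f) (tgt \<C> f)"
    using assms plus_left_comm[of g "neg f" "neg g"] by simp
  then show ?thesis
    using plus_cancel[of "aplus \<C> f g" "neg (aplus \<C> f g)" "aplus \<C> (neg f) (neg g)"] assms
    by (simp del: plus_assoc)
qed

lemma cmp_plus [simp]: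
  assumes "f \<in> arrs \<C>" "f' \<in> arrs \<C>" "src \<C> f' = src \<C> f" "tgt \<C> f' = tgt \<C> f"
  shows "g \<in> arrs \<C> \<Longrightarrow> src \<C> g = tgt \<C> f \<Longrightarrow> g \<bullet> aplus \<C> f f' = aplus \<C> (g \<bullet> f) (g \<bullet> f')"
    "h \<in> arrs \<C> \<Longrightarrow> tgt \<C> h = src \<C> f \<Longrightarrow> aplus \<C> f f' \<bullet> h = aplus \<C> (f \<bullet> h) (f' \<bullet> h)"
  using cmp_plus_right[of f "src \<C> f" "tgt \<C> f" f' g "tgt \<C> g"]
    cmp_plus_left[of h "src \<C> h" "src \<C> f" f "tgt \<C> f" f'] assms by (auto simp: in_Hom)

lemma cmp_neg [simp]:
  assumes "f \<in> arrs \<C>" "g \<in> arrs \<C>" "src \<C> g = tgt \<C> f"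
  shows "g \<bullet> neg f = neg (g \<bullet> f)" "neg g \<bullet> f = neg (g \<bullet> f)"
proof -
  have "\<ominus>\<^bsub>K\<^esub> \<one>\<^bsub>K\<^esub> \<in> carrier K" by simp
  then show "g \<bullet> neg f = neg (g \<bullet> f)" "neg g \<bullet> f = neg (g \<bullet> f)"
    using cmp_scale_right[of _ f "src \<C> f" "tgt \<C> f" g "tgt \<C> g"]
      cmp_scale_left[of _ f "src \<C> f" "tgt \<C> f" g "tgt \<C> g"] assms
    unfolding neg_def by (auto simp: in_Hom)
qed

lemma cmp_zero [simp]:
  assumes "f \<in> arrs \<C>"
  shows "tgt \<C> f = X \<Longrightarrow> Y \<in> objs \<C> \<Longrightarrow> zarr \<C> X Y \<bullet> f = zarr \<C> (src \<C> f) Y"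
    "src \<C> f = Y \<Longrightarrow> X \<in> objs \<C> \<Longrightarrow> f \<bullet> zarr \<C> X Y = zarr \<C> X (tgt \<C> f)"
proof -
  show "zarr \<C> X Y \<bullet> f = zarr \<C> (src \<C> f) Y" if "tgt \<C> f = X" "Y \<in> objs \<C>"
  proof -
    have X: "X \<in> objs \<C>" using that assms by auto
    have "aplus \<C> (zarr \<C> X Y) (neg (zarr \<C> X Y)) \<bullet> f
        = aplus \<C> (zarr \<C> X Y \<bullet> f) (neg (zarr \<C> X Y \<bullet> f))"
      using that assms X by (subst cmp_plus) (simp_all del: neg_zero)
    then show ?thesis using that assms X by (simp del: neg_zero)
  qed
  show "f \<bullet> zarr \<C> X Y = zarr \<C> X (tgt \<C> f)" if "src \<C> f = Y" "X \<in> objs \<C>"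
  proof -
    have Y: "Y \<in> objs \<C>" using that assms by auto
    have "f \<bullet> aplus \<C> (zarr \<C> X Y) (neg (zarr \<C> X Y))
        = aplus \<C> (f \<bullet> zarr \<C> X Y) (neg (f \<bullet> zarr \<C> X Y))"
      using that assms Y by (subst cmp_plus) (simp_all del: neg_zero)
    then show ?thesis using that assms Y by (simp del: neg_zero)
  qed
qed

lemma is_isoI:
  assumes "f \<in> Hom \<C> X Y" "g \<in> Hom \<C> Y X" "h \<in> Hom \<C> Y X"
    "g \<bullet> f = ident \<C> X" "f \<bullet> h = ident \<C> Y"
  shows "is_iso \<C> f"
proof -
  have "g = g \<bullet> f \<bullet> h" using assms by (simp add: in_Hom)
  also have "\<dots> = (g \<bullet> f) \<bullet> h" using assms(1-3) by (subst cmp_assoc') (auto simp: in_Hom)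
  also have "\<dots> = h" using assms by (simp add: in_Hom del: cmp_assoc')
  finally show ?thesis using assms by (auto simp: is_iso_def in_Hom intro!: bexI[of _ g])
qed

lemma is_isoE:
  assumes "is_iso \<C> f" "f \<in> Hom \<C> X Y"
  obtains g where "g \<in> Hom \<C> Y X" "g \<bullet> f = ident \<C> X" "f \<bullet> g = ident \<C> Y"
  using assms by (auto simp: is_iso_def in_Hom)

lemma finsum_closed_under:
  assumes "X \<in> objs \<C>" "Y \<in> objs \<C>" "finite A"
    and F: "\<And>a. a \<in> A \<Longrightarrow> F a \<in> Hom \<C> X Y" "\<And>a. a \<in> A \<Longrightarrow> P (F a)"
    and P: "P (zarr \<C> X Y)"
      "\<And>f g. f \<in> Hom \<C> X Y \<Longrightarrow> g \<in> Hom \<C> X Y \<Longrightarrow> P f \<Longrightarrow> P g \<Longrightarrow> P (aplus \<C> f g)"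
  shows "P (finsum (hom_module \<C> X Y) F A)"
proof -
  interpret abelian_group "hom_module \<C> X Y" using assms(1,2) by (rule hom_group)
  have "finsum (hom_module \<C> X Y) F B \<in> Hom \<C> X Y \<and> P (finsum (hom_module \<C> X Y) F B)"
    if "finite B" "B \<subseteq> A" for B
    using that
  proof (induction B rule: finite_induct)
    case empty
    then show ?case using P(1) zero_closed by simp
  next
    case (insert b B)
    have "F \<in> B \<rightarrow> carrier (hom_module \<C> X Y)" "F b \<in> carrier (hom_module \<C> X Y)"
      using F insert.prems by auto
    then have "finsum (hom_module \<C> X Y) F (insert b B) = aplus \<C> (F b) (finsum (hom_module \<C> X Y) F B)"
      using insert.hyps by (simp add: finsum_insert)
    then show ?case using insert F P(2) a_closed[of "F b" "finsum (hom_module \<C> X Y) F B"] by simp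
  qed
  from this[OF assms(3)] show ?thesis by simp
qed

text \<open>
  An object of \<open>add T\<close> is visible from \<open>T\<close>: its identity is a sum of endomorphisms that factor
  through \<open>T\<close>.  So a property that is stable under sums holds for the identity as soon as it holds
  for the arrows passing through \<open>T\<close>.
\<close>

lemma add_closure_induct:
  assumes S: "S \<in> add_closure \<C> T"
    and uv: "\<And>u v. u \<in> Hom \<C> T S \<Longrightarrow> v \<in> Hom \<C> S T \<Longrightarrow> P (u \<bullet> v)"
    and zero: "P (zarr \<C> S S)"
    and plus: "\<And>f g. f \<in> Hom \<C> S S \<Longrightarrow> g \<in> Hom \<C> S S \<Longrightarrow> P f \<Longrightarrow> P g \<Longrightarrow> P (aplus \<C> f g)"
  shows "P (ident \<C> S)"
proof -
  obtain Ws where W: "\<forall>W \<in> set Ws. is_summand \<C> W T" and "is_finite_dsum \<C> Ws S"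
    using S by (auto simp: add_closure_def)
  then obtain \<iota> \<pi> where S: "S \<in> objs \<C>"
    and ip: "\<And>a. a < length Ws \<Longrightarrow> \<iota> a \<in> Hom \<C> (Ws ! a) S \<and> \<pi> a \<in> Hom \<C> S (Ws ! a)"
    and sum: "finsum (hom_module \<C> S S) (\<lambda>a. \<iota> a \<bullet> \<pi> a) {..<length Ws} = ident \<C> S"
    unfolding is_finite_dsum_def by metis
  have "P (finsum (hom_module \<C> S S) (\<lambda>a. \<iota> a \<bullet> \<pi> a) {..<length Ws})"
  proof (rule finsum_closed_under[OF S S finite_lessThan _ _ zero plus])
    fix a assume "a \<in> {..<length Ws}"
    then have a: "a < length Ws" by simp
    then show "\<iota> a \<bullet> \<pi> a \<in> Hom \<C> S S" using ip[OF a] by (auto simp: in_Hom)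
    obtain W' i j p q where b: "biproduct \<C> (Ws ! a) W' T i j p q"
      using W a nth_mem unfolding is_summand_def is_dsum_def by meson
    have "\<iota> a \<bullet> \<pi> a = (\<iota> a \<bullet> p) \<bullet> (i \<bullet> \<pi> a)"
    proof -
      have "p \<bullet> i \<bullet> \<pi> a = (p \<bullet> i) \<bullet> \<pi> a"
        using b ip[OF a] by (subst cmp_assoc') (simp_all add: biproduct_def in_Hom)
      also have "\<dots> = \<pi> a" using b ip[OF a] by (simp add: biproduct_def in_Hom)
      finally show ?thesis using b ip[OF a] by (simp add: biproduct_def in_Hom)
    qed
    moreover have "\<iota> a \<bullet> p \<in> Hom \<C> T S" "i \<bullet> \<pi> a \<in> Hom \<C> S T"
      using b ip[OF a] by (auto simp: biproduct_def in_Hom)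
    ultimately show "P (\<iota> a \<bullet> \<pi> a)" using uv by simp
  qed
  then show ?thesis by (simp add: sum)
qed

text \<open>Composites are normalized by nesting to the right, where an equation \<open>p i = k\<close> has no instance of its
  left-hand side inside \<open>p (i f)\<close>.  The next rules supply the equations with the further factor.\<close>

lemma cmp_cancel_middle:
  assumes "p \<bullet> i = ident \<C> X" "i \<in> Hom \<C> X Z" "p \<in> Hom \<C> Z X"
  shows "f \<in> arrs \<C> \<Longrightarrow> tgt \<C> f = X \<Longrightarrow> p \<bullet> i \<bullet> f = f"
proof -
  assume f: "f \<in> arrs \<C>" "tgt \<C> f = X"
  have "p \<bullet> i \<bullet> f = (p \<bullet> i) \<bullet> f" using assms(2,3) f by (simp add: in_Hom)
  then show ?thesis using assms f by simp
qed

lemma cmp_zero_middle: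
  assumes "p \<bullet> i = zarr \<C> X W" "i \<in> Hom \<C> X Z" "p \<in> Hom \<C> Z W"
  shows "f \<in> arrs \<C> \<Longrightarrow> tgt \<C> f = X \<Longrightarrow> p \<bullet> i \<bullet> f = zarr \<C> (src \<C> f) W"
proof -
  assume f: "f \<in> arrs \<C>" "tgt \<C> f = X"
  have "p \<bullet> i \<bullet> f = (p \<bullet> i) \<bullet> f" using assms(2,3) f by (simp add: in_Hom)
  then show ?thesis using assms f by (auto simp: in_Hom simp del: cmp_assoc')
qed

lemma cmp_reduce:
  assumes "g \<bullet> f = k" "f \<in> Hom \<C> X Y" "g \<in> Hom \<C> Y Z"
  shows "h \<in> arrs \<C> \<Longrightarrow> tgt \<C> h = X \<Longrightarrow> g \<bullet> f \<bullet> h = k \<bullet> h"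
proof -
  assume h: "h \<in> arrs \<C>" "tgt \<C> h = X"
  have "g \<bullet> f \<bullet> h = (g \<bullet> f) \<bullet> h" using assms(2-) h by (simp add: in_Hom)
  then show ?thesis by (simp only: assms(1))
qed

lemma biproductD:
  assumes "biproduct \<C> X Y Z i j p q"
  shows "X \<in> objs \<C>" "Y \<in> objs \<C>" "Z \<in> objs \<C>"
    "i \<in> Hom \<C> X Z" "j \<in> Hom \<C> Y Z" "p \<in> Hom \<C> Z X" "q \<in> Hom \<C> Z Y"
    "p \<bullet> i = ident \<C> X" "q \<bullet> j = ident \<C> Y" "q \<bullet> i = zarr \<C> X Y" "p \<bullet> j = zarr \<C> Y X"
    "aplus \<C> (i \<bullet> p) (j \<bullet> q) = ident \<C> Z"
  using assms by (simp_all add: biproduct_def)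

lemma cmp_eq_middle:
  assumes "g \<bullet> f = g' \<bullet> f'" "f \<in> Hom \<C> X Y" "g \<in> Hom \<C> Y Z" "f' \<in> Hom \<C> X Y'" "g' \<in> Hom \<C> Y' Z"
  shows "h \<in> arrs \<C> \<Longrightarrow> tgt \<C> h = X \<Longrightarrow> g \<bullet> f \<bullet> h = g' \<bullet> f' \<bullet> h"
proof -
  assume h: "h \<in> arrs \<C>" "tgt \<C> h = X"
  have "g \<bullet> f \<bullet> h = (g \<bullet> f) \<bullet> h" using assms(2-) h by (simp add: in_Hom)
  also have "\<dots> = g' \<bullet> f' \<bullet> h" unfolding assms(1) using assms(2-) h by (simp add: in_Hom)
  finally show ?thesis .
qed

end

section \<open>Minimal approximations in Krull--Schmidt categories\<close>

context linear_category
begin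

text \<open>The Jacobson radical of the category.\<close>

definition radical :: "'m \<Rightarrow> bool" where
  "radical f \<longleftrightarrow> f \<in> arrs \<C> \<and>
     (\<forall>h \<in> Hom \<C> (tgt \<C> f) (src \<C> f). is_iso \<C> (aplus \<C> (ident \<C> (src \<C> f)) (neg (h \<bullet> f))))"

lemma radicalD:
  assumes "radical f" "f \<in> Hom \<C> X Y" "h \<in> Hom \<C> Y X"
  shows "is_iso \<C> (aplus \<C> (ident \<C> X) (neg (h \<bullet> f)))"
  using assms by (auto simp: radical_def in_Hom)

lemma radical_zero:
  assumes "X \<in> objs \<C>" "Y \<in> objs \<C>" shows "radical (zarr \<C> X Y)"
  using assms is_isoI[of "ident \<C> X" X X "ident \<C> X" "ident \<C> X"]
  by (auto simp: radical_def in_Hom)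

lemma iso_cmp:
  assumes "is_iso \<C> f" "f \<in> Hom \<C> X Y" "is_iso \<C> g" "g \<in> Hom \<C> Y Z" shows "is_iso \<C> (g \<bullet> f)"
proof -
  obtain f' where f': "f' \<in> Hom \<C> Y X" "f' \<bullet> f = ident \<C> X" "f \<bullet> f' = ident \<C> Y"
    using is_isoE[OF assms(1,2)] .
  obtain g' where g': "g' \<in> Hom \<C> Z Y" "g' \<bullet> g = ident \<C> Y" "g \<bullet> g' = ident \<C> Z"
    using is_isoE[OF assms(3,4)] .
  show ?thesis
  proof (rule is_isoI)
    show "g \<bullet> f \<in> Hom \<C> X Z" "f' \<bullet> g' \<in> Hom \<C> Z X" "f' \<bullet> g' \<in> Hom \<C> Z X"
      using assms(2,4) f' g' by (simp_all add: in_Hom)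
    show "(f' \<bullet> g') \<bullet> g \<bullet> f = ident \<C> X" "(g \<bullet> f) \<bullet> f' \<bullet> g' = ident \<C> Z"
      using assms(2,4) f' g' cmp_cancel_middle[OF g'(2) assms(4) g'(1)]
        cmp_cancel_middle[OF f'(3) f'(1) assms(2)] by (simp_all add: in_Hom)
  qed
qed

lemma radical_plus:
  assumes r: "radical f" "radical g" and f: "f \<in> Hom \<C> X Y" "g \<in> Hom \<C> X Y"
  shows "radical (aplus \<C> f g)"
proof -
  have "is_iso \<C> (aplus \<C> (ident \<C> X) (neg (h \<bullet> aplus \<C> f g)))" if h: "h \<in> Hom \<C> Y X" for h
  proof -
    have X: "X \<in> objs \<C>" using Hom_obj[OF f(1)] by simp
    define u where "u = aplus \<C> (ident \<C> X) (neg (h \<bullet> f))"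
    have u: "u \<in> Hom \<C> X X" "is_iso \<C> u"
      using radicalD[OF r(1) f(1) h] f h X by (simp_all add: u_def in_Hom)
    obtain u' where u': "u' \<in> Hom \<C> X X" "u' \<bullet> u = ident \<C> X" "u \<bullet> u' = ident \<C> X"
      using is_isoE[OF u(2,1)] .
    define v where "v = aplus \<C> (ident \<C> X) (neg ((u' \<bullet> h) \<bullet> g))"
    have uh: "u' \<bullet> h \<in> Hom \<C> Y X" using u' h by (simp add: in_Hom)
    have v: "v \<in> Hom \<C> X X" "is_iso \<C> v"
      using radicalD[OF r(2) f(2) uh] f h X u' by (simp_all add: v_def in_Hom)
    have "u \<bullet> v = aplus \<C> u (neg (h \<bullet> g))"
      using cmp_cancel_middle[OF u'(3) u'(1) u(1)] u(1) u'(1) f h X by (simp add: v_def in_Hom)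
    also have "\<dots> = aplus \<C> (ident \<C> X) (neg (h \<bullet> aplus \<C> f g))"
      using f h X by (simp add: u_def in_Hom)
    finally show ?thesis using iso_cmp[OF v(2,1) u(2,1)] by simp
  qed
  then show ?thesis using f by (simp add: radical_def in_Hom)
qed

lemma radical_left:
  assumes r: "radical f" and f: "f \<in> Hom \<C> X Y" and g: "g \<in> Hom \<C> Y Z"
  shows "radical (g \<bullet> f)"
proof -
  have "is_iso \<C> (aplus \<C> (ident \<C> X) (neg (h \<bullet> g \<bullet> f)))" if h: "h \<in> Hom \<C> Z X" for h
    using radicalD[OF r f, of "h \<bullet> g"] f g h by (simp add: in_Hom)
  then show ?thesis using f g by (simp add: radical_def in_Hom)
qed

text \<open>The inverse of \<open>1 - h f a\<close> is \<open>1 + h f v a\<close> with \<open>v\<close> the inverse of \<open>1 - a h f\<close>.\<close>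

lemma radical_right:
  assumes r: "radical f" and f: "f \<in> Hom \<C> X Y" and a: "a \<in> Hom \<C> W X"
  shows "radical (f \<bullet> a)"
proof -
  have "is_iso \<C> (aplus \<C> (ident \<C> W) (neg (h \<bullet> f \<bullet> a)))" if h: "h \<in> Hom \<C> Y W" for h
  proof -
    have obj: "X \<in> objs \<C>" "W \<in> objs \<C>" using Hom_obj[OF f] Hom_obj[OF a] by auto
    have ah: "a \<bullet> h \<in> Hom \<C> Y X" using a h by (simp add: in_Hom)
    define u where "u = aplus \<C> (ident \<C> X) (neg (a \<bullet> h \<bullet> f))"
    have u: "u \<in> Hom \<C> X X" "is_iso \<C> u"
      using radicalD[OF r f ah] f h a obj by (simp_all add: u_def in_Hom)
    obtain v where v: "v \<in> Hom \<C> X X" "v \<bullet> u = ident \<C> X" "u \<bullet> v = ident \<C> X"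
      using is_isoE[OF u(2,1)] .
    have vl: "aplus \<C> v (neg (v \<bullet> a \<bullet> h \<bullet> f)) = ident \<C> X"
      using v(2) v(1) f h a obj by (simp add: u_def in_Hom)
    have vr: "aplus \<C> v (neg (a \<bullet> h \<bullet> f \<bullet> v)) = ident \<C> X"
      using v(3) v(1) f h a obj by (simp add: u_def in_Hom)
    have 1: "aplus \<C> (h \<bullet> f \<bullet> v \<bullet> a) (neg (h \<bullet> f \<bullet> v \<bullet> a \<bullet> h \<bullet> f \<bullet> a)) = h \<bullet> f \<bullet> a"
    proof -
      have "h \<bullet> f \<bullet> aplus \<C> v (neg (v \<bullet> a \<bullet> h \<bullet> f)) \<bullet> a = h \<bullet> f \<bullet> a"
        unfolding vl using f h a by (simp add: in_Hom)
      then show ?thesis using v(1) f h a by (simp add: in_Hom)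
    qed
    have 2: "aplus \<C> (h \<bullet> f \<bullet> v \<bullet> a) (neg (h \<bullet> f \<bullet> a \<bullet> h \<bullet> f \<bullet> v \<bullet> a)) = h \<bullet> f \<bullet> a"
    proof -
      have "h \<bullet> f \<bullet> aplus \<C> v (neg (a \<bullet> h \<bullet> f \<bullet> v)) \<bullet> a = h \<bullet> f \<bullet> a"
        unfolding vr using f h a by (simp add: in_Hom)
      then show ?thesis using v(1) f h a by (simp add: in_Hom)
    qed
    define i where "i = aplus \<C> (ident \<C> W) (h \<bullet> f \<bullet> v \<bullet> a)"
    have i: "i \<in> Hom \<C> W W" using v(1) f h a obj by (simp add: i_def in_Hom)
    define e where "e = aplus \<C> (ident \<C> W) (neg (h \<bullet> f \<bullet> a))"
    have e: "e \<in> Hom \<C> W W" using f h a obj by (simp add: e_def in_Hom)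
    have "i \<bullet> e = aplus \<C> (ident \<C> W) (aplus \<C> (neg (h \<bullet> f \<bullet> a))
      (aplus \<C> (h \<bullet> f \<bullet> v \<bullet> a) (neg (h \<bullet> f \<bullet> v \<bullet> a \<bullet> h \<bullet> f \<bullet> a))))"
      using v(1) f h a obj
      by (simp add: i_def e_def in_Hom plus_left_comm[of "h \<bullet> f \<bullet> v \<bullet> a" "neg (h \<bullet> f \<bullet> a)"])
    then have ie: "i \<bullet> e = ident \<C> W" unfolding 1 using f h a obj by (simp add: in_Hom)
    have "e \<bullet> i = aplus \<C> (ident \<C> W) (aplus \<C> (neg (h \<bullet> f \<bullet> a))
      (aplus \<C> (h \<bullet> f \<bullet> v \<bullet> a) (neg (h \<bullet> f \<bullet> a \<bullet> h \<bullet> f \<bullet> v \<bullet> a))))"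
      using v(1) f h a obj
      by (simp add: i_def e_def in_Hom plus_left_comm[of "h \<bullet> f \<bullet> v \<bullet> a" "neg (h \<bullet> f \<bullet> a)"])
    then have ei: "e \<bullet> i = ident \<C> W" unfolding 2 using f h a obj by (simp add: in_Hom)
    show ?thesis using is_isoI[OF e i i ie ei] by (simp add: e_def)
  qed
  then show ?thesis using f a by (simp add: radical_def in_Hom)
qed

text \<open>One of \<open>e\<close> and \<open>1 - e\<close> is invertible, and their product is zero.\<close>

lemma local_idempotent:
  assumes Y: "Y \<in> objs \<C>" "local_endomorphism_ring \<C> Y" and e: "e \<in> Hom \<C> Y Y" "e \<bullet> e = e"
  shows "e = ident \<C> Y \<or> e = zarr \<C> Y Y"
proof -
  define f where "f = aplus \<C> (ident \<C> Y) (neg e)"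
  have f: "f \<in> Hom \<C> Y Y" using e Y by (simp add: f_def in_Hom)
  have sum: "aplus \<C> e f = ident \<C> Y"
    using e Y plus_left_comm[of e "ident \<C> Y" "neg e"] by (simp add: f_def in_Hom)
  have "is_iso \<C> (ident \<C> Y)" using is_isoI[of "ident \<C> Y" Y Y] Y by (simp add: in_Hom)
  then have "is_iso \<C> e \<or> is_iso \<C> f" using Y(2) e f sum by (metis local_endomorphism_ring_def)
  then show ?thesis
  proof
    assume "is_iso \<C> e"
    then obtain i where i: "i \<in> Hom \<C> Y Y" "i \<bullet> e = ident \<C> Y" using is_isoE e(1) by blast
    have "e = i \<bullet> e \<bullet> e" using cmp_cancel_middle[OF i(2) e(1) i(1)] e(1) by (simp add: in_Hom)
    then show ?thesis using e i by simp
  next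
    assume "is_iso \<C> f"
    then obtain i where i: "i \<in> Hom \<C> Y Y" "i \<bullet> f = ident \<C> Y" using is_isoE f by blast
    have fe: "f \<bullet> e = zarr \<C> Y Y" using e Y by (simp add: f_def in_Hom)
    have "e = i \<bullet> f \<bullet> e" using cmp_cancel_middle[OF i(2) f i(1)] e(1) by (simp add: in_Hom)
    also have "\<dots> = zarr \<C> Y Y" unfolding fe using i(1) Y by (simp add: in_Hom)
    finally show ?thesis by simp
  qed
qed

text \<open>If \<open>1 - h g\<close> were not invertible for some \<open>h\<close>, then \<open>h g\<close> would be, as the two sum to \<open>1\<close>.  With \<open>i\<close> its
  inverse, \<open>g i h\<close> is an idempotent endomorphism of \<open>Y\<close>, hence \<open>0\<close> or \<open>1\<close>; the first makes \<open>X\<close> zero and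
  the second makes \<open>g\<close> invertible.\<close>

lemma radical_local:
  assumes X: "local_endomorphism_ring \<C> X" and Y: "local_endomorphism_ring \<C> Y"
    and g: "g \<in> Hom \<C> X Y" "\<not> is_iso \<C> g"
  shows "radical g"
proof -
  have "is_iso \<C> (aplus \<C> (ident \<C> X) (neg (h \<bullet> g)))" if h: "h \<in> Hom \<C> Y X" for h
  proof (rule ccontr)
    assume n: "\<not> is_iso \<C> (aplus \<C> (ident \<C> X) (neg (h \<bullet> g)))"
    have obj: "X \<in> objs \<C>" "Y \<in> objs \<C>" using Hom_obj[OF g(1)] by auto
    have hg: "h \<bullet> g \<in> Hom \<C> X X" using g h by (simp add: in_Hom)
    have f: "aplus \<C> (ident \<C> X) (neg (h \<bullet> g)) \<in> Hom \<C> X X" using g h obj by (simp add: in_Hom)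
    have sum: "aplus \<C> (h \<bullet> g) (aplus \<C> (ident \<C> X) (neg (h \<bullet> g))) = ident \<C> X"
      using g h obj plus_left_comm[of "h \<bullet> g" "ident \<C> X" "neg (h \<bullet> g)"] by (simp add: in_Hom)
    have "is_iso \<C> (ident \<C> X)" using is_isoI[of "ident \<C> X" X X] obj by (simp add: in_Hom)
    then have "is_iso \<C> (h \<bullet> g)" using X hg f n sum by (metis local_endomorphism_ring_def)
    then obtain i where i: "i \<in> Hom \<C> X X" "i \<bullet> h \<bullet> g = ident \<C> X" using is_isoE hg by metis
    have ih: "(i \<bullet> h) \<bullet> g = ident \<C> X" "i \<bullet> h \<in> Hom \<C> Y X" using i g h by (simp_all add: in_Hom)
    define e where "e = g \<bullet> i \<bullet> h"
    have e: "e \<in> Hom \<C> Y Y" using i g h by (simp add: e_def in_Hom)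
    have ege: "e \<bullet> g = g" using cmp_ident_right i g h by (simp add: e_def in_Hom)
    then have "e \<bullet> e = e" using cmp_reduce[OF ege g(1) e, of "i \<bullet> h"] i g h by (simp add: e_def in_Hom)
    then have "e = ident \<C> Y \<or> e = zarr \<C> Y Y" using local_idempotent[OF obj(2) Y e] by simp
    then show False
    proof
      assume "e = ident \<C> Y"
      then have "is_iso \<C> g" using is_isoI[OF g(1) ih(2,2) ih(1)] by (simp add: e_def)
      then show False using g by simp
    next
      assume "e = zarr \<C> Y Y"
      then have "g = zarr \<C> X Y" using ege g(1) obj by (auto simp: in_Hom)
      then have "ident \<C> X = zarr \<C> X X" using ih obj by (simp add: in_Hom)
      then show False using X by (simp add: local_endomorphism_ring_def)
    qed
  qed
  then show ?thesis using g by (simp add: radical_def in_Hom)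
qed

end

context additive_category
begin

text \<open>\<open>Z\<close> is the part of the direct sum \<open>L\<close> with the summands in \<open>J\<close>; \<open>e\<close> and \<open>r\<close> are its
  inclusion and projection.\<close>

definition partial_sum where
  "partial_sum L \<iota> \<pi> J Z e r \<longleftrightarrow> e \<in> Hom \<C> Z L \<and> r \<in> Hom \<C> L Z \<and> r \<bullet> e = ident \<C> Z \<and>
     e \<bullet> r = finsum (hom_module \<C> L L) (\<lambda>a. \<iota> a \<bullet> \<pi> a) J"

text \<open>Built up summand by summand from biproducts, since the idempotent \<open>e r\<close> is not known to split beforehand.\<close>

lemma ex_partial_sum:
  assumes L: "L \<in> objs \<C>" and J: "finite J"
    and ip: "\<And>a. a \<in> J \<Longrightarrow> \<iota> a \<in> Hom \<C> (W a) L \<and> \<pi> a \<in> Hom \<C> L (W a)"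
    and orth: "\<And>a b. a \<in> J \<Longrightarrow> b \<in> J \<Longrightarrow>
      \<pi> a \<bullet> \<iota> b = (if a = b then ident \<C> (W a) else zarr \<C> (W b) (W a))"
  shows "\<exists>Z e r. partial_sum L \<iota> \<pi> J Z e r"
  using J ip orth
proof (induction J rule: finite_induct)
  case empty
  interpret L: abelian_group "hom_module \<C> L L" using L L by (rule hom_group)
  obtain Q where Q: "Q \<in> objs \<C>" "ident \<C> Q = zarr \<C> Q Q" using zero_object by auto
  have "partial_sum L \<iota> \<pi> {} Q (zarr \<C> Q L) (zarr \<C> L Q)"
    using L Q by (simp add: partial_sum_def in_Hom)
  then show ?case by blast
next
  case (insert k J)
  interpret L: abelian_group "hom_module \<C> L L" using L L by (rule hom_group)
  obtain Z e r where z: "partial_sum L \<iota> \<pi> J Z e r" using insert by auto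
  have e: "e \<in> Hom \<C> Z L" "r \<in> Hom \<C> L Z" "r \<bullet> e = ident \<C> Z"
    and er: "e \<bullet> r = finsum (hom_module \<C> L L) (\<lambda>a. \<iota> a \<bullet> \<pi> a) J"
    using z by (simp_all add: partial_sum_def)
  have k: "\<iota> k \<in> Hom \<C> (W k) L" "\<pi> k \<in> Hom \<C> L (W k)" "\<pi> k \<bullet> \<iota> k = ident \<C> (W k)"
    using insert by auto
  have obj: "Z \<in> objs \<C>" "W k \<in> objs \<C>" using Hom_obj[OF k(1)] Hom_obj[OF e(1)] by auto
  have tp: "\<And>a. a \<in> J \<Longrightarrow> \<iota> a \<bullet> \<pi> a \<in> Hom \<C> L L" using insert.prems(1) by (auto simp: in_Hom)
  have "finsum (hom_module \<C> L L) (\<lambda>a. \<iota> a \<bullet> \<pi> a) J \<bullet> \<iota> k = zarr \<C> (W k) L"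
  proof (rule finsum_closed_under[OF L L insert.hyps(1) tp])
    show "(\<iota> a \<bullet> \<pi> a) \<bullet> \<iota> k = zarr \<C> (W k) L" if a: "a \<in> J" for a
    proof -
      have "a \<noteq> k" using a insert.hyps(2) by auto
      then have "\<pi> a \<bullet> \<iota> k = zarr \<C> (W k) (W a)" using insert.prems(2)[of a k] a by simp
      moreover have "\<iota> a \<in> Hom \<C> (W a) L" "\<pi> a \<in> Hom \<C> L (W a)" using insert.prems(1) a by auto
      moreover have "W a \<in> objs \<C>" using Hom_obj[OF \<open>\<iota> a \<in> Hom \<C> (W a) L\<close>] by simp
      ultimately show ?thesis using k obj by (simp add: in_Hom)
    qed
    show "zarr \<C> L L \<bullet> \<iota> k = zarr \<C> (W k) L" using k L by (simp add: in_Hom)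
    show "aplus \<C> f g \<bullet> \<iota> k = zarr \<C> (W k) L"
      if "f \<in> Hom \<C> L L" "g \<in> Hom \<C> L L" "f \<bullet> \<iota> k = zarr \<C> (W k) L" "g \<bullet> \<iota> k = zarr \<C> (W k) L" for f g
      using that k L obj by (simp add: in_Hom)
  qed
  then have erk: "e \<bullet> r \<bullet> \<iota> k = zarr \<C> (W k) L" using e k er[symmetric] by (simp add: in_Hom)
  have "r \<bullet> \<iota> k = r \<bullet> e \<bullet> r \<bullet> \<iota> k"
    using cmp_cancel_middle[OF e(3,1,2), of "r \<bullet> \<iota> k"] e k by (simp add: in_Hom)
  then have rk: "r \<bullet> \<iota> k = zarr \<C> (W k) Z" unfolding erk using e obj by (simp add: in_Hom)
  have "\<pi> k \<bullet> finsum (hom_module \<C> L L) (\<lambda>a. \<iota> a \<bullet> \<pi> a) J = zarr \<C> L (W k)"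
  proof (rule finsum_closed_under[OF L L insert.hyps(1) tp])
    show "\<pi> k \<bullet> \<iota> a \<bullet> \<pi> a = zarr \<C> L (W k)" if a: "a \<in> J" for a
    proof -
      have "a \<noteq> k" using a insert.hyps(2) by auto
      then have z: "\<pi> k \<bullet> \<iota> a = zarr \<C> (W a) (W k)" using insert.prems(2)[of k a] a by simp
      have t: "\<iota> a \<in> Hom \<C> (W a) L" "\<pi> a \<in> Hom \<C> L (W a)" using insert.prems(1) a by auto
      show ?thesis using cmp_zero_middle[OF z t(1) k(2), of "\<pi> a"] t by (simp add: in_Hom)
    qed
    show "\<pi> k \<bullet> zarr \<C> L L = zarr \<C> L (W k)" using k L by (simp add: in_Hom)
    show "\<pi> k \<bullet> aplus \<C> f g = zarr \<C> L (W k)"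
      if "f \<in> Hom \<C> L L" "g \<in> Hom \<C> L L" "\<pi> k \<bullet> f = zarr \<C> L (W k)" "\<pi> k \<bullet> g = zarr \<C> L (W k)" for f g
      using that k L obj by (simp add: in_Hom)
  qed
  then have ker: "\<pi> k \<bullet> e \<bullet> r = zarr \<C> L (W k)" by (simp add: er)
  have "\<pi> k \<bullet> e = (\<pi> k \<bullet> e \<bullet> r) \<bullet> e" using e k by (simp add: in_Hom)
  then have ke: "\<pi> k \<bullet> e = zarr \<C> Z (W k)" unfolding ker using e obj by (simp add: in_Hom)
  obtain Y i j p q where b: "biproduct \<C> Z (W k) Y i j p q"
    using biproducts[OF obj] by (auto simp: is_dsum_def)
  note B = biproductD[OF b]
  define e' where "e' = aplus \<C> (e \<bullet> p) (\<iota> k \<bullet> q)"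
  define r' where "r' = aplus \<C> (i \<bullet> r) (j \<bullet> \<pi> k)"
  have 1: "e' \<in> Hom \<C> Y L" "r' \<in> Hom \<C> L Y" using e k B by (simp_all add: e'_def r'_def in_Hom)
  have "r' \<bullet> e' = aplus \<C> (i \<bullet> p) (j \<bullet> q)"
    using B(1-11) e k obj cmp_cancel_middle[OF e(3,1,2), of p] cmp_cancel_middle[OF k(3,1,2), of q]
      cmp_zero_middle[OF rk k(1) e(2), of q] cmp_zero_middle[OF ke e(1) k(2), of p]
    by (simp add: e'_def r'_def in_Hom)
  then have 2: "r' \<bullet> e' = ident \<C> Y" using B(12) by simp
  have "e' \<bullet> r' = aplus \<C> (e \<bullet> r) (\<iota> k \<bullet> \<pi> k)"
    using B(1-7)[unfolded in_Hom] e(1,2)[unfolded in_Hom] k(1,2)[unfolded in_Hom] obj L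
      cmp_cancel_middle[OF B(8,4,6), of r] cmp_cancel_middle[OF B(9,5,7), of "\<pi> k"]
      cmp_zero_middle[OF B(10,4,7), of r] cmp_zero_middle[OF B(11,5,6), of "\<pi> k"]
    by (simp add: e'_def r'_def)
  also have "\<dots> = aplus \<C> (\<iota> k \<bullet> \<pi> k) (e \<bullet> r)"
    using e(1,2) k(1,2) by (subst plus_comm) (simp_all add: in_Hom)
  also have "\<dots> = finsum (hom_module \<C> L L) (\<lambda>a. \<iota> a \<bullet> \<pi> a) (insert k J)"
  proof -
    have "(\<lambda>a. \<iota> a \<bullet> \<pi> a) \<in> J \<rightarrow> carrier (hom_module \<C> L L)"
      "\<iota> k \<bullet> \<pi> k \<in> carrier (hom_module \<C> L L)"
      using tp k by (auto simp: in_Hom)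
    then show ?thesis using insert.hyps er by (simp add: L.finsum_insert)
  qed
  finally show ?case using 1 2 unfolding partial_sum_def by blast
qed

text \<open>
  A right approximation \<open>f\<close> has a right minimal version: restrict it to a part of its source, a
  direct sum of objects with local endomorphism rings, with as few summands as possible.  If
  \<open>f h = f\<close> with \<open>h\<close> not invertible, then \<open>1 - h\<close> is not radical, so one of its components is
  invertible; this makes a summand redundant, contradicting the choice.
\<close>

lemma ex_right_minimal_approx:
  assumes ks: "krull_schmidt \<C>" and S: "S \<subseteq> objs \<C>"
    and retract: "\<And>W Z i p. Z \<in> S \<Longrightarrow> i \<in> Hom \<C> W Z \<Longrightarrow> p \<in> Hom \<C> Z W \<Longrightarrow> p \<bullet> i = ident \<C> W \<Longrightarrow> W \<in> S"
    and f: "right_approx \<C> S f"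
  obtains f' where "right_approx \<C> S f'" "right_minimal \<C> f'" "tgt \<C> f' = tgt \<C> f"
proof -
  define L where "L = src \<C> f"
  define M where "M = tgt \<C> f"
  have fL: "f \<in> Hom \<C> L M" "L \<in> S" using f by (auto simp: right_approx_def in_Hom L_def M_def)
  then have L: "L \<in> objs \<C>" using S by auto
  obtain Xs where Xs: "is_finite_dsum \<C> Xs L" and loc: "\<And>Y. Y \<in> set Xs \<Longrightarrow> local_endomorphism_ring \<C> Y"
    using ks L by (auto simp: krull_schmidt_def)
  define N where "N = length Xs"
  define W where "W a = Xs ! a" for a
  have "\<exists>\<iota> \<pi>. (\<forall>a < N. \<iota> a \<in> Hom \<C> (W a) L \<and> \<pi> a \<in> Hom \<C> L (W a)) \<and>
      (\<forall>a < N. \<forall>b < N. \<pi> a \<bullet> \<iota> b = (if a = b then ident \<C> (W a) else zarr \<C> (W b) (W a))) \<and>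
      finsum (hom_module \<C> L L) (\<lambda>a. \<iota> a \<bullet> \<pi> a) {..<N} = ident \<C> L"
    using Xs unfolding is_finite_dsum_def N_def W_def by blast
  then obtain \<iota> \<pi> where
      ip': "\<forall>a < N. \<iota> a \<in> Hom \<C> (W a) L \<and> \<pi> a \<in> Hom \<C> L (W a)" and
      orth': "\<forall>a < N. \<forall>b < N. \<pi> a \<bullet> \<iota> b = (if a = b then ident \<C> (W a) else zarr \<C> (W b) (W a))" and
      sum: "finsum (hom_module \<C> L L) (\<lambda>a. \<iota> a \<bullet> \<pi> a) {..<N} = ident \<C> L"
    by (elim exE conjE) (rule that)
  have ip: "\<iota> a \<in> Hom \<C> (W a) L \<and> \<pi> a \<in> Hom \<C> L (W a)" if "a < N" for a
    using ip' that by blast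
  have orth: "\<pi> a \<bullet> \<iota> b = (if a = b then ident \<C> (W a) else zarr \<C> (W b) (W a))"
    if "a < N" "b < N" for a b using orth' that by blast
  have locW: "local_endomorphism_ring \<C> (W a)" if "a < N" for a
    using loc nth_mem that by (simp add: W_def N_def)
  interpret L: abelian_group "hom_module \<C> L L" using L L by (rule hom_group)
  define good where "good J \<longleftrightarrow> J \<subseteq> {..<N} \<and>
    (\<exists>Z e r. partial_sum L \<iota> \<pi> J Z e r \<and> right_approx \<C> S (f \<bullet> e))" for J
  have "good {..<N}"
    unfolding good_def partial_sum_def using L sum fL f
    by (intro conjI exI[of _ L] exI[of _ "ident \<C> L"]) (simp_all add: in_Hom)
  then obtain J where J: "good J" and min: "\<And>J'. good J' \<Longrightarrow> card J \<le> card J'"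
    using ex_has_least_nat[of good "{..<N}" card] by blast
  obtain Z e r where Z: "partial_sum L \<iota> \<pi> J Z e r" "right_approx \<C> S (f \<bullet> e)" and JN: "J \<subseteq> {..<N}"
    using J by (auto simp: good_def)
  have fin: "finite J" using JN finite_subset by blast
  have e: "e \<in> Hom \<C> Z L" "r \<in> Hom \<C> L Z" "r \<bullet> e = ident \<C> Z"
    and er: "e \<bullet> r = finsum (hom_module \<C> L L) (\<lambda>a. \<iota> a \<bullet> \<pi> a) J"
    using Z by (simp_all add: partial_sum_def)
  have Zo: "Z \<in> objs \<C>" using Hom_obj[OF e(1)] by simp
  have fe: "f \<bullet> e \<in> Hom \<C> Z M" using fL e by (simp add: in_Hom)
  have tp: "\<And>a. a \<in> J \<Longrightarrow> \<iota> a \<bullet> \<pi> a \<in> Hom \<C> L L" using ip JN by (auto simp: in_Hom)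
  \<comment> \<open>the identity of \<open>Z\<close> is the sum of the \<open>r \<iota>\<^sub>a \<pi>\<^sub>a e\<close>\<close>
  have Zind: "P (ident \<C> Z)" if P0: "P (zarr \<C> Z Z)"
    and Pp: "\<And>f g. f \<in> Hom \<C> Z Z \<Longrightarrow> g \<in> Hom \<C> Z Z \<Longrightarrow> P f \<Longrightarrow> P g \<Longrightarrow> P (aplus \<C> f g)"
    and Pa: "\<And>a. a \<in> J \<Longrightarrow> P (r \<bullet> \<iota> a \<bullet> \<pi> a \<bullet> e)" for P
  proof -
    have "P (r \<bullet> finsum (hom_module \<C> L L) (\<lambda>a. \<iota> a \<bullet> \<pi> a) J \<bullet> e)"
    proof (rule finsum_closed_under[OF L L fin tp])
      fix a assume a: "a \<in> J"
      then have "\<iota> a \<in> Hom \<C> (W a) L" "\<pi> a \<in> Hom \<C> L (W a)" using ip JN by auto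
      then show "P (r \<bullet> (\<iota> a \<bullet> \<pi> a) \<bullet> e)" using Pa[OF a] e by (simp add: in_Hom)
    next
      show "P (r \<bullet> zarr \<C> L L \<bullet> e)" using P0 e L Zo by (simp add: in_Hom)
    next
      fix f g assume "f \<in> Hom \<C> L L" "g \<in> Hom \<C> L L" "P (r \<bullet> f \<bullet> e)" "P (r \<bullet> g \<bullet> e)"
      then show "P (r \<bullet> aplus \<C> f g \<bullet> e)" using Pp[of "r \<bullet> f \<bullet> e" "r \<bullet> g \<bullet> e"] e by (simp add: in_Hom)
    qed
    then show ?thesis unfolding er[symmetric] using e cmp_cancel_middle[OF e(3,1,2), of "r \<bullet> e"]
      by (simp add: in_Hom)
  qed
  have "right_minimal \<C> (f \<bullet> e)"
    unfolding right_minimal_def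
  proof (intro ballI impI)
    fix h assume "h \<in> Hom \<C> (src \<C> (f \<bullet> e)) (src \<C> (f \<bullet> e))" and eq: "(f \<bullet> e) \<bullet> h = f \<bullet> e"
    then have h: "h \<in> Hom \<C> Z Z" using fe by (simp add: in_Hom)
    define g where "g = aplus \<C> (ident \<C> Z) (neg h)"
    have g: "g \<in> Hom \<C> Z Z" using h Zo by (simp add: g_def in_Hom)
    have feg: "f \<bullet> e \<bullet> g = zarr \<C> Z M"
      using eq h e fL Zo by (simp add: g_def in_Hom)
    have "radical g"
    proof (rule ccontr)
      assume nr: "\<not> radical g"
      have "\<exists>k \<in> J. \<exists>l \<in> J. is_iso \<C> (\<pi> k \<bullet> e \<bullet> g \<bullet> r \<bullet> \<iota> l)"
      proof (rule ccontr)
        assume n: "\<not> ?thesis"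
        have 1: "radical (g \<bullet> r \<bullet> \<iota> l)" if l: "l \<in> J" for l
        proof -
          have il: "\<iota> l \<in> Hom \<C> (W l) L" using ip JN l by auto
          then have Wl: "W l \<in> objs \<C>" using Hom_obj by blast
          have gl: "g \<bullet> r \<bullet> \<iota> l \<in> Hom \<C> (W l) Z" using il g e by (simp add: in_Hom)
          have "radical (ident \<C> Z \<bullet> g \<bullet> r \<bullet> \<iota> l)"
          proof (rule Zind)
            show "radical (zarr \<C> Z Z \<bullet> g \<bullet> r \<bullet> \<iota> l)"
              using radical_zero[OF Wl Zo] gl Zo by (simp add: in_Hom)
            show "radical (aplus \<C> a b \<bullet> g \<bullet> r \<bullet> \<iota> l)"
              if "a \<in> Hom \<C> Z Z" "b \<in> Hom \<C> Z Z" "radical (a \<bullet> g \<bullet> r \<bullet> \<iota> l)" "radical (b \<bullet> g \<bullet> r \<bullet> \<iota> l)" for a b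
              using radical_plus[OF that(3,4), of "W l" Z] that(1,2) gl by (simp add: in_Hom)
            fix k assume k: "k \<in> J"
            then have ik: "\<iota> k \<in> Hom \<C> (W k) L" "\<pi> k \<in> Hom \<C> L (W k)" using ip JN by auto
            have t: "\<pi> k \<bullet> e \<bullet> g \<bullet> r \<bullet> \<iota> l \<in> Hom \<C> (W l) (W k)" using ik gl e by (simp add: in_Hom)
            have "radical (\<pi> k \<bullet> e \<bullet> g \<bullet> r \<bullet> \<iota> l)"
              using radical_local[OF locW locW t] n k l JN by auto
            then have "radical ((r \<bullet> \<iota> k) \<bullet> \<pi> k \<bullet> e \<bullet> g \<bullet> r \<bullet> \<iota> l)"
              using radical_left[OF _ t, of "r \<bullet> \<iota> k" Z] ik e by (simp add: in_Hom)
            then show "radical ((r \<bullet> \<iota> k \<bullet> \<pi> k \<bullet> e) \<bullet> g \<bullet> r \<bullet> \<iota> l)" using ik e gl by (simp add: in_Hom)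
          qed
          then show ?thesis using gl by (simp add: in_Hom)
        qed
        have "radical (g \<bullet> ident \<C> Z)"
        proof (rule Zind)
          show "radical (g \<bullet> zarr \<C> Z Z)" using radical_zero[OF Zo Zo] g Zo by (simp add: in_Hom)
          show "radical (g \<bullet> aplus \<C> a b)"
            if "a \<in> Hom \<C> Z Z" "b \<in> Hom \<C> Z Z" "radical (g \<bullet> a)" "radical (g \<bullet> b)" for a b
            using radical_plus[OF that(3,4), of Z Z] that(1,2) g by (simp add: in_Hom)
          fix l assume l: "l \<in> J"
          then have il: "\<iota> l \<in> Hom \<C> (W l) L" "\<pi> l \<in> Hom \<C> L (W l)" using ip JN by auto
          then show "radical (g \<bullet> r \<bullet> \<iota> l \<bullet> \<pi> l \<bullet> e)"
            using radical_right[OF 1[OF l], of "W l" Z "\<pi> l \<bullet> e" Z] g e by (simp add: in_Hom)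
        qed
        then show False using nr g by (simp add: in_Hom)
      qed
      \<comment> \<open>\<open>s\<close> embeds the summand \<open>W k\<close> into the kernel of \<open>f e\<close>, and \<open>c\<close> is the projection along it\<close>
      then obtain k l where kl: "k \<in> J" "l \<in> J" "is_iso \<C> (\<pi> k \<bullet> e \<bullet> g \<bullet> r \<bullet> \<iota> l)" by blast
      have ik: "\<iota> k \<in> Hom \<C> (W k) L" "\<pi> k \<in> Hom \<C> L (W k)" "\<iota> l \<in> Hom \<C> (W l) L"
        using ip JN kl by auto
      have Wk: "W k \<in> objs \<C>" using Hom_obj[OF ik(1)] by simp
      have "\<pi> k \<bullet> e \<bullet> g \<bullet> r \<bullet> \<iota> l \<in> Hom \<C> (W l) (W k)" using ik g e by (simp add: in_Hom)
      then obtain u where u: "u \<in> Hom \<C> (W k) (W l)" "(\<pi> k \<bullet> e \<bullet> g \<bullet> r \<bullet> \<iota> l) \<bullet> u = ident \<C> (W k)"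
        using is_isoE[OF kl(3)] by metis
      define s where "s = g \<bullet> r \<bullet> \<iota> l \<bullet> u"
      have s: "s \<in> Hom \<C> (W k) Z" using ik g e u by (simp add: s_def in_Hom)
      have ps: "\<pi> k \<bullet> e \<bullet> s = ident \<C> (W k)" using ik g e u by (simp add: s_def in_Hom)
      have fs: "f \<bullet> e \<bullet> s = zarr \<C> (W k) M"
      proof -
        have feg': "(f \<bullet> e) \<bullet> g = zarr \<C> Z M" using feg fL e g by (simp add: in_Hom)
        show ?thesis using cmp_zero_middle[OF feg' g fe, of "r \<bullet> \<iota> l \<bullet> u"] ik fL e g u
          by (simp add: s_def in_Hom)
      qed
      define c where "c = aplus \<C> (ident \<C> Z) (neg (s \<bullet> \<pi> k \<bullet> e))"
      have c: "c \<in> Hom \<C> Z Z" using ik s e Zo by (simp add: c_def in_Hom)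
      have fec: "f \<bullet> e \<bullet> c = f \<bullet> e"
      proof -
        have "f \<bullet> e \<bullet> s \<bullet> \<pi> k \<bullet> e = zarr \<C> Z M"
        proof -
          have "f \<bullet> e \<bullet> s \<bullet> \<pi> k \<bullet> e = (f \<bullet> e \<bullet> s) \<bullet> \<pi> k \<bullet> e" using ik s e fL by (simp add: in_Hom)
          then show ?thesis unfolding fs using ik e fe by (simp add: in_Hom Wk) (use Hom_obj[OF fe] in simp)
        qed
        then show ?thesis using ik s e fL Zo Hom_obj[OF fe] by (simp add: c_def in_Hom)
      qed
      have kc: "\<pi> k \<bullet> e \<bullet> c = zarr \<C> Z (W k)"
      proof -
        have "\<pi> k \<bullet> e \<bullet> s \<bullet> \<pi> k \<bullet> e = \<pi> k \<bullet> e"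
          using cmp_cancel_middle[of "\<pi> k \<bullet> e" s "W k" Z "\<pi> k \<bullet> e"] ps ik s e by (simp add: in_Hom)
        then show ?thesis using ik s e Zo by (simp add: c_def in_Hom)
      qed
      let ?J = "J - {k}"
      have "\<exists>Z e r. partial_sum L \<iota> \<pi> ?J Z e r"
      proof (rule ex_partial_sum[OF L])
        show "finite ?J" using fin by simp
        show "\<iota> a \<in> Hom \<C> (W a) L \<and> \<pi> a \<in> Hom \<C> L (W a)" if "a \<in> ?J" for a using that ip JN by auto
        show "\<pi> a \<bullet> \<iota> b = (if a = b then ident \<C> (W a) else zarr \<C> (W b) (W a))"
          if "a \<in> ?J" "b \<in> ?J" for a b using that JN by (intro orth) auto
      qed
      then obtain Y e2 r2 where y: "partial_sum L \<iota> \<pi> ?J Y e2 r2" by blast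
      have e2: "e2 \<in> Hom \<C> Y L" "r2 \<in> Hom \<C> L Y" "r2 \<bullet> e2 = ident \<C> Y"
        and er2: "e2 \<bullet> r2 = finsum (hom_module \<C> L L) (\<lambda>a. \<iota> a \<bullet> \<pi> a) ?J"
        using y by (simp_all add: partial_sum_def)
      have "e \<bullet> r = aplus \<C> (\<iota> k \<bullet> \<pi> k) (e2 \<bullet> r2)"
      proof -
        have "(\<lambda>a. \<iota> a \<bullet> \<pi> a) \<in> ?J \<rightarrow> carrier (hom_module \<C> L L)"
          "\<iota> k \<bullet> \<pi> k \<in> carrier (hom_module \<C> L L)" using tp kl(1) by auto
        then have "finsum (hom_module \<C> L L) (\<lambda>a. \<iota> a \<bullet> \<pi> a) (insert k ?J) = aplus \<C> (\<iota> k \<bullet> \<pi> k) (e2 \<bullet> r2)"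
          using fin er2 by (subst L.finsum_insert) auto
        then show ?thesis using er kl(1) by (simp add: insert_absorb)
      qed
      then have "e \<bullet> r \<bullet> e \<bullet> c = aplus \<C> (\<iota> k \<bullet> \<pi> k \<bullet> e \<bullet> c) (e2 \<bullet> r2 \<bullet> e \<bullet> c)"
        using cmp_reduce[of e r "aplus \<C> (\<iota> k \<bullet> \<pi> k) (e2 \<bullet> r2)" L Z L "e \<bullet> c"] e(1,2) e2(1,2) ik c
        by (simp add: in_Hom)
      moreover have "e \<bullet> r \<bullet> e \<bullet> c = e \<bullet> c" using cmp_cancel_middle[OF e(3,1,2), of c] c by (simp add: in_Hom)
      ultimately have ec: "e \<bullet> c = e2 \<bullet> r2 \<bullet> e \<bullet> c"
        using kc ik e2(1,2) e c Wk Zo L by (simp add: in_Hom)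
      then have fe2: "f \<bullet> e = (f \<bullet> e2) \<bullet> r2 \<bullet> e \<bullet> c"
        using fec fL e2(1,2) e(1) c by (simp add: in_Hom)
      have "right_approx \<C> S (f \<bullet> e2)"
        unfolding right_approx_def
      proof (intro conjI ballI)
        show "f \<bullet> e2 \<in> arrs \<C>" using fL e2 by (simp add: in_Hom)
        have "Y \<in> S" using retract[OF fL(2) e2] .
        then show "src \<C> (f \<bullet> e2) \<in> S" using fL e2 by (simp add: in_Hom)
        fix X t assume X: "X \<in> S" and "t \<in> Hom \<C> X (tgt \<C> (f \<bullet> e2))"
        then have "t \<in> Hom \<C> X (tgt \<C> (f \<bullet> e))" using fL e2 e by (simp add: in_Hom)
        then obtain t' where t': "t' \<in> Hom \<C> X (src \<C> (f \<bullet> e))" "(f \<bullet> e) \<bullet> t' = t"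
          using Z(2) X by (auto simp: right_approx_def)
        then have t'': "t' \<in> Hom \<C> X Z" using fL e by (simp add: in_Hom)
        have "(f \<bullet> e2) \<bullet> r2 \<bullet> e \<bullet> c \<bullet> t' = ((f \<bullet> e2) \<bullet> r2 \<bullet> e \<bullet> c) \<bullet> t'"
          using t'' fL e2(1,2) e(1) c by (simp add: in_Hom)
        also have "\<dots> = t" unfolding fe2[symmetric] by (rule t'(2))
        finally have "(f \<bullet> e2) \<bullet> r2 \<bullet> e \<bullet> c \<bullet> t' = t" .
        moreover have "r2 \<bullet> e \<bullet> c \<bullet> t' \<in> Hom \<C> X (src \<C> (f \<bullet> e2))"
          using t'' fL e2(1,2) e(1) c by (simp add: in_Hom)
        ultimately show "\<exists>h \<in> Hom \<C> X (src \<C> (f \<bullet> e2)). (f \<bullet> e2) \<bullet> h = t" by blast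
      qed
      then have "good ?J" using JN y unfolding good_def by blast
      then have "card J \<le> card ?J" by (rule min)
      moreover have "card ?J < card J" using kl(1) fin by (rule card_Diff1_less[rotated])
      ultimately show False by simp
    qed
    moreover have "ident \<C> Z \<in> Hom \<C> Z Z" using Zo by (simp add: in_Hom)
    ultimately have "is_iso \<C> (aplus \<C> (ident \<C> Z) (neg (ident \<C> Z \<bullet> g)))" using radicalD[OF _ g] by blast
    moreover have "aplus \<C> (ident \<C> Z) (neg (ident \<C> Z \<bullet> g)) = h"
      using h Zo by (simp add: g_def in_Hom)
    ultimately show "is_iso \<C> h" by simp
  qed
  moreover have "tgt \<C> (f \<bullet> e) = tgt \<C> f" using fe by (simp add: in_Hom M_def)
  ultimately show ?thesis using that Z(2) by blast
qed

end

section \<open>Exact sequences in extriangulated categories\<close>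

context extriangulated_category
begin

abbreviation tri where "tri \<equiv> etriangle E"

lemma triD:
  assumes "tri X f Y g Z d"
  shows "X \<in> objs E" "Y \<in> objs E" "Z \<in> objs E" "f \<in> Hom E X Y" "g \<in> Hom E Y Z" "d \<in> Ext E Z X"
  using assms by (auto simp: etriangle_def)

lemma ext_group_simps [simp]:
  "carrier (ext_group E Z X) = Ext E Z X" "monoid.mult (ext_group E Z X) = eplus E"
  "one (ext_group E Z X) = ezero E Z X"
  by (simp_all add: ext_group_def)

lemma ezero_closed [simp]: "Z \<in> objs E \<Longrightarrow> X \<in> objs E \<Longrightarrow> ezero E Z X \<in> Ext E Z X"
  using monoid.one_closed[of "ext_group E Z X"] ext_comm_group[of Z X]
  by (simp add: comm_group_def group_def)

lemma push_closed:
  assumes "a \<in> Hom E X X'" "Z \<in> objs E" "d \<in> Ext E Z X" shows "push E a d \<in> Ext E Z X'"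
  using push_hom[OF assms(1,2)] assms(3) by (auto simp: hom_def)

lemma pull_closed:
  assumes "c \<in> Hom E Z' Z" "X \<in> objs E" "d \<in> Ext E Z X" shows "pull E c d \<in> Ext E Z' X"
  using pull_hom[OF assms(1,2)] assms(3) by (auto simp: hom_def)

lemma ext_group: "Z \<in> objs E \<Longrightarrow> X \<in> objs E \<Longrightarrow> group (ext_group E Z X)"
  using ext_comm_group by (simp add: comm_group_def)

lemma push_ezero:
  assumes "a \<in> Hom E X X'" "Z \<in> objs E" shows "push E a (ezero E Z X) = ezero E Z X'"
  using hom_one[OF push_hom[OF assms] ext_group ext_group] assms Hom_obj[OF assms(1)] by simp

lemma pull_ezero:
  assumes "c \<in> Hom E Z' Z" "X \<in> objs E" shows "pull E c (ezero E Z X) = ezero E Z' X"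
  using hom_one[OF pull_hom[OF assms] ext_group ext_group] assms Hom_obj[OF assms(1)] by simp

lemma ezero_plus:
  assumes "d \<in> Ext E Z X" "Z \<in> objs E" "X \<in> objs E"
  shows "eplus E d (ezero E Z X) = d" "eplus E (ezero E Z X) d = d"
  using monoid.r_one[of "ext_group E Z X" d] monoid.l_one[of "ext_group E Z X" d]
    ext_group[of Z X] assms by (simp_all add: group_def)

lemma eplus_idem:
  assumes "d \<in> Ext E Z X" "Z \<in> objs E" "X \<in> objs E" "eplus E d d = d" shows "d = ezero E Z X"
  using group.l_cancel_one[OF ext_group[of Z X], of d d] assms by simp

lemma push_zarr:
  assumes "d \<in> Ext E Z X" "Z \<in> objs E" "X \<in> objs E" "X' \<in> objs E"
  shows "push E (zarr E X X') d = ezero E Z X'"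
proof (rule eplus_idem)
  have z: "zarr E X X' \<in> Hom E X X'" using assms by (simp add: in_Hom)
  show "push E (zarr E X X') d \<in> Ext E Z X'" using push_closed[OF z] assms by simp
  show "eplus E (push E (zarr E X X') d) (push E (zarr E X X') d) = push E (zarr E X X') d"
    using push_plus[OF z z assms(2,1)] assms by simp
qed (use assms in auto)

lemma pull_zarr:
  assumes "d \<in> Ext E Z X" "Z \<in> objs E" "X \<in> objs E" "Z' \<in> objs E"
  shows "pull E (zarr E Z' Z) d = ezero E Z' X"
proof (rule eplus_idem)
  have z: "zarr E Z' Z \<in> Hom E Z' Z" using assms by (simp add: in_Hom)
  show "pull E (zarr E Z' Z) d \<in> Ext E Z' X" using pull_closed[OF z] assms by simp
  show "eplus E (pull E (zarr E Z' Z) d) (pull E (zarr E Z' Z) d) = pull E (zarr E Z' Z) d"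
    using pull_plus[OF z z assms(3,1)] assms by simp
qed (use assms in auto)

lemma tri_zero:
  assumes "biproduct E X Z Y i j p q" shows "tri X i Y q Z (ezero E Z X)"
  using assms real_zero[OF assms] by (simp add: etriangle_def biproduct_def)

lemma biproduct_zero:
  assumes "X \<in> objs E" "Q \<in> objs E" "ident E Q = zarr E Q Q"
  shows "biproduct E X Q X (ident E X) (zarr E Q X) (ident E X) (zarr E X Q)"
    "biproduct E Q X X (zarr E Q X) (ident E X) (zarr E X Q) (ident E X)"
  using assms by (simp_all add: biproduct_def in_Hom)

lemma zero_tris:
  assumes "Q \<in> objs E" "ident E Q = zarr E Q Q" "X \<in> objs E"
  shows "tri X (ident E X) X (zarr E X Q) Q (ezero E Q X)"
    "tri Q (zarr E Q X) X (ident E X) X (ezero E X Q)"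
  using biproduct_zero[OF assms(3,1,2)] tri_zero by blast+

text \<open>
  The next facts are the exactness of the two Hom-Ext sequences of an \<open>\<E>\<close>-triangle.  At the Hom
  terms one compares the triangle with the trivial triangles \<open>W \<rightarrow> W \<rightarrow> 0\<close> and \<open>0 \<rightarrow> W \<rightarrow> W\<close>, at the
  Ext term with a triangle realizing the given extension.
\<close>

lemma tri_cmp_zero:
  assumes t: "tri X f Y g Z d" shows "g \<bullet> f = zarr E X Z"
proof -
  obtain Q where Q: "Q \<in> objs E" "ident E Q = zarr E Q Q" using zero_object by auto
  note d = triD[OF t]
  obtain c where "c \<in> Hom E Q Z" "c \<bullet> zarr E X Q = g \<bullet> f"
    using ET3[OF zero_tris(1)[OF Q d(1)] t ident_hom[OF d(1)] d(4) refl] by blast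
  then show ?thesis using d(1) Q(1) by (simp add: in_Hom)
qed

lemma lift_to_kernel:
  assumes t: "tri X f Y g Z d" and h: "h \<in> Hom E W Y" "g \<bullet> h = zarr E W Z"
  obtains k where "k \<in> Hom E W X" "f \<bullet> k = h"
proof -
  obtain Q where Q: "Q \<in> objs E" "ident E Q = zarr E Q Q" using zero_object by auto
  note d = triD[OF t]
  have W: "W \<in> objs E" using h Hom_obj by blast
  obtain a where "a \<in> Hom E W X" "h \<bullet> ident E W = f \<bullet> a"
  proof -
    have "zarr E Q Z \<in> Hom E Q Z" "g \<bullet> h = zarr E Q Z \<bullet> zarr E W Q"
      using h(2) d(3) Q(1) W by (simp_all add: in_Hom)
    then show ?thesis using ET3_op[OF zero_tris(1)[OF Q W] t h(1)] that by metis
  qed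
  then show ?thesis using that h by (simp add: in_Hom)
qed

lemma extend_to_cokernel:
  assumes t: "tri X f Y g Z d" and h: "h \<in> Hom E Y W" "h \<bullet> f = zarr E X W"
  obtains k where "k \<in> Hom E Z W" "k \<bullet> g = h"
proof -
  obtain Q where Q: "Q \<in> objs E" "ident E Q = zarr E Q Q" using zero_object by auto
  note d = triD[OF t]
  have W: "W \<in> objs E" using h Hom_obj by blast
  obtain a where "a \<in> Hom E Z W" "a \<bullet> g = ident E W \<bullet> h"
  proof -
    have "zarr E X Q \<in> Hom E X Q" "h \<bullet> f = zarr E Q W \<bullet> zarr E X Q"
      using h(2) d(1) Q(1) W by (simp_all add: in_Hom)
    then show ?thesis using ET3[OF t zero_tris(2)[OF Q W] _ h(1)] that by metis
  qed
  then show ?thesis using that h by (simp add: in_Hom)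
qed

lemma lift_iff:
  assumes t: "tri X f Y g Z d" and h: "h \<in> Hom E W Z"
  shows "pull E h d = ezero E W X \<longleftrightarrow> (\<exists>k \<in> Hom E W Y. g \<bullet> k = h)"
proof -
  obtain Q where Q: "Q \<in> objs E" "ident E Q = zarr E Q Q" using zero_object by auto
  note d = triD[OF t]
  have W: "W \<in> objs E" using h Hom_obj by blast
  note z = zero_tris(2)[OF Q W]
  show ?thesis
  proof
    assume p: "pull E h d = ezero E W X"
    have a: "zarr E Q X \<in> Hom E Q X" using Q d by (simp add: in_Hom)
    obtain b where "b \<in> Hom E W Y" "g \<bullet> b = h \<bullet> ident E W"
      using real_morphism[OF z t a h] p push_ezero[OF a W] by auto
    then show "\<exists>k \<in> Hom E W Y. g \<bullet> k = h" using h by (auto simp: in_Hom)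
  next
    assume "\<exists>k \<in> Hom E W Y. g \<bullet> k = h"
    then obtain k where k: "k \<in> Hom E W Y" "g \<bullet> k = h \<bullet> ident E W" using h by (auto simp: in_Hom)
    obtain a where "a \<in> Hom E Q X" "push E a (ezero E W Q) = pull E h d"
      using ET3_op[OF z t k(1) h k(2)] by auto
    then show "pull E h d = ezero E W X" using push_ezero W by metis
  qed
qed

lemma extend_iff:
  assumes t: "tri X f Y g Z d" and h: "h \<in> Hom E X W"
  shows "push E h d = ezero E Z W \<longleftrightarrow> (\<exists>k \<in> Hom E Y W. k \<bullet> f = h)"
proof -
  obtain Q where Q: "Q \<in> objs E" "ident E Q = zarr E Q Q" using zero_object by auto
  note d = triD[OF t]
  have W: "W \<in> objs E" using h Hom_obj by blast
  note z = zero_tris(1)[OF Q W]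
  show ?thesis
  proof
    assume p: "push E h d = ezero E Z W"
    have c: "zarr E Z Q \<in> Hom E Z Q" using Q d by (simp add: in_Hom)
    obtain b where "b \<in> Hom E Y W" "b \<bullet> f = ident E W \<bullet> h"
      using real_morphism[OF t z h c] p pull_ezero[OF c W] by auto
    then show "\<exists>k \<in> Hom E Y W. k \<bullet> f = h" using h by (auto simp: in_Hom)
  next
    assume "\<exists>k \<in> Hom E Y W. k \<bullet> f = h"
    then obtain k where k: "k \<in> Hom E Y W" "k \<bullet> f = ident E W \<bullet> h" using h by (auto simp: in_Hom)
    obtain c where "c \<in> Hom E Z Q" "push E h d = pull E c (ezero E Q W)"
      using ET3[OF t z h k] by auto
    then show "push E h d = ezero E Z W" using pull_ezero W by metis
  qed
qed

lemma push_inflation: assumes "tri X f Y g Z d" shows "push E f d = ezero E Z Y"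
  using extend_iff[OF assms triD(4)[OF assms]] triD[OF assms]
  by (auto simp: in_Hom intro!: bexI[of _ "ident E Y"])

lemma pull_deflation: assumes "tri X f Y g Z d" shows "pull E g d = ezero E Y X"
  using lift_iff[OF assms triD(5)[OF assms]] triD[OF assms]
  by (auto simp: in_Hom intro!: bexI[of _ "ident E Y"])

lemma realized:
  assumes "d \<in> Ext E Z X" "Z \<in> objs E" "X \<in> objs E"
  obtains f Y g where "tri X f Y g Z d"
proof -
  obtain Y f g where Y: "Y \<in> objs E" "f \<in> Hom E X Y" "g \<in> Hom E Y Z" and
    r: "realization E d = {(f', g'). \<exists>Y' \<in> objs E. f' \<in> Hom E X Y' \<and> g' \<in> Hom E Y' Z \<and>
               (\<exists>b \<in> Hom E Y Y'. is_iso E b \<and> b \<bullet> f = f' \<and> g' \<bullet> b = g)}"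
    using real_class[OF assms(2,3,1)] by auto
  have "ident E Y \<in> Hom E Y Y" "is_iso E (ident E Y)"
    using Y(1) is_isoI[of "ident E Y" Y Y "ident E Y" "ident E Y"] by (simp_all add: in_Hom)
  then have "\<exists>b \<in> Hom E Y Y. is_iso E b \<and> b \<bullet> f = f \<and> g \<bullet> b = g"
    using Y by (auto simp: in_Hom intro!: bexI[of _ "ident E Y"])
  then have "(f, g) \<in> realization E d" using r Y by auto
  then show ?thesis using that Y assms by (auto simp: etriangle_def)
qed

lemma ext_from_push:
  assumes t: "tri X f Y g Z d" and e: "e \<in> Ext E W X" "W \<in> objs E" "push E f e = ezero E W Y"
  obtains c where "c \<in> Hom E W Z" "pull E c d = e"
proof -
  note d = triD[OF t]
  obtain p V q where v: "tri X p V q W e" using realized[OF e(1,2) d(1)] by auto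
  obtain b where b: "b \<in> Hom E V Y" "b \<bullet> p = f" using extend_iff[OF v d(4)] e(3) by auto
  obtain c where "c \<in> Hom E W Z" "push E (ident E X) e = pull E c d"
    using ET3[OF v t ident_hom[OF d(1)] b(1)] b(2) d(4) by (auto simp: in_Hom)
  then show ?thesis using that push_ident[of W X e] e d by auto
qed

lemma ext_from_pull:
  assumes t: "tri X f Y g Z d" and e: "e \<in> Ext E Z W" "W \<in> objs E" "pull E g e = ezero E Y W"
  obtains a where "a \<in> Hom E X W" "push E a d = e"
proof -
  note d = triD[OF t]
  obtain p V q where v: "tri W p V q Z e" using realized[OF e(1) d(3) e(2)] by auto
  obtain b where b: "b \<in> Hom E Y V" "q \<bullet> b = g" using lift_iff[OF v d(5)] e(3) by auto
  obtain a where "a \<in> Hom E X W" "push E a d = pull E (ident E Z) e"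
    using ET3_op[OF t v b(1) ident_hom[OF d(3)]] b(2) d(5) by (auto simp: in_Hom)
  then show ?thesis using that pull_ident[of Z W e] e d by auto
qed

subsection \<open>Isomorphic and split triangles\<close>

lemma tri_unique:
  assumes t: "tri X f Y g Z d" and t': "tri X f' Y' g' Z d"
  obtains b where "b \<in> Hom E Y Y'" "is_iso E b" "b \<bullet> f = f'" "g' \<bullet> b = g"
proof -
  note d = triD[OF t] and d' = triD[OF t']
  obtain V p q where V: "V \<in> objs E" "p \<in> Hom E X V" "q \<in> Hom E V Z" and
    r: "realization E d = {(f', g'). \<exists>Y' \<in> objs E. f' \<in> Hom E X Y' \<and> g' \<in> Hom E Y' Z \<and>
               (\<exists>b \<in> Hom E V Y'. is_iso E b \<and> b \<bullet> p = f' \<and> g' \<bullet> b = q)}"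
    using real_class[OF d(3,1,6)] by auto
  have *: "\<exists>b \<in> Hom E V Y. is_iso E b \<and> b \<bullet> p = f \<and> g \<bullet> b = q" if t: "tri X f Y g Z d" for f Y g
  proof -
    have "(f, g) \<in> realization E d" using t by (simp add: etriangle_def)
    then obtain Y1 b where "f \<in> Hom E X Y1" "b \<in> Hom E V Y1" "is_iso E b \<and> b \<bullet> p = f \<and> g \<bullet> b = q"
      unfolding r by blast
    moreover have "Y1 = Y" using triD[OF t] \<open>f \<in> Hom E X Y1\<close> by (simp add: in_Hom)
    ultimately show ?thesis by auto
  qed
  obtain b where b: "b \<in> Hom E V Y" "is_iso E b" "b \<bullet> p = f" "g \<bullet> b = q" using *[OF t] by auto
  obtain b' where b': "b' \<in> Hom E V Y'" "is_iso E b'" "b' \<bullet> p = f'" "g' \<bullet> b' = q" using *[OF t'] by auto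
  obtain c where c: "c \<in> Hom E Y V" "c \<bullet> b = ident E V" "b \<bullet> c = ident E Y" using is_isoE[OF b(2,1)] .
  obtain c' where c': "c' \<in> Hom E Y' V" "c' \<bullet> b' = ident E V" "b' \<bullet> c' = ident E Y'"
    using is_isoE[OF b'(2,1)] .
  have "b \<bullet> c' \<bullet> b' \<bullet> c = ident E Y" "b' \<bullet> c \<bullet> b \<bullet> c' = ident E Y'"
    using b b' c c' cmp_cancel_middle[OF c(2) b(1) c(1)] cmp_cancel_middle[OF c'(2) b'(1) c'(1)]
    by (simp_all add: in_Hom)
  then have "is_iso E (b' \<bullet> c)" using b b' c c'
    by (intro is_isoI[of _ Y Y' "b \<bullet> c'" "b \<bullet> c'"]) (auto simp: in_Hom)
  moreover have "(b' \<bullet> c) \<bullet> f = f'"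
  proof -
    have "(b' \<bullet> c) \<bullet> f = b' \<bullet> c \<bullet> b \<bullet> p" using b b' c d V by (simp add: in_Hom)
    then show ?thesis using cmp_cancel_middle[OF c(2) b(1) c(1)] b' V by (simp add: in_Hom)
  qed
  moreover have "g' \<bullet> (b' \<bullet> c) = g"
  proof -
    have "g' \<bullet> b' \<bullet> c = q \<bullet> c" using cmp_reduce[OF b'(4,1) d'(5)] c by (simp add: in_Hom)
    also have "\<dots> = g \<bullet> b \<bullet> c" using cmp_reduce[OF b(4,1) d(5), of c] c(1) by (simp add: in_Hom)
    also have "\<dots> = g" using c(3) d(5) by (simp add: in_Hom)
    finally show ?thesis .
  qed
  moreover have "b' \<bullet> c \<in> Hom E Y Y'" using b' c by (simp add: in_Hom)
  ultimately show ?thesis using that by blast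
qed

text \<open>The realizations of an extension form a full isomorphism class, so the middle term may be changed.\<close>

lemma tri_iso_middle:
  assumes t: "tri X f Y g Z d" and b: "b \<in> Hom E Y Y'" "is_iso E b" "g' \<bullet> b = g" "g' \<in> Hom E Y' Z"
  shows "tri X (b \<bullet> f) Y' g' Z d"
proof -
  note d = triD[OF t]
  obtain V p q where V: "V \<in> objs E" "p \<in> Hom E X V" "q \<in> Hom E V Z" and
    r: "realization E d = {(f', g'). \<exists>Y' \<in> objs E. f' \<in> Hom E X Y' \<and> g' \<in> Hom E Y' Z \<and>
               (\<exists>b \<in> Hom E V Y'. is_iso E b \<and> b \<bullet> p = f' \<and> g' \<bullet> b = q)}"
    using real_class[OF d(3,1,6)] by auto
  have "(f, g) \<in> realization E d" using t by (simp add: etriangle_def)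
  then obtain Y1 c where "f \<in> Hom E X Y1" "c \<in> Hom E V Y1" and c': "is_iso E c" "c \<bullet> p = f" "g \<bullet> c = q"
    unfolding r by blast
  then have c: "c \<in> Hom E V Y" using d by (auto simp: in_Hom)
  obtain i where i: "i \<in> Hom E Y' Y" "i \<bullet> b = ident E Y" "b \<bullet> i = ident E Y'" using is_isoE[OF b(2,1)] .
  obtain k where k: "k \<in> Hom E Y V" "k \<bullet> c = ident E V" "c \<bullet> k = ident E Y" using is_isoE[OF c'(1) c] .
  have "is_iso E (b \<bullet> c)"
    using b c i k cmp_cancel_middle[OF i(2) b(1) i(1)] cmp_cancel_middle[OF k(3) k(1) c]
    by (intro is_isoI[of _ V Y' "k \<bullet> i" "k \<bullet> i"]) (auto simp: in_Hom)
  moreover have "(b \<bullet> c) \<bullet> p = b \<bullet> f" using b(1) c c'(2) V by (simp add: in_Hom)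
  moreover have "g' \<bullet> (b \<bullet> c) = q"
  proof -
    have "g' \<bullet> (b \<bullet> c) = (g' \<bullet> b) \<bullet> c" using b(1,4) c by (simp add: in_Hom)
    then show ?thesis by (simp only: b(3) c'(3))
  qed
  moreover have "b \<bullet> c \<in> Hom E V Y'" "b \<bullet> f \<in> Hom E X Y'" using b(1) c d(4) by (simp_all add: in_Hom)
  moreover have "Y' \<in> objs E" using Hom_obj[OF b(1)] by simp
  ultimately have "(b \<bullet> f, g') \<in> realization E d" using b(4) unfolding r by blast
  then show ?thesis using d b(1,4) Hom_obj[OF b(1)] by (simp add: etriangle_def in_Hom)
qed

text \<open>The biproduct also realizes the zero extension, and its maps are carried over along the isomorphism
  of middle terms.\<close>

lemma split_tri:
  assumes t: "tri X f Y g Z (ezero E Z X)"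
  obtains j p where "biproduct E X Z Y f j p g"
proof -
  note d = triD[OF t]
  obtain B i j p q where b: "biproduct E X Z B i j p q"
    using biproducts[OF d(1,3)] by (auto simp: is_dsum_def)
  obtain b where bb: "b \<in> Hom E B Y" "is_iso E b" "b \<bullet> i = f" "g \<bullet> b = q"
    using tri_unique[OF tri_zero[OF b] t] .
  obtain c where c: "c \<in> Hom E Y B" "c \<bullet> b = ident E B" "b \<bullet> c = ident E Y" using is_isoE[OF bb(2,1)] .
  note B = biproductD(1-11)[OF b, unfolded in_Hom]
  have qc: "q \<bullet> c = g"
    using cmp_reduce[OF bb(4,1) d(5), of c] c d(5) by (simp add: in_Hom)
  have "aplus E (b \<bullet> i \<bullet> p \<bullet> c) (b \<bullet> j \<bullet> q \<bullet> c) = b \<bullet> aplus E (i \<bullet> p) (j \<bullet> q) \<bullet> c"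
    using B bb(1) c(1) by (simp add: in_Hom)
  also have "\<dots> = ident E Y" using biproductD(12)[OF b] c by (simp add: in_Hom)
  finally have "aplus E (b \<bullet> i \<bullet> p \<bullet> c) (b \<bullet> j \<bullet> q \<bullet> c) = ident E Y" .
  then have s: "aplus E (f \<bullet> p \<bullet> c) ((b \<bullet> j) \<bullet> g) = ident E Y"
    using B bb(1,3) c(1) qc by (auto simp: in_Hom)
  have "(p \<bullet> c) \<bullet> f = p \<bullet> c \<bullet> b \<bullet> i" using bb B c d(4) by (simp add: in_Hom)
  then have 1: "(p \<bullet> c) \<bullet> f = ident E X"
    using cmp_cancel_middle[OF c(2) bb(1) c(1)] B by (simp add: in_Hom)
  have 2: "(p \<bullet> c) \<bullet> (b \<bullet> j) = zarr E Z X"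
    using cmp_cancel_middle[OF c(2) bb(1) c(1)] B bb c by (simp add: in_Hom)
  have "g \<bullet> b \<bullet> j = (g \<bullet> b) \<bullet> j" using bb(1) B d by (simp add: in_Hom)
  then have 3: "g \<bullet> b \<bullet> j = ident E Z" using bb(4) B by simp
  have "biproduct E X Z Y f (b \<bullet> j) (p \<bullet> c) g"
    using 1 2 3 s d B bb(1) c(1) tri_cmp_zero[OF t] by (auto simp: biproduct_def in_Hom)
  then show ?thesis using that by blast
qed

text \<open>A one-sided inverse comes from each of the two Hom sequences: neither of them is exact on the left,
  so each proves only one half of the five lemma.\<close>

lemma five_lemma:
  assumes t: "tri X f Y g Z d" and t': "tri X f' Y' g' Z' d'"
    and e: "e \<in> Hom E Y Y'" "e \<bullet> f = f'" "g' \<bullet> e = c \<bullet> g"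
    and c: "c \<in> Hom E Z Z'" "is_iso E c" "pull E c d' = d"
  shows "is_iso E e"
proof -
  note d = triD[OF t] and d' = triD[OF t']
  obtain i where i: "i \<in> Hom E Z' Z" "i \<bullet> c = ident E Z" "c \<bullet> i = ident E Z'" using is_isoE[OF c(2,1)] .
  have d'i: "d' = pull E i d"
    using pull_cmp[OF c(1) i(1) d'(1,6)] pull_ident[of Z' X d'] c(3) i(3) d' by simp
  \<comment> \<open>the covariant sequence gives a right inverse of \<open>e\<close>\<close>
  have "pull E (i \<bullet> g') d = ezero E Y' X"
    using pull_cmp[OF i(1) d'(5) d(1,6)] d'i pull_deflation[OF t'] by simp
  moreover have ig: "i \<bullet> g' \<in> Hom E Y' Z" using i d' by (simp add: in_Hom)
  ultimately obtain y where y: "y \<in> Hom E Y' Y" "g \<bullet> y = i \<bullet> g'" using lift_iff[OF t ig] by auto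
  have "g' \<bullet> e \<bullet> y = g'"
  proof -
    have "g' \<bullet> e \<bullet> y = c \<bullet> g \<bullet> y"
      using cmp_eq_middle[OF e(3) e(1) d'(5) d(5) c(1), of y] y by (simp add: in_Hom)
    also have "\<dots> = g'" using cmp_cancel_middle[OF i(3) i(1) c(1)] y(2) d' by (simp add: in_Hom)
    finally show ?thesis .
  qed
  then have "g' \<bullet> aplus E (ident E Y') (neg (e \<bullet> y)) = zarr E Y' Z'"
    using d' e y by (simp add: in_Hom)
  moreover have "aplus E (ident E Y') (neg (e \<bullet> y)) \<in> Hom E Y' Y'" using d' e y by (simp add: in_Hom)
  ultimately obtain k where k: "k \<in> Hom E Y' X" "f' \<bullet> k = aplus E (ident E Y') (neg (e \<bullet> y))"
    using lift_to_kernel[OF t'] by metis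
  have "e \<bullet> aplus E (f \<bullet> k) y = aplus E (f' \<bullet> k) (e \<bullet> y)"
    using e(1) d k y e(2)[symmetric] by (simp add: in_Hom)
  also have "\<dots> = ident E Y'" using k d' e y by (simp add: in_Hom)
  finally have r: "e \<bullet> aplus E (f \<bullet> k) y = ident E Y'" .
  have r': "aplus E (f \<bullet> k) y \<in> Hom E Y' Y" using d k y by (simp add: in_Hom)
  \<comment> \<open>the contravariant sequence gives a left inverse of \<open>e\<close>\<close>
  have "push E f d' = ezero E Z' Y"
    using push_pull[OF d(4) i(1) d(6)] d'i push_inflation[OF t] pull_ezero[OF i(1) d(2)] by simp
  then obtain w where w: "w \<in> Hom E Y' Y" "w \<bullet> f' = f" using extend_iff[OF t' d(4)] by auto
  have we: "aplus E (ident E Y) (neg (w \<bullet> e)) \<bullet> f = zarr E X Y"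
    using d e w by (auto simp: in_Hom)
  have "aplus E (ident E Y) (neg (w \<bullet> e)) \<in> Hom E Y Y" using d e w by (auto simp: in_Hom)
  then obtain z where z: "z \<in> Hom E Z Y" "z \<bullet> g = aplus E (ident E Y) (neg (w \<bullet> e))"
    using extend_to_cokernel[OF t _ we] by metis
  have "(z \<bullet> i) \<bullet> g' \<bullet> e = z \<bullet> i \<bullet> c \<bullet> g" using i z(1) c(1) d(5) by (simp add: in_Hom e(3))
  also have "\<dots> = z \<bullet> g" using cmp_cancel_middle[OF i(2) c(1) i(1)] d by (simp add: in_Hom)
  finally have "(z \<bullet> i) \<bullet> g' \<bullet> e = z \<bullet> g" .
  then have "aplus E w (z \<bullet> i \<bullet> g') \<bullet> e = aplus E (w \<bullet> e) (z \<bullet> g)"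
    using w(1) e(1) i(1) z(1) d'(5) \<open>(z \<bullet> i) \<bullet> g' \<bullet> e = z \<bullet> g\<close> by (simp add: in_Hom)
  also have "\<dots> = aplus E (z \<bullet> g) (w \<bullet> e)"
    using w e z d by (subst plus_comm) (auto simp: in_Hom)
  also have "\<dots> = ident E Y" unfolding z(2) using d e w by (simp add: in_Hom)
  finally have l: "aplus E w (z \<bullet> i \<bullet> g') \<bullet> e = ident E Y" .
  have "aplus E w (z \<bullet> i \<bullet> g') \<in> Hom E Y' Y" using w z i d' by (simp add: in_Hom)
  then show ?thesis using is_isoI[OF e(1) _ r' l r] by simp
qed

text \<open>Changing the cokernel by \<open>b\<close> amounts to pulling the extension back along the inverse of \<open>b\<close>; the five
  lemma identifies the middle term of the result with the old one.\<close>

lemma tri_iso_right: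
  assumes t: "tri X f Y g Z d" and b: "b \<in> Hom E Z Z'" "is_iso E b"
  obtains d' where "tri X f Y (b \<bullet> g) Z' d'"
proof -
  note d = triD[OF t]
  have Z': "Z' \<in> objs E" using Hom_obj[OF b(1)] by simp
  obtain i where i: "i \<in> Hom E Z' Z" "i \<bullet> b = ident E Z" "b \<bullet> i = ident E Z'" using is_isoE[OF b(2,1)] .
  have pd: "pull E i d \<in> Ext E Z' X" using pull_closed[OF i(1) d(1,6)] .
  obtain p V q where v: "tri X p V q Z' (pull E i d)" using realized[OF pd Z' d(1)] .
  have eq: "pull E b (pull E i d) = d"
    using pull_cmp[OF i(1) b(1) d(1,6)] i(2) pull_ident[OF d(3,1,6)] by simp
  have "ident E X \<in> Hom E X X" using d by (simp add: in_Hom)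
  then obtain e where e: "e \<in> Hom E Y V" "e \<bullet> f = p \<bullet> ident E X" "q \<bullet> e = b \<bullet> g"
    using real_morphism[OF t v _ b(1)] eq push_ident[OF d(3,1,6)] by auto
  have ep: "e \<bullet> f = p" using e(2) triD[OF v] by (simp add: in_Hom)
  have "is_iso E e" using five_lemma[OF t v e(1) ep e(3) b eq] .
  then obtain h where h: "h \<in> Hom E V Y" "h \<bullet> e = ident E Y" "e \<bullet> h = ident E V" using is_isoE e(1) by blast
  have "is_iso E h" using is_isoI[OF h(1) e(1) e(1)] h by simp
  moreover have "(b \<bullet> g) \<bullet> h = q"
  proof -
    have "(b \<bullet> g) \<bullet> h = q \<bullet> e \<bullet> h" using e(3)[symmetric] e(1) h(1) triD[OF v] by (simp add: in_Hom)
    then show ?thesis using h triD[OF v] by (simp add: in_Hom)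
  qed
  moreover have "b \<bullet> g \<in> Hom E Y Z'" using b d by (simp add: in_Hom)
  ultimately have "tri X (h \<bullet> p) Y (b \<bullet> g) Z' (pull E i d)" using tri_iso_middle[OF v h(1)] by simp
  moreover have "h \<bullet> p = f"
    using ep[symmetric] h e(1) d cmp_cancel_middle[OF h(2) e(1) h(1)] by (simp add: in_Hom)
  ultimately show ?thesis using that by simp
qed

text \<open>The kernel of another retraction \<open>r\<close> of the same inclusion \<open>u\<close> is again a complement, embedded by
  \<open>s = j - u r j\<close>.\<close>

lemma biproduct_change:
  assumes b: "biproduct E X W G u j p v" and r: "r \<in> Hom E G X" "r \<bullet> u = ident E X"
  obtains s where "biproduct E W X G s u v r"
proof -
  note B = biproductD(1-11)[OF b, unfolded in_Hom]
  define s where "s = aplus E j (neg (u \<bullet> r \<bullet> j))"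
  have s: "s \<in> Hom E W G" using B r by (simp add: s_def in_Hom)
  have u: "u \<in> Hom E X G" "v \<in> Hom E G W" using biproductD[OF b] by simp_all
  have "v \<bullet> u = zarr E X W" using B by simp
  note vu = cmp_zero_middle[OF this u]
  have vs: "v \<bullet> s = ident E W"
    using B r vu by (simp add: s_def in_Hom)
  have rs: "r \<bullet> s = zarr E W X"
    using B r cmp_cancel_middle[OF r(2) u(1) r(1)] by (simp add: s_def in_Hom)
  have up: "aplus E (u \<bullet> p) (j \<bullet> v) = ident E G" using biproductD[OF b] by simp
  have "r = r \<bullet> aplus E (u \<bullet> p) (j \<bullet> v)" unfolding up using r by (simp add: in_Hom)
  also have "\<dots> = aplus E p (r \<bullet> j \<bullet> v)"
    using B r cmp_cancel_middle[OF r(2) u(1) r(1)] by (simp add: in_Hom)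
  finally have rp: "r = aplus E p (r \<bullet> j \<bullet> v)" .
  have "aplus E (s \<bullet> v) (u \<bullet> r) = aplus E (s \<bullet> v) (u \<bullet> aplus E p (r \<bullet> j \<bullet> v))"
    by (rule arg_cong[OF rp])
  also have "\<dots> = aplus E (j \<bullet> v) (u \<bullet> p)"
    using B r by (simp add: s_def in_Hom plus_left_comm[of "neg (u \<bullet> r \<bullet> j \<bullet> v)" "u \<bullet> p" "u \<bullet> r \<bullet> j \<bullet> v"])
  also have "\<dots> = ident E G" using up plus_comm[of "u \<bullet> p" "j \<bullet> v"] B by simp
  finally have "aplus E (s \<bullet> v) (u \<bullet> r) = ident E G" .
  then have "biproduct E W X G s u v r" using B r s vs rs by (simp add: biproduct_def in_Hom)
  then show ?thesis using that by blast
qed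

subsection \<open>Pullbacks of deflations and the horseshoe\<close>

text \<open>
  Two deflations \<open>Y1 \<rightarrow> Z \<leftarrow> Y2\<close> are covered by a common object \<open>M\<close>, lying over \<open>Y2\<close> with kernel
  \<open>X1\<close> and over \<open>Y1\<close> with kernel \<open>X2\<close>.  One realizes \<open>y2\<^sup>* d1\<close> and takes the kernel \<open>G\<close> of the
  composite \<open>M \<rightarrow> Y2 \<rightarrow> Z\<close>; it is a direct sum of \<open>X1\<close> and \<open>X2\<close>, and the projection to \<open>X1\<close> can be
  corrected so that it pushes the extension of \<open>G\<close> to \<open>d1\<close>.  Dividing \<open>M\<close> by the complement
  \<open>X2\<close> of this projection then gives back \<open>Y1\<close>.
\<close>

lemma pullback_of_deflations:
  assumes t1: "tri X1 x1 Y1 y1 Z d1" and t2: "tri X2 x2 Y2 y2 Z d2"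
  obtains M m1 e1 m2 e2 d where "tri X1 m1 M e1 Y2 (pull E y2 d1)" "tri X2 m2 M e2 Y1 d"
    "e2 \<bullet> m1 = x1"
proof -
  note D1 = triD[OF t1] and D2 = triD[OF t2]
  have p: "pull E y2 d1 \<in> Ext E Y2 X1" using pull_closed[OF D2(5) D1(1,6)] .
  obtain m1 M e1 where t3: "tri X1 m1 M e1 Y2 (pull E y2 d1)" using realized[OF p D2(2) D1(1)] .
  note D3 = triD[OF t3]
  obtain G h u v d where g: "tri G h M (y2 \<bullet> e1) Z d" "tri X1 u G v X2 (pull E x2 (pull E y2 d1))"
    "h \<bullet> u = m1" "push E v d = d2" "push E u (pull E y2 d1) = pull E y2 d"
    using ET4_op[OF t3 t2] by blast
  note DG = triD[OF g(1)] and DG' = triD[OF g(2)]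
  have "pull E x2 (pull E y2 d1) = pull E (y2 \<bullet> x2) d1"
    using pull_cmp[OF D2(5,4) D1(1,6)] by simp
  also have "\<dots> = ezero E X2 X1" using tri_cmp_zero[OF t2] pull_zarr[OF D1(6,3,1) D2(1)] by simp
  finally have g0: "tri X1 u G v X2 (ezero E X2 X1)" using g(2) by simp
  obtain j r where b: "biproduct E X1 X2 G u j r v" using split_tri[OF g0] .
  note B = biproductD[OF b]
  \<comment> \<open>\<open>r\<close> pushes \<open>d\<close> to \<open>d1\<close> only up to a multiple \<open>a\<^sub>* d2\<close>, which is absorbed by subtracting \<open>a v\<close>\<close>
  have nid: "neg (ident E X1) \<in> Hom E X1 X1" using D1 by (simp add: in_Hom)
  define e where "e = eplus E (push E r d) (push E (neg (ident E X1)) d1)"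
  have rd: "push E r d \<in> Ext E Z X1" and nd: "push E (neg (ident E X1)) d1 \<in> Ext E Z X1"
    using push_closed[OF B(6) DG(3,6)] push_closed[OF nid D1(3,6)] by auto
  interpret G: comm_group "ext_group E Z X1" using ext_comm_group D1 by simp
  interpret G': comm_group "ext_group E Y2 X1" using ext_comm_group D1 D2 by simp
  have eE: "e \<in> Ext E Z X1" using G.m_closed rd nd by (simp add: e_def)
  have inv: "eplus E (push E (neg (ident E X1)) d1') d1' = ezero E Z' X1"
    if d': "d1' \<in> Ext E Z' X1" "Z' \<in> objs E" for d1' Z'
  proof -
    have "ident E X1 \<in> Hom E X1 X1" using D1 by (simp add: in_Hom)
    then show ?thesis
      using push_plus[OF nid _ d'(2,1), of "ident E X1"] push_ident[OF d'(2) D1(1) d'(1)]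
        push_zarr[OF d' D1(1) D1(1)] D1 by simp
  qed
  have "pull E y2 (push E r d) = push E r (push E u (pull E y2 d1))"
    using push_pull[OF B(6) D2(5) DG(6)] g(5) by simp
  also have "\<dots> = pull E y2 d1"
    using push_cmp[OF B(4,6) D2(2) p] B(8) push_ident[OF D2(2) D1(1) p] by simp
  finally have 1: "pull E y2 (push E r d) = pull E y2 d1" .
  have 2: "pull E y2 (push E (neg (ident E X1)) d1) = push E (neg (ident E X1)) (pull E y2 d1)"
    using push_pull[OF nid D2(5) D1(6)] by simp
  have pn: "push E (neg (ident E X1)) (pull E y2 d1) \<in> Ext E Y2 X1"
    using push_closed[OF nid D2(2) p] .
  have "pull E y2 e = eplus E (pull E y2 d1) (push E (neg (ident E X1)) (pull E y2 d1))"
    using hom_mult[OF pull_hom[OF D2(5) D1(1)], of "push E r d" "push E (neg (ident E X1)) d1"] rd nd 1 2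
    by (simp add: e_def)
  also have "\<dots> = ezero E Y2 X1" using inv[OF p D2(2)] G'.m_comm[of "pull E y2 d1"] p pn by simp
  finally obtain a where a: "a \<in> Hom E X2 X1" "push E a d2 = e"
    using ext_from_pull[OF t2 eE D1(1)] by metis
  define r' where "r' = aplus E r (neg (a \<bullet> v))"
  have r': "r' \<in> Hom E G X1" using a(1) B by (simp add: r'_def in_Hom)
  have rv: "a \<bullet> v \<in> Hom E G X1" using a B by (simp add: in_Hom)
  have r'u: "r' \<bullet> u = ident E X1" using a(1) B by (simp add: r'_def in_Hom)
  have r'd: "push E r' d = d1"
  proof -
    have sum: "aplus E r' (a \<bullet> v) = r" using a(1) B by (simp add: r'_def in_Hom)
    have pr': "push E r' d \<in> Ext E Z X1" using push_closed[OF r' DG(3,6)] .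
    have pe: "push E (a \<bullet> v) d = e" using push_cmp[OF B(7) a(1) DG(3,6)] a(2) g(4) by simp
    have "push E r d = eplus E (push E r' d) e"
      using push_plus[OF r' rv DG(3,6)] sum pe by simp
    also have "\<dots> = eplus E (push E r d) (eplus E (push E r' d) (push E (neg (ident E X1)) d1))"
      using G.m_lcomm[of "push E r' d" "push E r d" "push E (neg (ident E X1)) d1"] rd nd pr'
      by (simp add: e_def)
    finally have z: "eplus E (push E r' d) (push E (neg (ident E X1)) d1) = ezero E Z X1"
      using G.r_cancel_one'[of "push E r d" "eplus E (push E r' d) (push E (neg (ident E X1)) d1)"]
        G.l_cancel_one'[of "push E r d" "eplus E (push E r' d) (push E (neg (ident E X1)) d1)"]
        G.m_closed[of "push E r' d"] rd nd pr' by simp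
    have "push E r' d = eplus E (push E r' d) (eplus E (push E (neg (ident E X1)) d1) d1)"
      using inv[OF D1(6,3)] ezero_plus[OF pr' D1(3,1)] by simp
    also have "\<dots> = eplus E (ezero E Z X1) d1"
      using G.m_assoc[of "push E r' d" "push E (neg (ident E X1)) d1" d1] pr' nd D1(6) z by simp
    finally show ?thesis using ezero_plus[OF D1(6,3,1)] by simp
  qed
  obtain s where "biproduct E X2 X1 G s u v r'" using biproduct_change[OF b r' r'u] .
  from tri_zero[OF this] have ts: "tri X2 s G r' X1 (ezero E X1 X2)" .
  obtain W k q c d3 where w: "tri X2 (h \<bullet> s) M k W d3" "tri X1 q W c Z (push E r' d)"
    "q \<bullet> r' = k \<bullet> h"
    using ET4[OF ts g(1)] by blast
  note DW = triD[OF w(1)] triD[OF w(2)]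
  obtain b where b: "b \<in> Hom E W Y1" "is_iso E b" "b \<bullet> q = x1"
    using tri_unique[OF w(2)[unfolded r'd] t1] by auto
  obtain d4 where t4: "tri X2 (h \<bullet> s) M (b \<bullet> k) Y1 d4" using tri_iso_right[OF w(1) b(1,2)] .
  have "(b \<bullet> k) \<bullet> m1 = b \<bullet> k \<bullet> h \<bullet> u" using b(1) DW DG DG' by (simp add: in_Hom g(3)[symmetric])
  also have "\<dots> = b \<bullet> q \<bullet> r' \<bullet> u"
    using cmp_reduce[OF w(3)[symmetric] DG(4) DW(5), of u] DG' DW r' by (simp add: in_Hom)
  also have "\<dots> = x1" using r'u DW b by (simp add: in_Hom)
  finally show ?thesis using that[OF t3 t4] by simp
qed

text \<open>Composing \<open>X \<rightarrow> Y\<close> with the inflation \<open>Y \<rightarrow> V\<close> that realizes \<open>e\<close>, one gets a triangle \<open>Z \<rightarrow> G \<rightarrow> W\<close> for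
  \<open>g\<^sub>* e\<close>.  If it splits, the extension of \<open>G\<close> by \<open>X\<close> pulls back along the section to a preimage of \<open>e\<close>.\<close>

lemma ext_middle_exact:
  assumes t: "tri X f Y g Z d" and e: "e \<in> Ext E W Y" "W \<in> objs E" "push E g e = ezero E W Z"
  obtains e' where "e' \<in> Ext E W X" "push E f e' = e"
proof -
  note d = triD[OF t]
  obtain p V q where v: "tri Y p V q W e" using realized[OF e(1,2) d(2)] .
  obtain G h u v d'' where g: "tri X (p \<bullet> f) V h G d''" "tri Z u G v W (push E g e)"
    "push E f d'' = pull E v e"
    using ET4[OF t v] by blast
  note DG = triD[OF g(1)] triD[OF g(2)]
  obtain s r where "biproduct E Z W G u s r v" using split_tri g(2) e(3) by metis
  note B = biproductD[OF this]
  have "push E f (pull E s d'') = pull E s (pull E v e)"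
    using push_pull[OF d(4) B(5) DG(6)] g(3) by simp
  also have "\<dots> = e"
    using pull_cmp[OF B(7,5) d(2) e(1)] B(9) pull_ident[OF e(2) d(2) e(1)] by simp
  finally show ?thesis using that pull_closed[OF B(5) d(1) DG(6)] by blast
qed

text \<open>
  A horseshoe: resolutions \<open>A \<rightarrow> X\<close> and \<open>D \<rightarrow> Z\<close> of the ends of a triangle \<open>X \<rightarrow> Y \<rightarrow> Z\<close> such that
  \<open>D \<rightarrow> Z\<close> lifts to \<open>Y\<close> give a resolution of \<open>Y\<close> by \<open>A \<oplus> D\<close>, whose kernel is an extension of the
  two kernels.  The extension class of the kernels is pulled back along an arrow \<open>w\<close> into \<open>X\<close> whose
  image in \<open>Y\<close> passes through \<open>D\<close>; this last remark controls liftings to the kernel \<open>L\<close>.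
\<close>

lemma horseshoe:
  assumes t: "tri X x Y y Z d" and tX: "tri KX a A a' X dX" and tZ: "tri KZ k D k' Z dZ"
    and lift: "pull E k' d = ezero E D X"
  obtains L h B b dL u v w c s where "is_dsum E A D B" "tri L h B b Y dL"
    "tri KX u L v KZ (pull E w dX)" "w \<in> Hom E KZ X" "c \<in> Hom E D Y" "s \<in> Hom E KZ D"
    "x \<bullet> w = c \<bullet> s"
proof -
  note dt = triD[OF t] and dX = triD[OF tX] and dZ = triD[OF tZ]
  obtain Q m1 e1 m2 e2 dQ where q: "tri X m1 Q e1 D (pull E k' d)" "tri KZ m2 Q e2 Y dQ" "e2 \<bullet> m1 = x"
    using pullback_of_deflations[OF t tZ] .
  obtain j p where bQ: "biproduct E X D Q m1 j p e1" using split_tri q(1) lift by metis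
  note BQ = biproductD[OF bQ] and dQ = triD[OF q(2)]
  obtain N where N: "N \<in> objs E" "ident E N = zarr E N N" using zero_object by auto
  obtain B iA jA pA qA where bB: "biproduct E A D B iA jA pA qA"
    using biproducts[OF dX(2) dZ(2)] by (auto simp: is_dsum_def)
  note BB = biproductD[OF bB]
  note tO = zero_tris(2)[OF N dZ(2)] and bO = biproduct_zero(1)[OF dX(1) N]
  define f where "f = aplus E (iA \<bullet> a \<bullet> ident E KX) (jA \<bullet> zarr E N D \<bullet> zarr E KX N)"
  define g where "g = aplus E (m1 \<bullet> a' \<bullet> pA) (j \<bullet> ident E D \<bullet> qA)"
  define \<delta> where "\<delta> = eplus E (push E (ident E KX) (pull E p dX)) (push E (zarr E N KX) (pull E e1 (ezero E D N)))"
  have r: "(f, g) \<in> realization E \<delta>"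
    unfolding f_def g_def \<delta>_def by (rule real_sum[OF tX tO bO bB bQ])
  have pd: "pull E p dX \<in> Ext E Q KX" using pull_closed[OF BQ(6) dX(1,6)] .
  have zO: "zarr E N KX \<in> Hom E N KX" using N dX by (simp add: in_Hom)
  have "\<delta> = eplus E (pull E p dX) (ezero E Q KX)"
    using push_ident[OF BQ(3) dX(1) pd] pull_ezero[OF BQ(7) N(1)] push_ezero[OF zO BQ(3)]
    by (simp add: \<delta>_def)
  then have \<delta>: "\<delta> = pull E p dX" using ezero_plus[OF pd BQ(3) dX(1)] by simp
  have "f \<in> Hom E KX B" "g \<in> Hom E B Q" using BB BQ dX dZ N by (simp_all add: f_def g_def in_Hom)
  then have tB: "tri KX f B g Q (pull E p dX)" using r \<delta> pd BB BQ dX by (simp add: etriangle_def)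
  obtain L h u v dL where l: "tri L h B (e2 \<bullet> g) Y dL" "tri KX u L v KZ (pull E m2 (pull E p dX))"
    using ET4_op[OF tB q(2)] by blast
  have 1: "tri KX u L v KZ (pull E (p \<bullet> m2) dX)" using l(2) pull_cmp[OF BQ(6) dQ(4) dX(1,6)] by simp
  have 2: "p \<bullet> m2 \<in> Hom E KZ X" using BQ dQ by (simp add: in_Hom)
  have 3: "neg (e2 \<bullet> j) \<in> Hom E D Y" "e1 \<bullet> m2 \<in> Hom E KZ D" using BQ dQ by (simp_all add: in_Hom)
  have "zarr E KZ Y = e2 \<bullet> aplus E (m1 \<bullet> p) (j \<bullet> e1) \<bullet> m2"
    using BQ dQ tri_cmp_zero[OF q(2)] by (simp add: in_Hom)
  also have "\<dots> = aplus E (e2 \<bullet> m1 \<bullet> p \<bullet> m2) (e2 \<bullet> j \<bullet> e1 \<bullet> m2)"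
    using BQ(4-7) dQ by (simp add: in_Hom)
  also have "e2 \<bullet> m1 \<bullet> p \<bullet> m2 = x \<bullet> p \<bullet> m2"
    using cmp_reduce[OF q(3) BQ(4) dQ(5), of "p \<bullet> m2"] BQ dQ by (simp add: in_Hom)
  finally have *: "aplus E (x \<bullet> p \<bullet> m2) (e2 \<bullet> j \<bullet> e1 \<bullet> m2) = zarr E KZ Y" by simp
  have 4: "x \<bullet> p \<bullet> m2 = neg (e2 \<bullet> j) \<bullet> e1 \<bullet> m2"
    using * eq_iff_diff_zero[of "x \<bullet> p \<bullet> m2" "neg (e2 \<bullet> j \<bullet> e1 \<bullet> m2)"] BQ(4-7) dQ dt by (simp add: in_Hom)
  have "is_dsum E A D B" using bB by (auto simp: is_dsum_def)
  then show ?thesis using that[OF _ l(1) 1 2 3 4] by simp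
qed

end

section \<open>Vanishing of extensions and the shift\<close>

context extriangulated_category
begin

definition ext_vanish :: "'o \<Rightarrow> 'o \<Rightarrow> bool" where
  "ext_vanish W N \<longleftrightarrow> (\<forall>d \<in> Ext E W N. d = ezero E W N)"

lemma trivial_ext_iff:
  assumes "W \<in> objs E" "N \<in> objs E"
  shows "trivial_group (ext_group E W N) \<longleftrightarrow> ext_vanish W N"
  using ext_group[OF assms] ezero_closed[OF assms] by (auto simp: trivial_group_def ext_vanish_def)

lemma ext_vanish_retract:
  assumes "i \<in> Hom E V W" "p \<in> Hom E W V" "p \<bullet> i = ident E V" "N \<in> objs E"
  shows "ext_vanish W N \<Longrightarrow> ext_vanish V N" "ext_vanish N W \<Longrightarrow> ext_vanish N V"
proof -
  have o: "V \<in> objs E" "W \<in> objs E" using Hom_obj[OF assms(1)] by auto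
  show "ext_vanish V N" if v: "ext_vanish W N"
    unfolding ext_vanish_def
  proof
    fix d assume d: "d \<in> Ext E V N"
    have "d = pull E i (pull E p d)"
      using pull_cmp[OF assms(2,1,4) d] pull_ident[OF o(1) assms(4) d] assms(3) by simp
    also have "\<dots> = ezero E V N"
      using v pull_closed[OF assms(2,4) d] pull_ezero[OF assms(1,4)] by (simp add: ext_vanish_def)
    finally show "d = ezero E V N" .
  qed
  show "ext_vanish N V" if v: "ext_vanish N W"
    unfolding ext_vanish_def
  proof
    fix d assume d: "d \<in> Ext E N V"
    have "d = push E p (push E i d)"
      using push_cmp[OF assms(1,2,4) d] push_ident[OF assms(4) o(1) d] assms(3) by simp
    also have "\<dots> = ezero E N V"
      using v push_closed[OF assms(1,4) d] push_ezero[OF assms(2,4)] by (simp add: ext_vanish_def)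
    finally show "d = ezero E N V" .
  qed
qed

lemma ext_vanish_dsum:
  assumes "biproduct E V W Z i j p q" "N \<in> objs E" "ext_vanish V N" "ext_vanish W N"
  shows "ext_vanish Z N"
  unfolding ext_vanish_def
proof
  note B = biproductD[OF assms(1)]
  fix d assume d: "d \<in> Ext E Z N"
  have 1: "i \<bullet> p \<in> Hom E Z Z" "j \<bullet> q \<in> Hom E Z Z" using B by (simp_all add: in_Hom)
  have 2: "pull E (i \<bullet> p) d = ezero E Z N"
    using pull_cmp[OF B(4,6) assms(2) d] assms(3) pull_closed[OF B(4) assms(2) d] pull_ezero[OF B(6) assms(2)]
    by (simp add: ext_vanish_def)
  have 3: "pull E (j \<bullet> q) d = ezero E Z N"
    using pull_cmp[OF B(5,7) assms(2) d] assms(4) pull_closed[OF B(5) assms(2) d] pull_ezero[OF B(7) assms(2)]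
    by (simp add: ext_vanish_def)
  show "d = ezero E Z N"
    using pull_plus[OF 1 assms(2) d] B(12) pull_ident[OF B(3) assms(2) d] 2 3 ezero_plus assms(2) B(3)
    by simp
qed

lemma ext_vanish_middle:
  assumes t: "tri X f Y g Z d" and W: "W \<in> objs E" "ext_vanish W X" "ext_vanish W Z"
  shows "ext_vanish W Y"
  unfolding ext_vanish_def
proof
  note D = triD[OF t]
  fix e assume e: "e \<in> Ext E W Y"
  have "push E g e = ezero E W Z" using W(3) push_closed[OF D(5) W(1) e] by (simp add: ext_vanish_def)
  then obtain e' where e': "e' \<in> Ext E W X" "push E f e' = e" using ext_middle_exact[OF t e W(1)] by metis
  then have "e' = ezero E W X" using W(2) by (simp add: ext_vanish_def)
  then show "e = ezero E W Y" using e'(2) push_ezero[OF D(4) W(1)] by simp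
qed

lemma lift_of_vanish:
  assumes t: "tri X f Y g Z d" and "ext_vanish W X" "h \<in> Hom E W Z"
  obtains k where "k \<in> Hom E W Y" "g \<bullet> k = h"
  using lift_iff[OF t assms(3)] assms(2) pull_closed[OF assms(3) triD(1,6)[OF t]] that
  by (auto simp: ext_vanish_def)

lemma extend_of_vanish:
  assumes t: "tri X f Y g Z d" and "ext_vanish Z W" "h \<in> Hom E X W"
  obtains k where "k \<in> Hom E Y W" "k \<bullet> f = h"
  using extend_iff[OF t assms(3)] assms(2) push_closed[OF assms(3) triD(3,6)[OF t]] that
  by (auto simp: ext_vanish_def)

lemma projective_iff: "P \<in> projectives E \<longleftrightarrow> P \<in> objs E \<and> (\<forall>X \<in> objs E. ext_vanish P X)"
  by (auto simp: projectives_def trivial_ext_iff)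

lemma injective_iff: "P \<in> injectives E \<longleftrightarrow> P \<in> objs E \<and> (\<forall>X \<in> objs E. ext_vanish X P)"
  by (auto simp: injectives_def trivial_ext_iff)

end

context frobenius_extriangulated_category
begin

lemma projectiveD:
  assumes "P \<in> projectives E"
  shows "P \<in> objs E" "X \<in> objs E \<Longrightarrow> ext_vanish P X" "X \<in> objs E \<Longrightarrow> ext_vanish X P"
  using assms projective_iff[of P] injective_iff[of P] projectives_eq_injectives by auto

lemma projective_dsum:
  assumes "biproduct E V W Z i j p q" "V \<in> projectives E" "W \<in> projectives E"
  shows "Z \<in> projectives E"
  using assms ext_vanish_dsum[OF assms(1)] biproductD(3)[OF assms(1)] by (simp add: projective_iff)

abbreviation null_arrows where "null_arrows \<equiv> factoring E (projectives E)"

lemma nullE: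
  assumes "h \<in> null_arrows X Y"
  obtains P f g where "P \<in> projectives E" "f \<in> Hom E X P" "g \<in> Hom E P Y" "h = g \<bullet> f"
  using assms by (auto simp: factoring_def)

lemma nullI: "P \<in> projectives E \<Longrightarrow> f \<in> Hom E X P \<Longrightarrow> g \<in> Hom E P Y \<Longrightarrow> g \<bullet> f \<in> null_arrows X Y"
  by (auto simp: factoring_def)

definition syzygy where
  "syzygy W = (SOME A. \<exists>f P g d. P \<in> projectives E \<and> tri A f P g W d)"

lemma syzygy_tri:
  assumes "W \<in> objs E"
  obtains f P g d where "P \<in> projectives E" "tri (syzygy W) f P g W d"
  using enough_projectives[OF assms] someI_ex[of "\<lambda>A. \<exists>f P g d. P \<in> projectives E \<and> tri A f P g W d"]
  unfolding syzygy_def by blast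

lemma suspension_tri:
  assumes "N \<in> objs E"
  obtains f I g d where "I \<in> projectives E" "tri N f I g (suspension E N) d"
proof -
  have "\<exists>A I f g d. I \<in> projectives E \<and> tri N f I g A d"
    using enough_injectives[OF assms] projectives_eq_injectives by metis
  then have "\<exists>I f g d. I \<in> projectives E \<and> tri N f I g (suspension E N) d"
    unfolding suspension_def by (rule someI_ex)
  then show ?thesis using that by blast
qed

lemma syzygy_obj: "W \<in> objs E \<Longrightarrow> syzygy W \<in> objs E"
  using syzygy_tri triD(1) by metis

lemma suspension_obj: "N \<in> objs E \<Longrightarrow> suspension E N \<in> objs E"
  using suspension_tri triD(3) by metis

lemma syzygy_pow_obj: "W \<in> objs E \<Longrightarrow> (syzygy ^^ i) W \<in> objs E"
  by (induction i) (simp_all add: syzygy_obj)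

lemma suspension_pow_obj: "N \<in> objs E \<Longrightarrow> (suspension E ^^ i) N \<in> objs E"
  by (induction i) (simp_all add: suspension_obj)

text \<open>
  Either side says that every arrow \<open>\<Omega>W \<rightarrow> \<Sigma>N\<close> factors through a projective-injective object.  So the
  vanishing of higher extensions can be tested by resolving the first argument instead of the
  second one.
\<close>

lemma vanish_shift:
  assumes W: "W \<in> objs E" and N: "N \<in> objs E"
  shows "ext_vanish W (suspension E N) \<longleftrightarrow> ext_vanish (syzygy W) N"
proof -
  let ?V = "syzygy W" and ?U = "suspension E N"
  obtain a P b dW where P: "P \<in> projectives E" and tW: "tri ?V a P b W dW" using syzygy_tri[OF W] .
  obtain f I g dU where I: "I \<in> projectives E" and tU: "tri N f I g ?U dU" using suspension_tri[OF N] .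
  note DW = triD[OF tW] and DU = triD[OF tU]
  show ?thesis
  proof
    assume v: "ext_vanish W ?U"
    show "ext_vanish ?V N"
      unfolding ext_vanish_def
    proof
      fix e assume e: "e \<in> Ext E ?V N"
      have "push E f e = ezero E ?V I"
        using push_closed[OF DU(4) DW(1) e] projectiveD(3)[OF I DW(1)] by (simp add: ext_vanish_def)
      then obtain c where c: "c \<in> Hom E ?V ?U" "pull E c dU = e" using ext_from_push[OF tU e DW(1)] by metis
      obtain k where k: "k \<in> Hom E P ?U" "k \<bullet> a = c" using extend_of_vanish[OF tW v c(1)] .
      obtain k' where k': "k' \<in> Hom E P I" "g \<bullet> k' = k"
        using lift_of_vanish[OF tU projectiveD(2)[OF P N] k(1)] .
      have "g \<bullet> k' \<bullet> a = c" using cmp_reduce[OF k'(2,1) DU(5), of a] DW k(2) by (simp add: in_Hom)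
      moreover have "k' \<bullet> a \<in> Hom E ?V I" using k' DW by (simp add: in_Hom)
      ultimately show "e = ezero E ?V N" using lift_iff[OF tU c(1)] c(2) by auto
    qed
  next
    assume v: "ext_vanish ?V N"
    show "ext_vanish W ?U"
      unfolding ext_vanish_def
    proof
      fix e assume e: "e \<in> Ext E W ?U"
      have "pull E b e = ezero E P ?U"
        using pull_closed[OF DW(5) DU(3) e] projectiveD(2)[OF P DU(3)] by (simp add: ext_vanish_def)
      then obtain c where c: "c \<in> Hom E ?V ?U" "push E c dW = e" using ext_from_pull[OF tW e DU(3)] by metis
      obtain k where k: "k \<in> Hom E ?V I" "g \<bullet> k = c" using lift_of_vanish[OF tU v c(1)] .
      obtain k' where k': "k' \<in> Hom E P I" "k' \<bullet> a = k"
        using extend_of_vanish[OF tW projectiveD(3)[OF I W] k(1)] .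
      have "(g \<bullet> k') \<bullet> a = c" using k k' DU DW by (simp add: in_Hom)
      moreover have "g \<bullet> k' \<in> Hom E P ?U" using k' DU by (simp add: in_Hom)
      ultimately show "e = ezero E W ?U" using extend_iff[OF tW c(1)] c(2) by auto
    qed
  qed
qed

lemma vanish_shift_pow:
  assumes "W \<in> objs E" "N \<in> objs E"
  shows "ext_vanish W ((suspension E ^^ i) N) \<longleftrightarrow> ext_vanish ((syzygy ^^ i) W) N"
  using assms
proof (induction i arbitrary: W)
  case (Suc i)
  have "ext_vanish W ((suspension E ^^ Suc i) N) \<longleftrightarrow> ext_vanish (syzygy W) ((suspension E ^^ i) N)"
    using vanish_shift Suc.prems suspension_pow_obj by simp
  also have "\<dots> \<longleftrightarrow> ext_vanish ((syzygy ^^ i) (syzygy W)) N" using Suc syzygy_obj by simp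
  finally show ?case by (simp add: funpow_swap1)
qed simp

lemma vanish_higher_ext:
  assumes "W \<in> objs E" "N \<in> objs E" "i \<ge> 1"
  shows "trivial_group (higher_ext E i W N) \<longleftrightarrow> ext_vanish ((syzygy ^^ (i - 1)) W) N"
  using assms by (simp add: higher_ext_def trivial_ext_iff suspension_pow_obj vanish_shift_pow)

text \<open>Dimension shift: an arrow \<open>\<Omega>V \<rightarrow> Z\<close> extends to a projective object if \<open>\<E>(V, Z) = 0\<close>, and from there
  it lifts along the deflation onto \<open>Z\<close>, so it gives no extension of \<open>\<Omega>V\<close> by the kernel.\<close>

lemma vanish_kernel:
  assumes t: "tri X f Y g Z d" and V: "V \<in> objs E" "ext_vanish V Z" "ext_vanish (syzygy V) Y"
  shows "ext_vanish (syzygy V) X"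
  unfolding ext_vanish_def
proof
  note D = triD[OF t]
  obtain a P b dV where P: "P \<in> projectives E" and tV: "tri (syzygy V) a P b V dV" using syzygy_tri[OF V(1)] .
  note DV = triD[OF tV]
  fix e assume e: "e \<in> Ext E (syzygy V) X"
  have "push E f e = ezero E (syzygy V) Y"
    using push_closed[OF D(4) DV(1) e] V(3) by (simp add: ext_vanish_def)
  then obtain c where c: "c \<in> Hom E (syzygy V) Z" "pull E c d = e" using ext_from_push[OF t e DV(1)] by metis
  obtain k where k: "k \<in> Hom E P Z" "k \<bullet> a = c" using extend_of_vanish[OF tV V(2) c(1)] .
  obtain k' where k': "k' \<in> Hom E P Y" "g \<bullet> k' = k"
    using lift_of_vanish[OF t projectiveD(2)[OF P D(1)] k(1)] .
  have "g \<bullet> k' \<bullet> a = c" using cmp_reduce[OF k'(2,1) D(5), of a] DV k(2) by (simp add: in_Hom)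
  moreover have "k' \<bullet> a \<in> Hom E (syzygy V) Y" using k' DV by (simp add: in_Hom)
  ultimately show "e = ezero E (syzygy V) X" using lift_iff[OF t c(1)] c(2) by auto
qed

end

section \<open>The cluster tilting subcategory\<close>

lemma all_pred_less: "(\<forall>i. 1 \<le> i \<and> i \<le> m \<longrightarrow> P (i - 1)) \<longleftrightarrow> (\<forall>i < m. P i)" for m :: nat
proof (intro iffI allI impI)
  fix i assume "\<forall>i. 1 \<le> i \<and> i \<le> m \<longrightarrow> P (i - 1)" "i < m"
  then show "P i" by (auto dest: spec[of _ "Suc i"])
next
  fix i assume "\<forall>i < m. P i" "1 \<le> i \<and> i \<le> m"
  then show "P (i - 1)" by auto
qed

locale cluster_tilting_category = frobenius_extriangulated_category K E
  for K :: "('k, 'r) ring_scheme" and E :: "('o, 'm, 'k, 'e, 'z) extcat_scheme" (structure) +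
  fixes T :: 'o and n :: nat
  assumes ks: "krull_schmidt E" and wic: "WIC E" and n_pos: "n \<ge> 1"
    and tilting: "cluster_tilting_object E n T"
begin

abbreviation \<T> where "\<T> \<equiv> add_closure E T"

lemma T_obj: "T \<in> objs E"
  using tilting by (simp add: cluster_tilting_object_def)

lemma T_objs: "S \<in> \<T> \<Longrightarrow> S \<in> objs E"
  by (auto simp: add_closure_def is_finite_dsum_def)

lemma T_right: "M \<in> \<T> \<longleftrightarrow> M \<in> objs E \<and> (\<forall>S \<in> \<T>. \<forall>i < n - 1. ext_vanish ((syzygy ^^ i) S) M)"
proof -
  have eq: "\<T> = {M \<in> objs E. \<forall>X \<in> \<T>. \<forall>i. 1 \<le> i \<and> i \<le> n - 1 \<longrightarrow> trivial_group (higher_ext E i X M)}"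
    using tilting unfolding cluster_tilting_object_def cluster_tilting_def by (elim conjE) assumption
  have "M \<in> \<T> \<longleftrightarrow> M \<in> objs E \<and>
      (\<forall>X \<in> \<T>. \<forall>i. 1 \<le> i \<and> i \<le> n - 1 \<longrightarrow> trivial_group (higher_ext E i X M))"
    using arg_cong[OF eq, of "\<lambda>A. M \<in> A"] by (simp only: mem_Collect_eq)
  also have "\<dots> \<longleftrightarrow> M \<in> objs E \<and> (\<forall>X \<in> \<T>. \<forall>i. 1 \<le> i \<and> i \<le> n - 1 \<longrightarrow> ext_vanish ((syzygy ^^ (i - 1)) X) M)"
    using vanish_higher_ext T_objs by blast
  also have "(\<forall>X \<in> \<T>. \<forall>i. 1 \<le> i \<and> i \<le> n - 1 \<longrightarrow> ext_vanish ((syzygy ^^ (i - 1)) X) M)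
      \<longleftrightarrow> (\<forall>X \<in> \<T>. \<forall>i < n - 1. ext_vanish ((syzygy ^^ i) X) M)"
    (is "(\<forall>X \<in> \<T>. ?L X) \<longleftrightarrow> (\<forall>X \<in> \<T>. ?R X)")
  proof (intro ball_cong refl)
    fix X show "?L X \<longleftrightarrow> ?R X" by (rule all_pred_less[of "n - 1" "\<lambda>i. ext_vanish ((syzygy ^^ i) X) M"])
  qed
  finally show ?thesis .
qed

lemma T_left: "M \<in> \<T> \<longleftrightarrow> M \<in> objs E \<and> (\<forall>S \<in> \<T>. \<forall>i < n - 1. ext_vanish M ((suspension E ^^ i) S))"
proof -
  have eq: "\<T> = {M \<in> objs E. \<forall>X \<in> \<T>. \<forall>i. 1 \<le> i \<and> i \<le> n - 1 \<longrightarrow> trivial_group (higher_ext E i M X)}"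
    using tilting unfolding cluster_tilting_object_def cluster_tilting_def by (elim conjE) assumption
  have "M \<in> \<T> \<longleftrightarrow> M \<in> objs E \<and>
      (\<forall>X \<in> \<T>. \<forall>i. 1 \<le> i \<and> i \<le> n - 1 \<longrightarrow> trivial_group (higher_ext E i M X))"
    using arg_cong[OF eq, of "\<lambda>A. M \<in> A"] by (simp only: mem_Collect_eq)
  also have "\<dots> \<longleftrightarrow> M \<in> objs E \<and> (\<forall>X \<in> \<T>. \<forall>i. 1 \<le> i \<and> i \<le> n - 1 \<longrightarrow> ext_vanish M ((suspension E ^^ (i - 1)) X))"
    using T_objs by (auto simp: higher_ext_def trivial_ext_iff suspension_pow_obj)
  also have "(\<forall>X \<in> \<T>. \<forall>i. 1 \<le> i \<and> i \<le> n - 1 \<longrightarrow> ext_vanish M ((suspension E ^^ (i - 1)) X))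
      \<longleftrightarrow> (\<forall>X \<in> \<T>. \<forall>i < n - 1. ext_vanish M ((suspension E ^^ i) X))"
    (is "(\<forall>X \<in> \<T>. ?L X) \<longleftrightarrow> (\<forall>X \<in> \<T>. ?R X)")
  proof (intro ball_cong refl)
    fix X show "?L X \<longleftrightarrow> ?R X" by (rule all_pred_less[of "n - 1" "\<lambda>i. ext_vanish M ((suspension E ^^ i) X)"])
  qed
  finally show ?thesis .
qed

lemma T_retract:
  assumes "Z \<in> \<T>" "i \<in> Hom E W Z" "p \<in> Hom E Z W" "p \<bullet> i = ident E W" shows "W \<in> \<T>"
  using assms(1) ext_vanish_retract(1)[OF assms(2-4)] Hom_obj[OF assms(2)] suspension_pow_obj T_objs
  unfolding T_left[of W] T_left[of Z] by blast

lemma T_dsum: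
  assumes "V \<in> \<T>" "W \<in> \<T>" "is_dsum E V W Z" shows "Z \<in> \<T>"
proof -
  obtain i j p q where b: "biproduct E V W Z i j p q" using assms(3) by (auto simp: is_dsum_def)
  show ?thesis
    using ext_vanish_dsum[OF b] biproductD(3)[OF b] assms(1,2) suspension_pow_obj T_objs
    unfolding T_left[of Z] T_left[of V] T_left[of W] by blast
qed

lemma projective_in_T: "P \<in> projectives E \<Longrightarrow> P \<in> \<T>"
  using projectiveD suspension_pow_obj T_objs unfolding T_left[of P] by blast

lemma T_in_T: "T \<in> \<T>"
proof -
  obtain Q where Q: "Q \<in> objs E" "ident E Q = zarr E Q Q" using zero_object by auto
  have "is_summand E T T"
    using biproduct_zero(1)[OF T_obj Q] unfolding is_summand_def is_dsum_def by blast
  moreover have "is_finite_dsum E [T] T"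
  proof -
    interpret M: abelian_group "hom_module E T T" using T_obj T_obj by (rule hom_group)
    have "finsum (hom_module E T T) (\<lambda>a. ident E T \<bullet> ident E T) {..<length [T]} = ident E T"
    proof -
      have "{..<length [T]} = {0::nat}" by auto
      moreover have "(\<lambda>a::nat. ident E T \<bullet> ident E T) \<in> {} \<rightarrow> carrier (hom_module E T T)" by simp
      moreover have "ident E T \<bullet> ident E T \<in> carrier (hom_module E T T)" using T_obj by (simp add: in_Hom)
      ultimately show ?thesis using T_obj M.finsum_insert[of "{}" "0::nat" "\<lambda>a. ident E T \<bullet> ident E T"]
        by (simp add: in_Hom)
    qed
    then show ?thesis using T_obj unfolding is_finite_dsum_def
      by (intro conjI exI[of _ "\<lambda>_. ident E T"]) (simp_all add: in_Hom)
  qed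
  ultimately show ?thesis unfolding add_closure_def by (auto intro!: exI[of _ "[T]"])
qed

text \<open>Objects whose extensions from \<open>\<T>\<close> vanish up to degree \<open>k\<close>.  They interpolate between all
  objects (\<open>k = 0\<close>) and \<open>\<T>\<close> itself (\<open>k = n - 1\<close>).\<close>

definition orth :: "nat \<Rightarrow> 'o set" where
  "orth k = {M \<in> objs E. \<forall>S \<in> \<T>. \<forall>i < k. ext_vanish ((syzygy ^^ i) S) M}"

lemma orth_top: "orth (n - 1) = \<T>"
proof (rule Set.set_eqI)
  show "M \<in> orth (n - 1) \<longleftrightarrow> M \<in> \<T>" for M
    unfolding orth_def mem_Collect_eq using T_right[of M] by blast
qed

lemma orth_0: "orth 0 = objs E"
  by (simp add: orth_def)

lemma T_orth: "k \<le> n - 1 \<Longrightarrow> S \<in> \<T> \<Longrightarrow> S \<in> orth k"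
  unfolding orth_def using iffD1[OF T_right[of S]] by (blast intro: less_le_trans)

lemma orth_vanish: "M \<in> orth k \<Longrightarrow> k > 0 \<Longrightarrow> S \<in> \<T> \<Longrightarrow> ext_vanish S M"
  by (force simp: orth_def)

lemma orth_extension:
  assumes t: "tri X f Y g Z d" and "X \<in> orth k" "Z \<in> orth k" shows "Y \<in> orth k"
  using assms ext_vanish_middle[OF t] triD(2)[OF t] syzygy_pow_obj T_objs by (simp add: orth_def)

text \<open>Surjectivity on arrows from \<open>\<T>\<close>; a right approximation is such an arrow with source in \<open>\<T>\<close>.\<close>

definition epic :: "'m \<Rightarrow> bool" where
  "epic g \<longleftrightarrow> (\<forall>S \<in> \<T>. \<forall>h \<in> Hom E S (tgt E g). \<exists>k \<in> Hom E S (src E g). g \<bullet> k = h)"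

lemma epicE:
  assumes "epic g" "g \<in> Hom E Y Z" "S \<in> \<T>" "h \<in> Hom E S Z"
  obtains k where "k \<in> Hom E S Y" "g \<bullet> k = h"
proof -
  have "src E g = Y" "tgt E g = Z" using assms(2) by (simp_all add: in_Hom)
  then show ?thesis using assms(1,3,4) that unfolding epic_def by blast
qed

lemma epicI:
  assumes "g \<in> Hom E Y Z" "\<And>S h. S \<in> \<T> \<Longrightarrow> h \<in> Hom E S Z \<Longrightarrow> \<exists>k \<in> Hom E S Y. g \<bullet> k = h"
  shows "epic g"
  using assms by (auto simp: epic_def in_Hom)

lemma epic_of_vanish:
  assumes t: "tri X f Y g Z d" and "\<And>S. S \<in> \<T> \<Longrightarrow> ext_vanish S X" shows "epic g"
  using lift_of_vanish[OF t] assms(2) triD(5)[OF t] by (metis epicI)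

lemma epic_of_orth: "tri X f Y g Z d \<Longrightarrow> X \<in> orth k \<Longrightarrow> k > 0 \<Longrightarrow> epic g"
  using epic_of_vanish orth_vanish by blast

lemma vanish_of_epic:
  assumes t: "tri X f Y g Z d" and g: "epic g" and S: "S \<in> \<T>" "ext_vanish S Y"
  shows "ext_vanish S X"
  unfolding ext_vanish_def
proof
  note D = triD[OF t]
  fix e assume e: "e \<in> Ext E S X"
  have "push E f e = ezero E S Y"
    using push_closed[OF D(4) T_objs[OF S(1)] e] S(2) by (simp add: ext_vanish_def)
  then obtain c where c: "c \<in> Hom E S Z" "pull E c d = e" using ext_from_push[OF t e T_objs[OF S(1)]] by metis
  then show "e = ezero E S X" using lift_iff[OF t c(1)] epicE[OF g D(5) S(1) c(1)] by metis
qed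

text \<open>Taking the kernel of an approximation gains one degree of vanishing, so that the kernels of an
  iterated resolution end up in \<open>\<T>\<close> after \<open>n - 1\<close> steps.\<close>

lemma orth_kernel:
  assumes t: "tri K' h L f M d" and f: "epic f" and L: "L \<in> \<T>" and M: "M \<in> orth k" and k: "Suc k \<le> n - 1"
  shows "K' \<in> orth (Suc k)"
  unfolding orth_def
proof (intro CollectI conjI ballI allI impI)
  show "K' \<in> objs E" using triD[OF t] by simp
  fix S i assume S: "S \<in> \<T>" and i: "i < Suc k"
  have "i < n - 1" using i k by simp
  then have LS: "ext_vanish ((syzygy ^^ i) S) L" using iffD1[OF T_right[of L] L] S by blast
  show "ext_vanish ((syzygy ^^ i) S) K'"
  proof (cases i)
    case 0
    then show ?thesis using vanish_of_epic[OF t f S] LS by simp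
  next
    case (Suc j)
    have "ext_vanish ((syzygy ^^ j) S) M" using M S i Suc by (simp add: orth_def)
    then show ?thesis using vanish_kernel[OF t syzygy_pow_obj[OF T_objs[OF S]]] LS Suc by simp
  qed
qed

lemma split_of_epic:
  assumes t: "tri X f Y g Z d" and g: "epic g" and Z: "Z \<in> \<T>"
  shows "is_dsum E X Z Y"
proof -
  note D = triD[OF t]
  have "ident E Z \<in> Hom E Z Z" using D by (simp add: in_Hom)
  then have "pull E (ident E Z) d = ezero E Z X" using lift_iff[OF t] epicE[OF g D(5) Z] by metis
  then have "tri X f Y g Z (ezero E Z X)" using t pull_ident[OF D(3,1,6)] by simp
  then show ?thesis using split_tri unfolding is_dsum_def by metis
qed

text \<open>A right approximation is a deflation by (WIC), because a deflation from a projective object, which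
  lies in \<open>\<T>\<close>, factors through it.\<close>

lemma ex_minimal_approx:
  assumes M: "M \<in> objs E"
  obtains X h L f d where "tri X h L f M d" "L \<in> \<T>" "right_approx E \<T> f" "right_minimal E f"
proof -
  obtain f0 where f0: "tgt E f0 = M" "right_approx E \<T> f0"
    using tilting M by (auto simp: cluster_tilting_object_def cluster_tilting_def functorially_finite_def)
  obtain f where f: "right_approx E \<T> f" "right_minimal E f" "tgt E f = tgt E f0"
  proof (rule ex_right_minimal_approx[OF ks _ _ f0(2)])
    show "\<T> \<subseteq> objs E" using T_objs by blast
    show "W \<in> \<T>" if "Z \<in> \<T>" "i \<in> Hom E W Z" "p \<in> Hom E Z W" "p \<bullet> i = ident E W" for W Z i p
      using T_retract that by blast
  qed (rule that)
  have fH: "f \<in> Hom E (src E f) M" "src E f \<in> \<T>" using f f0 by (auto simp: right_approx_def in_Hom)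
  obtain A a P p d where P: "P \<in> projectives E" and tP: "tri A a P p M d" using enough_projectives[OF M] by blast
  have p: "p \<in> Hom E P M" using triD[OF tP] by simp
  then obtain k where k: "k \<in> Hom E P (src E f)" "f \<bullet> k = p"
    using f(1,3) f0(1) projective_in_T[OF P] by (auto simp: right_approx_def)
  have "deflation E p" using tP unfolding deflation_def by blast
  then have "deflation E f" using wic k fH unfolding WIC_def in_Hom by metis
  then obtain X h L Z d where t: "tri X h L f Z d" by (auto simp: deflation_def)
  then have "L = src E f" "Z = M" using triD(5)[OF t] fH by (auto simp: in_Hom)
  then show ?thesis using that t f fH by auto
qed

lemma epic_of_approx: "right_approx E \<T> f \<Longrightarrow> epic f"
  by (simp add: right_approx_def epic_def)

end

section \<open>Split Grothendieck groups\<close>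

lemma (in comm_group) additive_resolution:
  assumes "b \<in> carrier G" "p \<in> carrier G" "q \<in> carrier G" "x \<in> carrier G" "y \<in> carrier G" "z \<in> carrier G"
    and eq: "y \<otimes> (p \<otimes> q) = (x \<otimes> z) \<otimes> b"
  shows "b \<otimes> inv y = (p \<otimes> inv x) \<otimes> (q \<otimes> inv z)"
proof -
  have c: "y \<otimes> (s \<otimes> (inv y \<otimes> t)) = s \<otimes> t" if "s \<in> carrier G" "t \<in> carrier G" for s t
    using that assms(5) m_lcomm[of y s "inv y \<otimes> t"] by (simp add: m_assoc[symmetric])
  have "b = inv (x \<otimes> z) \<otimes> (y \<otimes> (p \<otimes> q))"
    using inv_solve_left[of b "x \<otimes> z" "y \<otimes> (p \<otimes> q)"] assms by simp
  then have "b \<otimes> inv y = ((inv x \<otimes> inv z) \<otimes> (y \<otimes> (p \<otimes> q))) \<otimes> inv y"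
    using assms(1-6) by (simp add: inv_mult)
  also have "\<dots> = (p \<otimes> inv x) \<otimes> (q \<otimes> inv z)" using assms(1-6) by (simp add: m_ac c)
  finally show ?thesis .
qed

lemma (in comm_group) solve_exchange:
  assumes "x \<in> carrier G" "y \<in> carrier G" "p \<in> carrier G" "q \<in> carrier G" "x \<otimes> q = y \<otimes> p"
  shows "x \<otimes> inv p = y \<otimes> inv q"
proof -
  have c: "q \<otimes> (inv q \<otimes> t) = t" if "t \<in> carrier G" for t
    using that assms(4) by (simp add: m_assoc[symmetric])
  have c': "p \<otimes> (inv p \<otimes> t) = t" if "t \<in> carrier G" for t
    using that assms(3) by (simp add: m_assoc[symmetric])
  have "x \<otimes> inv p = (x \<otimes> q) \<otimes> (inv q \<otimes> inv p)" using assms(1-4) by (simp add: m_assoc c)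
  also have "\<dots> = (y \<otimes> p) \<otimes> (inv q \<otimes> inv p)" by (simp only: assms(5))
  also have "\<dots> = y \<otimes> inv q" using assms(1-4) m_comm[of "inv q" "inv p"] by (simp add: m_assoc c')
  finally show ?thesis .
qed

context
  fixes S :: "'x set" and eqv :: "'x \<Rightarrow> 'x \<Rightarrow> bool" and sumrel :: "'x \<Rightarrow> 'x \<Rightarrow> 'x \<Rightarrow> bool"
begin

lemma split_relations_normal: "split_relations S eqv sumrel \<lhd> free_on_classes S eqv"
proof -
  interpret G: comm_group "free_on_classes S eqv" by (rule abelian_free_Abelian_group)
  have "{frag_of (iso_class S eqv z) - (frag_of (iso_class S eqv x) + frag_of (iso_class S eqv y))
       | x y z. x \<in> S \<and> y \<in> S \<and> z \<in> S \<and> sumrel x y z} \<subseteq> carrier (free_on_classes S eqv)"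
  proof clarify
    fix x y z assume "x \<in> S" "y \<in> S" "z \<in> S"
    then show "frag_of (iso_class S eqv z) - (frag_of (iso_class S eqv x) + frag_of (iso_class S eqv y))
        \<in> carrier (free_on_classes S eqv)"
      using keys_diff[of "frag_of (iso_class S eqv z)" "frag_of (iso_class S eqv x) + frag_of (iso_class S eqv y)"]
        keys_add[of "frag_of (iso_class S eqv x)" "frag_of (iso_class S eqv y)"]
      by auto
  qed
  then show ?thesis
    unfolding split_relations_def by (intro G.subgroup_imp_normal G.generate_is_subgroup)
qed

lemma K0_split_comm_group: "comm_group (K0_split S eqv sumrel)"
proof -
  interpret G: comm_group "free_on_classes S eqv" by (rule abelian_free_Abelian_group)
  show ?thesis unfolding K0_split_def
    using G.abelian_FactGroup normal_imp_subgroup[OF split_relations_normal] by blast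
qed

lemma K0_split_class_closed:
  assumes "x \<in> S" shows "K0_split_class S eqv sumrel x \<in> carrier (K0_split S eqv sumrel)"
  using assms by (auto simp: K0_split_def K0_split_class_def carrier_FactGroup)

lemma K0_split_class_dsum:
  assumes "x \<in> S" "y \<in> S" "z \<in> S" "sumrel x y z"
  shows "K0_split_class S eqv sumrel z
    = K0_split_class S eqv sumrel x \<otimes>\<^bsub>K0_split S eqv sumrel\<^esub> K0_split_class S eqv sumrel y"
proof -
  interpret G: comm_group "free_on_classes S eqv" by (rule abelian_free_Abelian_group)
  interpret N: normal "split_relations S eqv sumrel" "free_on_classes S eqv" by (rule split_relations_normal)
  let ?x = "frag_of (iso_class S eqv x)" and ?y = "frag_of (iso_class S eqv y)"
    and ?z = "frag_of (iso_class S eqv z)"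
  have c: "?x \<in> carrier (free_on_classes S eqv)" "?y \<in> carrier (free_on_classes S eqv)"
    "?z \<in> carrier (free_on_classes S eqv)" using assms by auto
  have "?z - (?x + ?y) \<in> split_relations S eqv sumrel"
    unfolding split_relations_def by (rule generate.incl) (use assms in blast)
  then have "?z \<in> split_relations S eqv sumrel #>\<^bsub>free_on_classes S eqv\<^esub> (?x + ?y)"
    unfolding r_coset_def by (auto intro!: bexI[of _ "?z - (?x + ?y)"])
  then have "split_relations S eqv sumrel #>\<^bsub>free_on_classes S eqv\<^esub> ?z
      = split_relations S eqv sumrel #>\<^bsub>free_on_classes S eqv\<^esub> (?x + ?y)"
    using G.repr_independence[OF _ _ N.is_subgroup] c G.m_closed[OF c(1,2)] by simp
  then show ?thesis
    using N.rcos_sum[OF c(1,2)] by (simp add: K0_split_def K0_split_class_def)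
qed

end

section \<open>Additivity of the index\<close>

context cluster_tilting_category
begin

abbreviation \<K> where "\<K> \<equiv> K0sp_sub E \<T>"
abbreviation cls where "cls \<equiv> class_sub E \<T>"
abbreviation ind where "ind \<equiv> index E \<T> n"
abbreviation \<Theta> where "\<Theta> \<equiv> Theta E \<T> n"

sublocale \<K>: comm_group \<K>
  by (simp add: K0sp_sub_def K0_split_comm_group)

lemma cls_closed [simp]: "S \<in> \<T> \<Longrightarrow> cls S \<in> carrier \<K>"
  by (simp add: K0sp_sub_def class_sub_def K0_split_class_closed)

lemma cls_dsum:
  assumes "V \<in> \<T>" "W \<in> \<T>" "is_dsum E V W Z" shows "cls Z = cls V \<otimes>\<^bsub>\<K>\<^esub> cls W"
  unfolding K0sp_sub_def class_sub_def
  by (rule K0_split_class_dsum[where S = \<T> and eqv = "isomorphic E" and sumrel = "is_dsum E"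
      and x = V and y = W and z = Z, OF assms(1,2) T_dsum[OF assms] assms(3)])

lemma zero_in_T:
  assumes "Q \<in> objs E" "ident E Q = zarr E Q Q" shows "Q \<in> \<T>"
  by (rule T_retract[OF T_in_T, of "zarr E Q T" Q "zarr E T Q"]) (use assms T_obj in \<open>auto simp: in_Hom\<close>)

lemma cls_zero:
  assumes "Q \<in> objs E" "ident E Q = zarr E Q Q" shows "cls Q = \<one>\<^bsub>\<K>\<^esub>"
proof -
  have Q: "Q \<in> \<T>" using zero_in_T[OF assms] .
  have "is_dsum E Q Q Q" using biproduct_zero(1)[OF assms(1) assms] unfolding is_dsum_def by blast
  then have "cls Q \<otimes>\<^bsub>\<K>\<^esub> cls Q = cls Q" by (rule cls_dsum[OF Q Q, symmetric])
  then show ?thesis using \<K>.l_cancel_one[of "cls Q" "cls Q"] Q by simp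
qed

text \<open>
  \<open>resolution_class m M v\<close>: \<open>v\<close> is the alternating sum of some resolution of \<open>M\<close> of length \<open>m\<close> by
  right approximations, not necessarily minimal ones.  Dropping minimality makes room for the
  direct sums and pullbacks of resolutions that prove additivity and uniqueness together.
\<close>

primrec resolution_class where
  "resolution_class 0 M v \<longleftrightarrow> M \<in> \<T> \<and> v = cls M"
| "resolution_class (Suc m) M v \<longleftrightarrow> (\<exists>K' h L f d w. tri K' h L f M d \<and> L \<in> \<T> \<and> epic f \<and>
      resolution_class m K' w \<and> v = cls L \<otimes>\<^bsub>\<K>\<^esub> inv\<^bsub>\<K>\<^esub> w)"

lemma resolution_class_closed: "resolution_class m M v \<Longrightarrow> v \<in> carrier \<K>"
  by (induction m arbitrary: M v) auto

lemma resolution_class_T: "S \<in> \<T> \<Longrightarrow> resolution_class m S (cls S)"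
proof (induction m arbitrary: S)
  case (Suc m)
  obtain Q where Q: "Q \<in> objs E" "ident E Q = zarr E Q Q" using zero_object by auto
  have t: "tri Q (zarr E Q S) S (ident E S) S (ezero E S Q)"
    using zero_tris(2)[OF Q T_objs[OF Suc.prems]] .
  moreover have "epic (ident E S)" using T_objs[OF Suc.prems] by (intro epicI) (auto simp: in_Hom)
  moreover have "resolution_class m Q (cls Q)" using Suc.IH zero_in_T[OF Q] .
  ultimately show ?case using cls_zero[OF Q] Suc.prems
    unfolding resolution_class.simps
    by (intro exI[of _ Q] exI[of _ "zarr E Q S"] exI[of _ S] exI[of _ "ident E S"]
        exI[of _ "ezero E S Q"] exI[of _ "cls Q"]) simp
qed simp

lemma resolution_class_exists:
  assumes "m + k = n - 1" "M \<in> orth k" shows "\<exists>v. resolution_class m M v"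
  using assms
proof (induction m arbitrary: k M)
  case 0
  then show ?case using orth_top by auto
next
  case (Suc m)
  have "M \<in> objs E" using Suc.prems by (simp add: orth_def)
  then obtain K' h L f d where t: "tri K' h L f M d" "L \<in> \<T>" "right_approx E \<T> f" using ex_minimal_approx by metis
  have e: "epic f" using epic_of_approx t(3) .
  have "K' \<in> orth (Suc k)" using orth_kernel[OF t(1) e t(2) Suc.prems(2)] Suc.prems(1) by simp
  then obtain w where "resolution_class m K' w" using Suc.IH[of "Suc k" K'] Suc.prems(1) by auto
  then show ?case using t e unfolding resolution_class.simps by blast
qed

text \<open>
  Induction on the length of the resolutions.  The horseshoe yields a resolution of \<open>Y\<close> whose class
  is the sum by the induction hypothesis for the kernels.  It need not be the given resolution of
  \<open>Y\<close>; a pullback of the two is an extension of each approximation by the kernel of the other one,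
  and the induction hypothesis for these two extensions identifies the classes.
\<close>

lemma resolution_class_additive:
  assumes "m + k = n - 1" "tri X x Y y Z d" "epic y" "X \<in> orth k" "Y \<in> orth k" "Z \<in> orth k"
    "resolution_class m X a" "resolution_class m Y b" "resolution_class m Z c"
  shows "b = a \<otimes>\<^bsub>\<K>\<^esub> c"
  using assms
proof (induction m arbitrary: k X x Y y Z d a b c)
  case 0
  then show ?case using split_of_epic[OF 0(2,3)] cls_dsum by simp
next
  case (Suc m)
  note t = Suc.prems(2) and ob = Suc.prems(4,5,6)
  obtain KX hX A fX dX wX where rX: "tri KX hX A fX X dX" "A \<in> \<T>" "epic fX" "resolution_class m KX wX"
    and a: "a = cls A \<otimes>\<^bsub>\<K>\<^esub> inv\<^bsub>\<K>\<^esub> wX" using Suc.prems(7) by auto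
  obtain KY hY B fY dY wY where rY: "tri KY hY B fY Y dY" "B \<in> \<T>" "epic fY" "resolution_class m KY wY"
    and b: "b = cls B \<otimes>\<^bsub>\<K>\<^esub> inv\<^bsub>\<K>\<^esub> wY" using Suc.prems(8) by auto
  obtain KZ hZ D fZ dZ wZ where rZ: "tri KZ hZ D fZ Z dZ" "D \<in> \<T>" "epic fZ" "resolution_class m KZ wZ"
    and c: "c = cls D \<otimes>\<^bsub>\<K>\<^esub> inv\<^bsub>\<K>\<^esub> wZ" using Suc.prems(9) by auto
  have k: "Suc k \<le> n - 1" and mk: "m + Suc k = n - 1" using Suc.prems(1) by auto
  have KX: "KX \<in> orth (Suc k)" and KY: "KY \<in> orth (Suc k)" and KZ: "KZ \<in> orth (Suc k)"
    using orth_kernel[OF rX(1,3,2) ob(1) k] orth_kernel[OF rY(1,3,2) ob(2) k]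
      orth_kernel[OF rZ(1,3,2) ob(3) k] by auto
  have fZ: "fZ \<in> Hom E D Z" using triD[OF rZ(1)] by simp
  have "pull E fZ d = ezero E D X"
    using lift_iff[OF t fZ] epicE[OF Suc.prems(3) triD(5)[OF t] rZ(2) fZ] by metis
  from horseshoe[OF t rX(1) rZ(1) this]
  obtain L h AD f dL u v w where ds: "is_dsum E A D AD" and hs: "tri L h AD f Y dL"
    "tri KX u L v KZ (pull E w dX)" by metis
  have AD: "AD \<in> \<T>" "cls AD = cls A \<otimes>\<^bsub>\<K>\<^esub> cls D" using T_dsum[OF rX(2) rZ(2) ds] cls_dsum[OF rX(2) rZ(2) ds] by auto
  have L: "L \<in> orth (Suc k)" using orth_extension[OF hs(2) KX KZ] .
  obtain wL where wL: "resolution_class m L wL" using resolution_class_exists[OF mk L] by auto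
  have wL_eq: "wL = wX \<otimes>\<^bsub>\<K>\<^esub> wZ"
    using Suc.IH[OF mk hs(2) epic_of_orth[OF hs(2) KX] KX L KZ rX(4) wL rZ(4)] by simp
  obtain R m1 e1 m2 e2 dR where R: "tri KY m1 R e1 AD (pull E f dY)" "tri L m2 R e2 B dR"
    using pullback_of_deflations[OF rY(1) hs(1)] by metis
  have ADo: "AD \<in> orth (Suc k)" and Bo: "B \<in> orth (Suc k)" using T_orth[OF k] AD(1) rY(2) by auto
  have Ro: "R \<in> orth (Suc k)" using orth_extension[OF R(1) KY ADo] .
  obtain r where r: "resolution_class m R r" using resolution_class_exists[OF mk Ro] by auto
  have "r = wY \<otimes>\<^bsub>\<K>\<^esub> cls AD"
    using Suc.IH[OF mk R(1) epic_of_orth[OF R(1) KY] KY Ro ADo rY(4) r resolution_class_T[OF AD(1)]] by simp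
  moreover have "r = wL \<otimes>\<^bsub>\<K>\<^esub> cls B"
    using Suc.IH[OF mk R(2) epic_of_orth[OF R(2) L] L Ro Bo wL r resolution_class_T[OF rY(2)]] by simp
  ultimately have "wY \<otimes>\<^bsub>\<K>\<^esub> (cls A \<otimes>\<^bsub>\<K>\<^esub> cls D) = (wX \<otimes>\<^bsub>\<K>\<^esub> wZ) \<otimes>\<^bsub>\<K>\<^esub> cls B" using AD(2) wL_eq by simp
  then show ?case unfolding a b c
    using rX(2,4) rY(2,4) rZ(2,4) resolution_class_closed by (intro \<K>.additive_resolution) auto
qed

text \<open>Additivity on the triangle \<open>M \<rightarrow> M \<rightarrow> 0\<close>, with different resolutions for the two copies of \<open>M\<close>.\<close>

lemma resolution_class_unique:
  assumes "resolution_class (n - 1) M v" "resolution_class (n - 1) M w" "M \<in> objs E" shows "v = w"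
proof -
  obtain Q where Q: "Q \<in> objs E" "ident E Q = zarr E Q Q" using zero_object by auto
  have t: "tri M (ident E M) M (zarr E M Q) Q (ezero E Q M)" using zero_tris(1)[OF Q assms(3)] .
  have "epic (zarr E M Q)"
  proof (rule epicI)
    show "zarr E M Q \<in> Hom E M Q" using assms(3) Q by (simp add: in_Hom)
    fix S h assume S: "S \<in> \<T>" and h: "h \<in> Hom E S Q"
    have "h = ident E Q \<bullet> h" using h by (simp add: in_Hom)
    also have "\<dots> = zarr E S Q" unfolding Q(2) using h Q(1) by (simp add: in_Hom)
    finally have "zarr E M Q \<bullet> zarr E S M = h" using T_objs[OF S] assms(3) Q(1) by simp
    then show "\<exists>k \<in> Hom E S M. zarr E M Q \<bullet> k = h"
      using T_objs[OF S] assms(3) by (auto simp: in_Hom intro!: bexI[of _ "zarr E S M"])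
  qed
  then have "w = v \<otimes>\<^bsub>\<K>\<^esub> cls Q"
    using resolution_class_additive[OF _ t, of "n - 1" 0 v w "cls Q"] assms Q(1)
      resolution_class_T[OF zero_in_T[OF Q]] by (simp add: orth_0)
  then show ?thesis using cls_zero[OF Q] resolution_class_closed[OF assms(1)] by simp
qed

lemma alternating_product_Suc:
  assumes "\<And>i. F i \<in> carrier \<K>"
  shows "finprod \<K> (\<lambda>i. F i [^]\<^bsub>\<K>\<^esub> ((-1) ^ i :: int)) {..<Suc m}
    = F 0 \<otimes>\<^bsub>\<K>\<^esub> inv\<^bsub>\<K>\<^esub> finprod \<K> (\<lambda>i. F (Suc i) [^]\<^bsub>\<K>\<^esub> ((-1) ^ i :: int)) {..<m}"
proof (induction m)
  case 0
  have "finprod \<K> (\<lambda>i. F i [^]\<^bsub>\<K>\<^esub> ((-1) ^ i :: int)) {..<Suc 0} = F 0 [^]\<^bsub>\<K>\<^esub> (1::int)"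
    using assms by (simp add: lessThan_Suc)
  then show ?case using assms[of 0] by simp
next
  case (Suc m)
  let ?P = "\<lambda>G. \<lambda>i. G i [^]\<^bsub>\<K>\<^esub> ((-1) ^ i :: int)"
  have cl: "?P G i \<in> carrier \<K>" if "\<And>i. G i \<in> carrier \<K>" for G and i :: nat using that by simp
  have clS: "\<And>i. F (Suc i) \<in> carrier \<K>" using assms by simp
  have ins: "finprod \<K> (?P G) {..<Suc j} = ?P G j \<otimes>\<^bsub>\<K>\<^esub> finprod \<K> (?P G) {..<j}"
    if "\<And>i. G i \<in> carrier \<K>" for G and j :: nat
    unfolding lessThan_Suc using cl[OF that] by (subst \<K>.finprod_insert) auto
  have fin: "finprod \<K> (?P (\<lambda>i. F (Suc i))) {..<m} \<in> carrier \<K>" using cl[OF clS] by (intro \<K>.finprod_closed) auto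
  have "finprod \<K> (?P F) {..<Suc (Suc m)}
      = inv\<^bsub>\<K>\<^esub> (?P (\<lambda>i. F (Suc i)) m) \<otimes>\<^bsub>\<K>\<^esub> (F 0 \<otimes>\<^bsub>\<K>\<^esub> inv\<^bsub>\<K>\<^esub> finprod \<K> (?P (\<lambda>i. F (Suc i))) {..<m})"
    using ins[of F "Suc m", OF assms] Suc clS[of m] by (simp add: \<K>.int_pow_neg)
  also have "\<dots> = F 0 \<otimes>\<^bsub>\<K>\<^esub> inv\<^bsub>\<K>\<^esub> (?P (\<lambda>i. F (Suc i)) m \<otimes>\<^bsub>\<K>\<^esub> finprod \<K> (?P (\<lambda>i. F (Suc i))) {..<m})"
    using assms[of 0] cl[of "\<lambda>i. F (Suc i)" m, OF clS] fin by (simp add: \<K>.inv_mult \<K>.m_ac)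
  finally show ?case using ins[of "\<lambda>i. F (Suc i)" m, OF clS] by simp
qed

lemma resolution_class_of_terms:
  assumes "\<And>i. i < m \<Longrightarrow> L i \<in> \<T> \<and> (\<exists>h f d. tri (K' (Suc i)) h (L i) f (K' i) d \<and> epic f)"
    and "K' m = L m" and "L m \<in> \<T>"
  shows "resolution_class m (K' 0)
    (finprod \<K> (\<lambda>i. cls (L i) [^]\<^bsub>\<K>\<^esub> ((-1) ^ i :: int)) {..<Suc m})"
  using assms
proof (induction m arbitrary: K' L)
  case 0
  then have "finprod \<K> (\<lambda>i. cls (L i) [^]\<^bsub>\<K>\<^esub> ((-1) ^ i :: int)) {..<Suc 0} = cls (L 0) [^]\<^bsub>\<K>\<^esub> (1::int)"
    by (simp add: lessThan_Suc)
  then show ?case using 0 by simp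
next
  case (Suc m)
  have L: "L i \<in> \<T>" if "i < Suc (Suc m)" for i using Suc.prems(1)[of i] Suc.prems(3) that less_Suc_eq by auto
  have r: "resolution_class m (K' (Suc 0))
      (finprod \<K> (\<lambda>i. cls (L (Suc i)) [^]\<^bsub>\<K>\<^esub> ((-1) ^ i :: int)) {..<Suc m})"
    using Suc.IH[of "\<lambda>i. L (Suc i)" "\<lambda>i. K' (Suc i)"] Suc.prems by auto
  define F where "F i = (if i < Suc (Suc m) then cls (L i) else \<one>\<^bsub>\<K>\<^esub>)" for i
  have F: "\<And>i. F i \<in> carrier \<K>" using L by (simp add: F_def)
  have 1: "finprod \<K> (\<lambda>i. cls (L i) [^]\<^bsub>\<K>\<^esub> ((-1) ^ i :: int)) {..<Suc (Suc m)}
      = finprod \<K> (\<lambda>i. F i [^]\<^bsub>\<K>\<^esub> ((-1) ^ i :: int)) {..<Suc (Suc m)}"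
    using L by (intro \<K>.finprod_cong') (auto simp: F_def)
  have 2: "finprod \<K> (\<lambda>i. cls (L (Suc i)) [^]\<^bsub>\<K>\<^esub> ((-1) ^ i :: int)) {..<Suc m}
      = finprod \<K> (\<lambda>i. F (Suc i) [^]\<^bsub>\<K>\<^esub> ((-1) ^ i :: int)) {..<Suc m}"
    using L by (intro \<K>.finprod_cong') (auto simp: F_def)
  have "finprod \<K> (\<lambda>i. cls (L i) [^]\<^bsub>\<K>\<^esub> ((-1) ^ i :: int)) {..<Suc (Suc m)}
     = cls (L 0) \<otimes>\<^bsub>\<K>\<^esub> inv\<^bsub>\<K>\<^esub> finprod \<K> (\<lambda>i. cls (L (Suc i)) [^]\<^bsub>\<K>\<^esub> ((-1) ^ i :: int)) {..<Suc m}"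
    unfolding 1 2 using alternating_product_Suc[of F "Suc m", OF F] by (simp add: F_def)
  moreover obtain h f d where "tri (K' (Suc 0)) h (L 0) f (K' 0) d" "epic f" using Suc.prems(1)[of 0] by auto
  ultimately show ?case using r L[of 0] unfolding resolution_class.simps by blast
qed

lemma ex_index_resolution_terms:
  assumes "m + k = n - 1" "M \<in> orth k"
  shows "\<exists>K' L. K' 0 = M \<and> (\<forall>i < m. L i \<in> \<T> \<and>
        (\<exists>h f d. tri (K' (Suc i)) h (L i) f (K' i) d \<and> right_approx E \<T> f \<and> right_minimal E f)) \<and>
     K' m = L m \<and> L m \<in> \<T>"
  using assms
proof (induction m arbitrary: k M)
  case 0
  then show ?case using orth_top by (auto intro!: exI[of _ "\<lambda>_. M"])
next
  case (Suc m)
  have "M \<in> objs E" using Suc.prems by (simp add: orth_def)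
  then obtain X h L0 f d where t: "tri X h L0 f M d" "L0 \<in> \<T>" "right_approx E \<T> f" "right_minimal E f"
    using ex_minimal_approx by metis
  have "X \<in> orth (Suc k)"
    using orth_kernel[OF t(1) epic_of_approx[OF t(3)] t(2) Suc.prems(2)] Suc.prems(1) by simp
  then obtain K' L where K: "K' 0 = X" "\<forall>i < m. L i \<in> \<T> \<and>
        (\<exists>h f d. tri (K' (Suc i)) h (L i) f (K' i) d \<and> right_approx E \<T> f \<and> right_minimal E f)"
     "K' m = L m" "L m \<in> \<T>" using Suc.IH[of "Suc k" X] Suc.prems(1) by auto
  let ?K = "case_nat M K'" and ?L = "case_nat L0 L"
  have "?L i \<in> \<T> \<and> (\<exists>h f d. tri (?K (Suc i)) h (?L i) f (?K i) d \<and> right_approx E \<T> f \<and> right_minimal E f)"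
    if "i < Suc m" for i
  proof (cases i)
    case 0
    then show ?thesis using t K(1) by auto
  next
    case (Suc j)
    then show ?thesis using K(2) that by auto
  qed
  then show ?case using K(3,4) by (intro exI[of _ ?K] exI[of _ ?L]) auto
qed

lemma index_resolution_class:
  assumes M: "M \<in> objs E" shows "resolution_class (n - 1) M (ind M)"
proof -
  have n: "Suc (n - 1) = n" using n_pos by simp
  have "\<exists>v K' L. index_resolution E \<T> n M K' L \<and>
     v = finprod \<K> (\<lambda>i. cls (L i) [^]\<^bsub>\<K>\<^esub> ((-1) ^ i :: int)) {..<n}"
    using ex_index_resolution_terms[of "n - 1" 0 M] M by (auto simp: index_resolution_def orth_0)
  then have "\<exists>K' L. index_resolution E \<T> n M K' L \<and>
     ind M = finprod \<K> (\<lambda>i. cls (L i) [^]\<^bsub>\<K>\<^esub> ((-1) ^ i :: int)) {..<n}"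
    unfolding index_def by (rule someI_ex)
  then obtain K' L where r: "index_resolution E \<T> n M K' L"
    and v: "ind M = finprod \<K> (\<lambda>i. cls (L i) [^]\<^bsub>\<K>\<^esub> ((-1) ^ i :: int)) {..<n}" by blast
  have "resolution_class (n - 1) (K' 0) (finprod \<K> (\<lambda>i. cls (L i) [^]\<^bsub>\<K>\<^esub> ((-1) ^ i :: int)) {..<Suc (n - 1)})"
  proof (rule resolution_class_of_terms)
    fix i assume "i < n - 1"
    then show "L i \<in> \<T> \<and> (\<exists>h f d. tri (K' (Suc i)) h (L i) f (K' i) d \<and> epic f)"
      using r epic_of_approx unfolding index_resolution_def by blast
  qed (use r in \<open>auto simp: index_resolution_def\<close>)
  then show ?thesis using r v n by (simp add: index_resolution_def)
qed

lemma ind_closed [simp]: "M \<in> objs E \<Longrightarrow> ind M \<in> carrier \<K>"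
  using resolution_class_closed index_resolution_class by blast

lemma ind_T: "S \<in> \<T> \<Longrightarrow> ind S = cls S"
  using resolution_class_unique[OF index_resolution_class resolution_class_T] T_objs by blast

lemma ind_additive:
  assumes "tri X x Y y Z d" "epic y" shows "ind Y = ind X \<otimes>\<^bsub>\<K>\<^esub> ind Z"
  using resolution_class_additive[OF _ assms, of "n - 1" 0] index_resolution_class triD[OF assms(1)]
  by (simp add: orth_0)

section \<open>Additivity of Theta\<close>

lemma projective_lift:
  assumes t: "tri X f Y g Z d" and P: "P \<in> projectives E" "h \<in> Hom E P Z"
  obtains k where "k \<in> Hom E P Y" "g \<bullet> k = h"
  using lift_of_vanish[OF t projectiveD(2)[OF P(1) triD(1)[OF t]] P(2)] .

lemma injective_extend:
  assumes t: "tri X f Y g Z d" and P: "P \<in> projectives E" "h \<in> Hom E X P"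
  obtains k where "k \<in> Hom E Y P" "k \<bullet> f = h"
  using extend_of_vanish[OF t projectiveD(3)[OF P(1) triD(3)[OF t]] P(2)] .

lemma null_lift:
  assumes t: "tri X f Y g Z d" and h: "h \<in> null_arrows W Z"
  obtains k where "k \<in> null_arrows W Y" "g \<bullet> k = h"
proof -
  obtain P a b where P: "P \<in> projectives E" "a \<in> Hom E W P" "b \<in> Hom E P Z" "h = b \<bullet> a" using nullE[OF h] .
  obtain k where k: "k \<in> Hom E P Y" "g \<bullet> k = b" using projective_lift[OF t P(1,3)] .
  have "g \<bullet> k \<bullet> a = h" using cmp_reduce[OF k(2,1) triD(5)[OF t], of a] P by (simp add: in_Hom)
  then show ?thesis using that nullI[OF P(1,2) k(1)] by blast
qed

lemma epic_onto_projective: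
  assumes t: "tri X f Y g P d" and P: "P \<in> projectives E" shows "epic g"
proof (rule epicI)
  have id: "ident E P \<in> Hom E P P" using projectiveD(1)[OF P] by (simp add: in_Hom)
  show g: "g \<in> Hom E Y P" using triD[OF t] by simp
  fix S h assume h: "h \<in> Hom E S P"
  obtain s where s: "s \<in> Hom E P Y" "g \<bullet> s = ident E P" using projective_lift[OF t P id] .
  have "g \<bullet> s \<bullet> h = h" "s \<bullet> h \<in> Hom E S Y"
    using cmp_cancel_middle[OF s(2,1) g] h s by (simp_all add: in_Hom)
  then show "\<exists>k \<in> Hom E S Y. g \<bullet> k = h" by blast
qed

text \<open>The pullback of two deflations \<open>P \<rightarrow> X \<leftarrow> P2\<close> from projective objects extends each of these by the kernel of
  the other, and additivity of the index makes the two candidates for \<open>\<Theta>(X)\<close> agree.\<close>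

lemma Theta_eq:
  assumes t: "tri X' h P f X d" and P: "P \<in> projectives E"
  shows "\<Theta> X = ind X' \<otimes>\<^bsub>\<K>\<^esub> inv\<^bsub>\<K>\<^esub> cls P \<otimes>\<^bsub>\<K>\<^esub> ind X"
proof -
  have "\<exists>v X' h P f d. P \<in> projectives E \<and> tri X' h P f X d \<and>
     v = ind X' \<otimes>\<^bsub>\<K>\<^esub> inv\<^bsub>\<K>\<^esub> cls P \<otimes>\<^bsub>\<K>\<^esub> ind X" using assms by blast
  then have "\<exists>X' h P f d. P \<in> projectives E \<and> tri X' h P f X d \<and>
     \<Theta> X = ind X' \<otimes>\<^bsub>\<K>\<^esub> inv\<^bsub>\<K>\<^esub> cls P \<otimes>\<^bsub>\<K>\<^esub> ind X"
    unfolding Theta_def by (rule someI_ex)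
  then obtain X2 h2 P2 f2 d2 where P2: "P2 \<in> projectives E" and t2: "tri X2 h2 P2 f2 X d2"
    and th: "\<Theta> X = ind X2 \<otimes>\<^bsub>\<K>\<^esub> inv\<^bsub>\<K>\<^esub> cls P2 \<otimes>\<^bsub>\<K>\<^esub> ind X" by blast
  obtain R m1 e1 m2 e2 dR where R: "tri X2 m1 R e1 P (pull E f d2)" "tri X' m2 R e2 P2 dR"
    using pullback_of_deflations[OF t2 t] by metis
  have c: "cls P \<in> carrier \<K>" "cls P2 \<in> carrier \<K>" using P P2 projective_in_T by auto
  have i: "ind X' \<in> carrier \<K>" "ind X2 \<in> carrier \<K>" using triD(1)[OF t] triD(1)[OF t2] by auto
  have "ind X2 \<otimes>\<^bsub>\<K>\<^esub> cls P = ind X' \<otimes>\<^bsub>\<K>\<^esub> cls P2"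
    using ind_additive[OF R(1) epic_onto_projective[OF R(1) P]]
      ind_additive[OF R(2) epic_onto_projective[OF R(2) P2]] ind_T projective_in_T P P2 by simp
  then have "ind X2 \<otimes>\<^bsub>\<K>\<^esub> inv\<^bsub>\<K>\<^esub> cls P2 = ind X' \<otimes>\<^bsub>\<K>\<^esub> inv\<^bsub>\<K>\<^esub> cls P"
    using \<K>.solve_exchange[OF i(2,1) c(2,1)] by simp
  then show ?thesis using th by simp
qed

text \<open>
  \<open>\<Theta>\<close> combines the index of an object and of its syzygy.  Surjectivity of \<open>H(Y) \<rightarrow> H(Z)\<close> makes the first
  additive; the second one is additive because injectivity of \<open>H(X) \<rightarrow> H(Y)\<close> says that the arrows
  from \<open>\<T>\<close> to the syzygy of \<open>Z\<close> lift to that of \<open>Y\<close>: the obstruction is a stable arrow into \<open>X\<close> that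
  vanishes in \<open>Y\<close>.
\<close>

lemma Theta_additive:
  assumes t: "tri X x Y y Z d" and ep: "epic y"
    and mono: "\<And>S h. S \<in> \<T> \<Longrightarrow> h \<in> Hom E S X \<Longrightarrow> x \<bullet> h \<in> null_arrows S Y \<Longrightarrow> h \<in> null_arrows S X"
  shows "\<Theta> Y = \<Theta> X \<otimes>\<^bsub>\<K>\<^esub> \<Theta> Z"
proof -
  note dt = triD[OF t]
  obtain KX hX A fX dX where A: "A \<in> projectives E" and tX: "tri KX hX A fX X dX"
    using enough_projectives[OF dt(1)] by blast
  obtain KZ hZ D fZ dZ where D: "D \<in> projectives E" and tZ: "tri KZ hZ D fZ Z dZ"
    using enough_projectives[OF dt(3)] by blast
  note dX = triD[OF tX] and dZ = triD[OF tZ]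
  have "pull E fZ d = ezero E D X" using lift_iff[OF t dZ(5)] projective_lift[OF t D dZ(5)] by metis
  from horseshoe[OF t tX tZ this]
  obtain L h B f dL u v w c s where ds: "is_dsum E A D B" and hs: "tri L h B f Y dL"
    "tri KX u L v KZ (pull E w dX)" and w: "w \<in> Hom E KZ X" "c \<in> Hom E D Y" "s \<in> Hom E KZ D"
    "x \<bullet> w = c \<bullet> s" by metis
  have B: "B \<in> projectives E" using ds projective_dsum[OF _ A D] unfolding is_dsum_def by blast
  have "epic v"
  proof (rule epicI)
    show "v \<in> Hom E L KZ" using triD[OF hs(2)] by simp
    fix S k assume S: "S \<in> \<T>" and k: "k \<in> Hom E S KZ"
    have wk: "w \<bullet> k \<in> Hom E S X" using w k by (simp add: in_Hom)
    have "x \<bullet> w \<bullet> k = c \<bullet> s \<bullet> k" using cmp_eq_middle[OF w(4,1) dt(4) w(3,2), of k] k by (simp add: in_Hom)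
    moreover have "c \<bullet> s \<bullet> k \<in> null_arrows S Y" using nullI[OF D, of "s \<bullet> k" S c Y] w k by (simp add: in_Hom)
    ultimately have "w \<bullet> k \<in> null_arrows S X" using mono[OF S wk] by simp
    then obtain z where "z \<in> null_arrows S A" "fX \<bullet> z = w \<bullet> k" using null_lift[OF tX] by metis
    moreover from this have "z \<in> Hom E S A" by (auto simp: factoring_def in_Hom)
    ultimately have "pull E (w \<bullet> k) dX = ezero E S KX" using lift_iff[OF tX wk] by blast
    then have "pull E k (pull E w dX) = ezero E S KX" using pull_cmp[OF w(1) k dX(1,6)] by simp
    then show "\<exists>j \<in> Hom E S L. v \<bullet> j = k" using lift_iff[OF hs(2) k] by simp
  qed
  then have 1: "ind L = ind KX \<otimes>\<^bsub>\<K>\<^esub> ind KZ" using ind_additive[OF hs(2)] by simp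
  have 2: "ind Y = ind X \<otimes>\<^bsub>\<K>\<^esub> ind Z" using ind_additive[OF t ep] .
  have 3: "cls B = cls A \<otimes>\<^bsub>\<K>\<^esub> cls D" using cls_dsum[OF _ _ ds] A D projective_in_T by simp
  have cl: "cls A \<in> carrier \<K>" "cls D \<in> carrier \<K>" "ind KX \<in> carrier \<K>" "ind KZ \<in> carrier \<K>"
    "ind X \<in> carrier \<K>" "ind Z \<in> carrier \<K>" using A D projective_in_T dX dZ dt by auto
  show ?thesis
    unfolding Theta_eq[OF hs(1) B] Theta_eq[OF tX A] Theta_eq[OF tZ D] 1 2 3
    using cl by (simp add: \<K>.inv_mult \<K>.m_ac)
qed

end

section \<open>The stable category\<close>

context frobenius_extriangulated_category
begin

abbreviation stab where "stab \<equiv> arr_class E (projectives E)"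
abbreviation \<A> where "\<A> \<equiv> stable_category E"

lemma null_Hom: "h \<in> null_arrows X Y \<Longrightarrow> h \<in> Hom E X Y"
  by (auto simp: factoring_def in_Hom)

lemma null_left: "h \<in> null_arrows X Y \<Longrightarrow> g \<in> Hom E Y Z \<Longrightarrow> g \<bullet> h \<in> null_arrows X Z"
proof (erule nullE)
  fix P a b assume P: "P \<in> projectives E" "a \<in> Hom E X P" "b \<in> Hom E P Y" "h = b \<bullet> a" and g: "g \<in> Hom E Y Z"
  then have "g \<bullet> h = (g \<bullet> b) \<bullet> a" "g \<bullet> b \<in> Hom E P Z" by (simp_all add: in_Hom)
  then show ?thesis using nullI[OF P(1,2), of "g \<bullet> b" Z] by simp
qed

lemma null_right: "h \<in> null_arrows X Y \<Longrightarrow> g \<in> Hom E W X \<Longrightarrow> h \<bullet> g \<in> null_arrows W Y"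
proof (erule nullE)
  fix P a b assume P: "P \<in> projectives E" "a \<in> Hom E X P" "b \<in> Hom E P Y" "h = b \<bullet> a" and g: "g \<in> Hom E W X"
  then have "h \<bullet> g = b \<bullet> a \<bullet> g" "a \<bullet> g \<in> Hom E W P" by (simp_all add: in_Hom)
  then show ?thesis using nullI[OF P(1) _ P(3), of "a \<bullet> g" W] by simp
qed

lemma null_neg: "h \<in> null_arrows X Y \<Longrightarrow> neg h \<in> null_arrows X Y"
proof (erule nullE)
  fix P a b assume P: "P \<in> projectives E" "a \<in> Hom E X P" "b \<in> Hom E P Y" "h = b \<bullet> a"
  then have "neg h = neg b \<bullet> a" "neg b \<in> Hom E P Y" by (simp_all add: in_Hom)
  then show ?thesis using nullI[OF P(1,2), of "neg b" Y] by simp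
qed

lemma null_plus:
  assumes "g \<in> null_arrows X Y" "h \<in> null_arrows X Y" shows "aplus E g h \<in> null_arrows X Y"
proof -
  obtain P a b where P: "P \<in> projectives E" "a \<in> Hom E X P" "b \<in> Hom E P Y" "g = b \<bullet> a" using nullE[OF assms(1)] .
  obtain Q c d where Q: "Q \<in> projectives E" "c \<in> Hom E X Q" "d \<in> Hom E Q Y" "h = d \<bullet> c" using nullE[OF assms(2)] .
  obtain Z i j p q where b: "biproduct E P Q Z i j p q"
    using biproducts projectiveD(1)[OF P(1)] projectiveD(1)[OF Q(1)] unfolding is_dsum_def by blast
  note B = biproductD[OF b]
  have Z: "Z \<in> projectives E" using projective_dsum[OF b P(1) Q(1)] .
  have "aplus E (b \<bullet> p) (d \<bullet> q) \<bullet> aplus E (i \<bullet> a) (j \<bullet> c) = aplus E g h"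
    using P(2-4) Q(2-4) B(1-11) cmp_cancel_middle[OF B(8,4,6), of a] cmp_cancel_middle[OF B(9,5,7), of c]
      cmp_zero_middle[OF B(10,4,7), of a] cmp_zero_middle[OF B(11,5,6), of c]
    by (simp add: in_Hom) (use Hom_obj[OF P(2)] Hom_obj[OF P(3)] in simp)
  moreover have "aplus E (b \<bullet> p) (d \<bullet> q) \<in> Hom E Z Y" "aplus E (i \<bullet> a) (j \<bullet> c) \<in> Hom E X Z"
    using P(2,3) Q(2,3) B by (simp_all add: in_Hom)
  ultimately show ?thesis using nullI[OF Z] by metis
qed

lemma ex_projective: obtains P where "P \<in> projectives E"
  using zero_object enough_projectives by blast

lemma null_zero: "X \<in> objs E \<Longrightarrow> Y \<in> objs E \<Longrightarrow> zarr E X Y \<in> null_arrows X Y"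
proof -
  assume o: "X \<in> objs E" "Y \<in> objs E"
  obtain P where P: "P \<in> projectives E" using ex_projective .
  then have "zarr E P Y \<bullet> zarr E X P = zarr E X Y" using o projectiveD(1)[OF P] by simp
  then show ?thesis using nullI[OF P, of "zarr E X P" X "zarr E P Y" Y] o projectiveD(1)[OF P] by (simp add: in_Hom)
qed

lemma mem_stab:
  assumes f: "f \<in> Hom E X Y"
  shows "g \<in> stab f \<longleftrightarrow> g \<in> Hom E X Y \<and> aplus E g (neg f) \<in> null_arrows X Y"
proof -
  have eq: "stab f = {aplus E h f | h. h \<in> null_arrows X Y}"
    using f by (auto simp: arr_class_def a_r_coset_def' in_Hom)
  show ?thesis
  proof
    assume "g \<in> stab f"
    then obtain h where h: "h \<in> null_arrows X Y" "g = aplus E h f" using eq by auto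
    have "aplus E g (neg f) = h" using null_Hom[OF h(1)] f h(2) by (simp add: in_Hom)
    then show "g \<in> Hom E X Y \<and> aplus E g (neg f) \<in> null_arrows X Y"
      using h null_Hom[OF h(1)] f by (simp add: in_Hom)
  next
    assume g: "g \<in> Hom E X Y \<and> aplus E g (neg f) \<in> null_arrows X Y"
    have "aplus E (aplus E g (neg f)) f = g" using g f by (simp add: in_Hom)
    then show "g \<in> stab f" using g eq by (metis (mono_tags, lifting) mem_Collect_eq)
  qed
qed

lemma stab_self: "f \<in> Hom E X Y \<Longrightarrow> f \<in> stab f"
  using mem_stab[of f X Y f] null_zero[of X Y] Hom_obj[of f X Y] by (simp add: in_Hom)

lemma stab_eq:
  assumes "f \<in> Hom E X Y" "g \<in> Hom E X Y"
  shows "stab f = stab g \<longleftrightarrow> aplus E f (neg g) \<in> null_arrows X Y"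
proof
  assume "stab f = stab g"
  then have "f \<in> stab g" using stab_self[OF assms(1)] by simp
  then show "aplus E f (neg g) \<in> null_arrows X Y" using mem_stab[OF assms(2)] by simp
next
  assume n: "aplus E f (neg g) \<in> null_arrows X Y"
  have n': "aplus E g (neg f) \<in> null_arrows X Y"
    using null_neg[OF n] assms plus_comm[of "neg f" g] by (simp add: in_Hom)
  have *: "h \<in> stab b" if "aplus E a (neg b) \<in> null_arrows X Y" "h \<in> stab a" "a \<in> Hom E X Y" "b \<in> Hom E X Y" for a b h
  proof -
    have h: "h \<in> Hom E X Y" "aplus E h (neg a) \<in> null_arrows X Y" using that mem_stab[OF that(3)] by auto
    have "aplus E (aplus E h (neg a)) (aplus E a (neg b)) = aplus E h (neg b)"
      using h(1) that(3,4) by (simp add: in_Hom)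
    then show ?thesis using null_plus[OF h(2) that(1)] mem_stab[OF that(4)] h by simp
  qed
  show "stab f = stab g" using *[OF n _ assms] *[OF n' _ assms(2,1)] by blast
qed

lemma stab_eq_zero:
  assumes "f \<in> Hom E X Y" shows "stab f = stab (zarr E X Y) \<longleftrightarrow> f \<in> null_arrows X Y"
proof -
  have o: "X \<in> objs E" "Y \<in> objs E" using Hom_obj[OF assms] by auto
  then show ?thesis using stab_eq[OF assms, of "zarr E X Y"] assms by (simp add: in_Hom)
qed

lemma stable_src_tgt:
  assumes "f \<in> Hom E X Y" shows "src \<A> (stab f) = X" "tgt \<A> (stab f) = Y"
proof -
  have "src E ` stab f = {X}" "tgt E ` stab f = {Y}"
    using mem_stab[OF assms] stab_self[OF assms] assms by (force simp: in_Hom)+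
  then show "src \<A> (stab f) = X" "tgt \<A> (stab f) = Y"
    by (simp_all add: stable_category_def quotient_category_def)
qed

lemma stable_Hom: "Hom \<A> X Y = stab ` Hom E X Y"
proof (intro equalityI subsetI)
  fix F assume "F \<in> Hom \<A> X Y"
  then obtain f where f: "f \<in> arrs E" "F = stab f" "src \<A> F = X" "tgt \<A> F = Y"
    by (auto simp: Hom_def stable_category_def quotient_category_def)
  then have "f \<in> Hom E (src E f) (tgt E f)" by (simp add: in_Hom)
  from stable_src_tgt[OF this] show "F \<in> stab ` Hom E X Y" using f by (auto simp: in_Hom)
next
  fix F assume "F \<in> stab ` Hom E X Y"
  then obtain f where f: "f \<in> Hom E X Y" "F = stab f" by auto
  then have "F \<in> arrs \<A>" by (auto simp: in_Hom stable_category_def quotient_category_def)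
  then show "F \<in> Hom \<A> X Y" using stable_src_tgt[OF f(1)] f by (simp add: in_Hom)
qed

lemma stable_cmp:
  assumes f: "f \<in> Hom E X Y" and g: "g \<in> Hom E Y Z" shows "cmp \<A> (stab g) (stab f) = stab (g \<bullet> f)"
proof -
  have *: "stab (g' \<bullet> f') = stab (g \<bullet> f)" if "g' \<in> stab g" "f' \<in> stab f" for g' f'
  proof -
    have g': "g' \<in> Hom E Y Z" "aplus E g' (neg g) \<in> null_arrows Y Z" using that mem_stab[OF g] by auto
    have f': "f' \<in> Hom E X Y" "aplus E f' (neg f) \<in> null_arrows X Y" using that mem_stab[OF f] by auto
    have "aplus E ((aplus E g' (neg g)) \<bullet> f') (g \<bullet> aplus E f' (neg f)) = aplus E (g' \<bullet> f') (neg (g \<bullet> f))"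
      using g' f' f g by (simp add: in_Hom)
    then have "aplus E (g' \<bullet> f') (neg (g \<bullet> f)) \<in> null_arrows X Z"
      using null_plus[OF null_right[OF g'(2) f'(1)] null_left[OF f'(2) g]] by simp
    moreover have "g' \<bullet> f' \<in> Hom E X Z" "g \<bullet> f \<in> Hom E X Z" using g' f' f g by (simp_all add: in_Hom)
    ultimately show ?thesis using stab_eq by blast
  qed
  have "cmp \<A> (stab g) (stab f) = (\<Union>g' \<in> stab g. \<Union>f' \<in> stab f. stab (g' \<bullet> f'))"
    by (simp add: stable_category_def quotient_category_def)
  also have "\<dots> = (\<Union>g' \<in> stab g. \<Union>f' \<in> stab f. stab (g \<bullet> f))" by (intro SUP_cong refl) (rule *)
  also have "\<dots> = stab (g \<bullet> f)" using stab_self[OF f] stab_self[OF g] by auto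
  finally show ?thesis .
qed

lemma stable_plus:
  assumes f: "f \<in> Hom E X Y" and g: "g \<in> Hom E X Y" shows "aplus \<A> (stab f) (stab g) = stab (aplus E f g)"
proof -
  have *: "stab (aplus E f' g') = stab (aplus E f g)" if "f' \<in> stab f" "g' \<in> stab g" for g' f'
  proof -
    have g': "g' \<in> Hom E X Y" "aplus E g' (neg g) \<in> null_arrows X Y" using that mem_stab[OF g] by auto
    have f': "f' \<in> Hom E X Y" "aplus E f' (neg f) \<in> null_arrows X Y" using that mem_stab[OF f] by auto
    have "aplus E (aplus E f' (neg f)) (aplus E g' (neg g)) = aplus E (aplus E f' g') (neg (aplus E f g))"
      using g' f' f g plus_left_comm[of "neg f" g' "neg g"] by (simp add: in_Hom)
    then have "aplus E (aplus E f' g') (neg (aplus E f g)) \<in> null_arrows X Y" using null_plus[OF f'(2) g'(2)] by simp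
    moreover have "aplus E f' g' \<in> Hom E X Y" "aplus E f g \<in> Hom E X Y" using g' f' f g by (simp_all add: in_Hom)
    ultimately show ?thesis using stab_eq by blast
  qed
  have "aplus \<A> (stab f) (stab g) = (\<Union>f' \<in> stab f. \<Union>g' \<in> stab g. stab (aplus E f' g'))"
    by (simp add: stable_category_def quotient_category_def)
  also have "\<dots> = (\<Union>f' \<in> stab f. \<Union>g' \<in> stab g. stab (aplus E f g))" by (intro SUP_cong refl) (rule *)
  also have "\<dots> = stab (aplus E f g)" using stab_self[OF f] stab_self[OF g] by auto
  finally show ?thesis .
qed

end

section \<open>Module homomorphisms\<close>

text \<open>Closure under the operations, the part of the module axioms that inverting a bijective homomorphism
  uses.\<close>

definition module_closed :: "('a, 'r) ring_scheme \<Rightarrow> ('a, 'b, 'c) module_scheme \<Rightarrow> bool" where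
  "module_closed R M \<longleftrightarrow> (\<forall>x \<in> carrier M. \<forall>y \<in> carrier M. x \<oplus>\<^bsub>M\<^esub> y \<in> carrier M) \<and>
     (\<forall>a \<in> carrier R. \<forall>x \<in> carrier M. a \<odot>\<^bsub>M\<^esub> x \<in> carrier M)"

lemma fg_module: "M \<in> fg_modules R \<Longrightarrow> left_module R M"
  by (simp add: fg_modules_def)

lemma left_module_closed: "left_module R M \<Longrightarrow> module_closed R M"
  using abelian_monoid.a_closed abelian_group.axioms(1)
  by (fastforce simp: module_closed_def left_module_def left_module_axioms_def)

lemma module_homD:
  assumes "h \<in> module_hom R M N"
  shows "x \<in> carrier M \<Longrightarrow> h x \<in> carrier N"
    "x \<in> carrier M \<Longrightarrow> y \<in> carrier M \<Longrightarrow> h (x \<oplus>\<^bsub>M\<^esub> y) = h x \<oplus>\<^bsub>N\<^esub> h y"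
    "a \<in> carrier R \<Longrightarrow> x \<in> carrier M \<Longrightarrow> h (a \<odot>\<^bsub>M\<^esub> x) = a \<odot>\<^bsub>N\<^esub> h x"
  using assms by (auto simp: module_hom_def)

lemma module_hom_compose:
  assumes "f \<in> module_hom R L M" "g \<in> module_hom R M N" shows "g \<circ> f \<in> module_hom R L N"
  using assms by (auto simp: module_hom_def Pi_iff)

lemma module_hom_inverse:
  assumes f: "f \<in> module_hom R M N" and b: "bij_betw f (carrier M) (carrier N)" and M: "module_closed R M"
  shows "inv_into (carrier M) f \<in> module_hom R N M"
proof -
  let ?g = "inv_into (carrier M) f"
  have g: "?g y \<in> carrier M" "f (?g y) = y" if "y \<in> carrier N" for y
    using that b by (auto simp: bij_betw_def inv_into_into f_inv_into_f)
  have gf: "?g (f x) = x" if "x \<in> carrier M" for x using that b by (simp add: bij_betw_def)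
  show ?thesis
    unfolding module_hom_def
  proof (intro CollectI conjI ballI)
    show "?g \<in> carrier N \<rightarrow> carrier M" using g by auto
    show "?g (x \<oplus>\<^bsub>N\<^esub> y) = ?g x \<oplus>\<^bsub>M\<^esub> ?g y" if "x \<in> carrier N" "y \<in> carrier N" for x y
      using gf[of "?g x \<oplus>\<^bsub>M\<^esub> ?g y"] g[OF that(1)] g[OF that(2)] module_homD(2)[OF f] M
      by (simp add: module_closed_def)
    show "?g (a \<odot>\<^bsub>N\<^esub> x) = a \<odot>\<^bsub>M\<^esub> ?g x" if "a \<in> carrier R" "x \<in> carrier N" for a x
      using gf[of "a \<odot>\<^bsub>M\<^esub> ?g x"] g[OF that(2)] that(1) module_homD(3)[OF f] M
      by (simp add: module_closed_def)
  qed
qed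

lemma module_iso_sym:
  assumes "module_iso R M N" "module_closed R M" shows "module_iso R N M"
  using assms module_hom_inverse bij_betw_inv_into unfolding module_iso_def by metis

lemma module_iso_trans:
  assumes "module_iso R L M" "module_iso R M N" shows "module_iso R L N"
  using assms module_hom_compose bij_betw_trans unfolding module_iso_def by metis

lemma class_mod_iso:
  assumes "module_iso R M N" "module_closed R M" shows "class_mod R M = class_mod R N"
proof -
  have "iso_class (fg_modules R) (module_iso R) M = iso_class (fg_modules R) (module_iso R) N"
    using module_iso_trans[OF module_iso_sym[OF assms]] module_iso_trans[OF assms(1)]
    by (auto simp: iso_class_def)
  then show ?thesis by (simp add: class_mod_def K0_split_class_def)
qed

lemma module_iso_of_kernel_pair:
  assumes g: "g \<in> module_hom R L M" "g ` carrier L = carrier M"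
    and h: "h \<in> module_hom R L N" "h ` carrier L = carrier N"
    and eq: "\<And>v w. v \<in> carrier L \<Longrightarrow> w \<in> carrier L \<Longrightarrow> g v = g w \<longleftrightarrow> h v = h w"
    and L: "module_closed R L"
  shows "module_iso R M N"
proof -
  let ?s = "inv_into (carrier L) g"
  have s: "?s y \<in> carrier L" "g (?s y) = y" if "y \<in> carrier M" for y
    using that g(2) by (auto simp: inv_into_into f_inv_into_f)
  have hs: "h (?s (g v)) = h v" if "v \<in> carrier L" for v
    using eq[of "?s (g v)" v] s[of "g v"] module_homD(1)[OF g(1)] that by simp
  define k where "k = h \<circ> ?s"
  have "k \<in> module_hom R M N"
    unfolding module_hom_def k_def
  proof (intro CollectI conjI ballI)
    show "h \<circ> ?s \<in> carrier M \<rightarrow> carrier N" using s module_homD(1)[OF h(1)] by auto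
    show "(h \<circ> ?s) (x \<oplus>\<^bsub>M\<^esub> y) = (h \<circ> ?s) x \<oplus>\<^bsub>N\<^esub> (h \<circ> ?s) y" if "x \<in> carrier M" "y \<in> carrier M" for x y
      using hs[of "?s x \<oplus>\<^bsub>L\<^esub> ?s y"] s[OF that(1)] s[OF that(2)] module_homD(2)[OF g(1)]
        module_homD(2)[OF h(1)] L by (simp add: module_closed_def)
    show "(h \<circ> ?s) (a \<odot>\<^bsub>M\<^esub> x) = a \<odot>\<^bsub>N\<^esub> (h \<circ> ?s) x" if "a \<in> carrier R" "x \<in> carrier M" for a x
      using hs[of "a \<odot>\<^bsub>L\<^esub> ?s x"] s[OF that(2)] that(1) module_homD(3)[OF g(1)]
        module_homD(3)[OF h(1)] L by (simp add: module_closed_def)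
  qed
  moreover have "bij_betw k (carrier M) (carrier N)"
    unfolding bij_betw_def
  proof
    show "inj_on k (carrier M)"
      by (rule inj_onI) (metis comp_apply eq k_def s)
    have "k ` carrier M = k ` g ` carrier L" by (simp add: g(2))
    also have "\<dots> = h ` carrier L" using hs by (force simp: k_def image_image)
    finally show "k ` carrier M = carrier N" using h(2) by simp
  qed
  ultimately show ?thesis by (auto simp: module_iso_def)
qed

section \<open>The functor to modules\<close>

context cluster_tilting_category
begin

abbreviation \<R> where "\<R> \<equiv> stable_algebra E T"
abbreviation H where "H \<equiv> H_functor E T"

lemma H_simps:
  "carrier (H M) = stab ` Hom E T M" "carrier \<R> = stab ` Hom E T T"
  "f \<in> Hom E T M \<Longrightarrow> g \<in> Hom E T M \<Longrightarrow> stab f \<oplus>\<^bsub>H M\<^esub> stab g = stab (aplus E f g)"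
  "f \<in> Hom E T M \<Longrightarrow> c \<in> Hom E T T \<Longrightarrow> stab c \<odot>\<^bsub>H M\<^esub> stab f = stab (f \<bullet> c)"
  by (simp_all add: H_functor_def G_functor_def stable_Hom stable_plus stable_cmp
      stable_algebra_def opposite_ring_def endomorphism_ring_def)

lemma H_closed: "module_closed \<R> (H M)"
  unfolding module_closed_def
proof (intro conjI ballI)
  fix x y assume "x \<in> carrier (H M)" "y \<in> carrier (H M)"
  then obtain f g where "x = stab f" "y = stab g" "f \<in> Hom E T M" "g \<in> Hom E T M" by (auto simp: H_simps)
  moreover from this have "aplus E f g \<in> Hom E T M" by (simp add: in_Hom)
  ultimately show "x \<oplus>\<^bsub>H M\<^esub> y \<in> carrier (H M)" by (simp add: H_simps)
next
  fix a x assume "a \<in> carrier \<R>" "x \<in> carrier (H M)"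
  then obtain f g where "a = stab f" "x = stab g" "f \<in> Hom E T T" "g \<in> Hom E T M" by (auto simp: H_simps)
  moreover from this have "g \<bullet> f \<in> Hom E T M" by (simp add: in_Hom)
  ultimately show "a \<odot>\<^bsub>H M\<^esub> x \<in> carrier (H M)" by (simp add: H_simps)
qed

definition Hmap where "Hmap \<phi> = cmp \<A> (stab \<phi>)"

lemma Hmap: "\<phi> \<in> Hom E M N \<Longrightarrow> h \<in> Hom E T M \<Longrightarrow> Hmap \<phi> (stab h) = stab (\<phi> \<bullet> h)"
  by (simp add: Hmap_def stable_cmp)

lemma Hmap_hom:
  assumes "\<phi> \<in> Hom E M N" shows "Hmap \<phi> \<in> module_hom \<R> (H M) (H N)"
proof -
  have c: "\<phi> \<bullet> h \<in> Hom E T N" if "h \<in> Hom E T M" for h using that assms by (simp add: in_Hom)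
  show ?thesis
    unfolding module_hom_def
  proof (intro CollectI conjI ballI funcsetI)
    fix x assume "x \<in> carrier (H M)"
    then show "Hmap \<phi> x \<in> carrier (H N)" using Hmap[OF assms] c by (auto simp: H_simps)
  next
    fix x y assume "x \<in> carrier (H M)" "y \<in> carrier (H M)"
    then obtain f g where fg: "x = stab f" "y = stab g" "f \<in> Hom E T M" "g \<in> Hom E T M" by (auto simp: H_simps)
    then have "aplus E f g \<in> Hom E T M" by (simp add: in_Hom)
    moreover have "\<phi> \<bullet> aplus E f g = aplus E (\<phi> \<bullet> f) (\<phi> \<bullet> g)" using fg assms by (simp add: in_Hom)
    ultimately show "Hmap \<phi> (x \<oplus>\<^bsub>H M\<^esub> y) = Hmap \<phi> x \<oplus>\<^bsub>H N\<^esub> Hmap \<phi> y"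
      using fg Hmap[OF assms] c by (simp add: H_simps)
  next
    fix a x assume "a \<in> carrier \<R>" "x \<in> carrier (H M)"
    then obtain f g where fg: "a = stab f" "x = stab g" "f \<in> Hom E T T" "g \<in> Hom E T M" by (auto simp: H_simps)
    then have "g \<bullet> f \<in> Hom E T M" by (simp add: in_Hom)
    moreover have "\<phi> \<bullet> g \<bullet> f = (\<phi> \<bullet> g) \<bullet> f" using fg assms by (simp add: in_Hom)
    ultimately show "Hmap \<phi> (a \<odot>\<^bsub>H M\<^esub> x) = a \<odot>\<^bsub>H N\<^esub> Hmap \<phi> x"
      using fg Hmap[OF assms] c by (simp add: H_simps)
  qed
qed

lemma hom_zero:
  assumes \<psi>: "\<psi> \<in> module_hom \<R> (H M) (H N)" and M: "M \<in> objs E" and N: "N \<in> objs E"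
  shows "\<psi> (stab (zarr E T M)) = stab (zarr E T N)"
proof -
  have z: "zarr E T M \<in> Hom E T M" "zarr E T T \<in> Hom E T T" using M T_obj by (simp_all add: in_Hom)
  have m: "stab (zarr E T M) \<in> carrier (H M)" using z by (auto simp: H_simps)
  obtain u where u: "u \<in> Hom E T N" "\<psi> (stab (zarr E T M)) = stab u"
    using module_homD(1)[OF \<psi> m] by (auto simp: H_simps)
  have "stab (zarr E T M) = stab (zarr E T T) \<odot>\<^bsub>H M\<^esub> stab (zarr E T M)"
    using H_simps(4)[OF z] M T_obj by simp
  then have "\<psi> (stab (zarr E T M)) = stab (zarr E T T) \<odot>\<^bsub>H N\<^esub> stab u"
    using module_homD(3)[OF \<psi> _ m, of "stab (zarr E T T)"] z(2) u(2) by (simp add: H_simps)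
  also have "\<dots> = stab (zarr E T N)" using H_simps(4)[OF u(1) z(2)] u(1) T_obj by (simp add: in_Hom)
  finally show ?thesis .
qed

text \<open>The Yoneda lemma: on arrows \<open>u v h\<close> through \<open>T\<close> the homomorphism is determined by its value at \<open>u\<close>,
  and these arrows generate by the description of the identity of \<open>S\<close>.\<close>

lemma hom_from_T:
  assumes S: "S \<in> \<T>" and N: "N \<in> objs E" and \<psi>: "\<psi> \<in> module_hom \<R> (H S) (H N)"
  obtains b where "b \<in> Hom E S N" "\<And>h. h \<in> Hom E T S \<Longrightarrow> \<psi> (stab h) = stab (b \<bullet> h)"
proof -
  have So: "S \<in> objs E" using T_objs[OF S] .
  have "\<exists>b \<in> Hom E S N. \<forall>h \<in> Hom E T S. \<psi> (stab (ident E S \<bullet> h)) = stab (b \<bullet> h)"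
  proof (rule add_closure_induct[OF S])
    fix u v assume u: "u \<in> Hom E T S" and v: "v \<in> Hom E S T"
    have m: "stab u \<in> carrier (H S)" using u by (auto simp: H_simps)
    obtain u' where u': "u' \<in> Hom E T N" "\<psi> (stab u) = stab u'"
      using module_homD(1)[OF \<psi> m] by (auto simp: H_simps)
    have "\<psi> (stab ((u \<bullet> v) \<bullet> h)) = stab ((u' \<bullet> v) \<bullet> h)" if h: "h \<in> Hom E T S" for h
    proof -
      have vh: "v \<bullet> h \<in> Hom E T T" using v h by (simp add: in_Hom)
      have "\<psi> (stab ((u \<bullet> v) \<bullet> h)) = \<psi> (stab (v \<bullet> h) \<odot>\<^bsub>H S\<^esub> stab u)"
        using H_simps(4)[OF u vh] u v h by (simp add: in_Hom)
      also have "\<dots> = stab (v \<bullet> h) \<odot>\<^bsub>H N\<^esub> stab u'"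
        using module_homD(3)[OF \<psi> _ m, of "stab (v \<bullet> h)"] vh u'(2) by (simp add: H_simps)
      also have "\<dots> = stab ((u' \<bullet> v) \<bullet> h)" using H_simps(4)[OF u'(1) vh] u' v h by (simp add: in_Hom)
      finally show ?thesis .
    qed
    moreover have "u' \<bullet> v \<in> Hom E S N" using u' v by (simp add: in_Hom)
    ultimately show "\<exists>b \<in> Hom E S N. \<forall>h \<in> Hom E T S. \<psi> (stab ((u \<bullet> v) \<bullet> h)) = stab (b \<bullet> h)" by blast
  next
    have "\<psi> (stab (zarr E S S \<bullet> h)) = stab (zarr E S N \<bullet> h)" if "h \<in> Hom E T S" for h
      using that hom_zero[OF \<psi> So N] So N by (simp add: in_Hom)
    moreover have "zarr E S N \<in> Hom E S N" using So N by (simp add: in_Hom)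
    ultimately show "\<exists>b \<in> Hom E S N. \<forall>h \<in> Hom E T S. \<psi> (stab (zarr E S S \<bullet> h)) = stab (b \<bullet> h)" by blast
  next
    fix f g assume f: "f \<in> Hom E S S" and g: "g \<in> Hom E S S"
      and "\<exists>b \<in> Hom E S N. \<forall>h \<in> Hom E T S. \<psi> (stab (f \<bullet> h)) = stab (b \<bullet> h)"
      and "\<exists>b \<in> Hom E S N. \<forall>h \<in> Hom E T S. \<psi> (stab (g \<bullet> h)) = stab (b \<bullet> h)"
    then obtain a b where a: "a \<in> Hom E S N" "\<And>h. h \<in> Hom E T S \<Longrightarrow> \<psi> (stab (f \<bullet> h)) = stab (a \<bullet> h)"
      and b: "b \<in> Hom E S N" "\<And>h. h \<in> Hom E T S \<Longrightarrow> \<psi> (stab (g \<bullet> h)) = stab (b \<bullet> h)" by blast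
    have "\<psi> (stab (aplus E f g \<bullet> h)) = stab (aplus E a b \<bullet> h)" if h: "h \<in> Hom E T S" for h
    proof -
      have fh: "f \<bullet> h \<in> Hom E T S" "g \<bullet> h \<in> Hom E T S" "a \<bullet> h \<in> Hom E T N" "b \<bullet> h \<in> Hom E T N"
        using f g a b h by (simp_all add: in_Hom)
      have "\<psi> (stab (aplus E f g \<bullet> h)) = \<psi> (stab (f \<bullet> h) \<oplus>\<^bsub>H S\<^esub> stab (g \<bullet> h))"
        using H_simps(3)[OF fh(1,2)] f g h by (simp add: in_Hom)
      also have "\<dots> = stab (a \<bullet> h) \<oplus>\<^bsub>H N\<^esub> stab (b \<bullet> h)"
        using module_homD(2)[OF \<psi>, of "stab (f \<bullet> h)" "stab (g \<bullet> h)"] fh a(2)[OF h] b(2)[OF h] by (simp add: H_simps)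
      also have "\<dots> = stab (aplus E a b \<bullet> h)" using H_simps(3)[OF fh(3,4)] a b h by (simp add: in_Hom)
      finally show ?thesis .
    qed
    moreover have "aplus E a b \<in> Hom E S N" using a b by (simp add: in_Hom)
    ultimately show "\<exists>b \<in> Hom E S N. \<forall>h \<in> Hom E T S. \<psi> (stab (aplus E f g \<bullet> h)) = stab (b \<bullet> h)" by blast
  qed
  then obtain b where "b \<in> Hom E S N" "\<And>h. h \<in> Hom E T S \<Longrightarrow> \<psi> (stab (ident E S \<bullet> h)) = stab (b \<bullet> h)" by blast
  moreover have "ident E S \<bullet> h = h" if "h \<in> Hom E T S" for h using that by (simp add: in_Hom)
  ultimately show ?thesis using that by simp
qed

lemma null_from_T:
  assumes S: "S \<in> \<T>" and b: "b \<in> Hom E S N" and h: "\<And>h. h \<in> Hom E T S \<Longrightarrow> b \<bullet> h \<in> null_arrows T N"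
  shows "b \<in> null_arrows S N"
proof -
  have o: "S \<in> objs E" "N \<in> objs E" using Hom_obj[OF b] by auto
  have "b \<bullet> ident E S \<in> null_arrows S N"
  proof (rule add_closure_induct[OF S])
    show "b \<bullet> u \<bullet> v \<in> null_arrows S N" if "u \<in> Hom E T S" "v \<in> Hom E S T" for u v
      using null_right[OF h[OF that(1)] that(2)] that b by (simp add: in_Hom)
    show "b \<bullet> zarr E S S \<in> null_arrows S N" using null_zero[OF o] o b by (simp add: in_Hom)
    show "b \<bullet> aplus E f g \<in> null_arrows S N"
      if "f \<in> Hom E S S" "g \<in> Hom E S S" "b \<bullet> f \<in> null_arrows S N" "b \<bullet> g \<in> null_arrows S N" for f g
      using null_plus[OF that(3,4)] that(1,2) b by (simp add: in_Hom)
  qed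
  then show ?thesis using b by (simp add: in_Hom)
qed

lemma stably_monic_from_T:
  assumes x: "x \<in> Hom E X Y" and m: "\<And>h. h \<in> Hom E T X \<Longrightarrow> x \<bullet> h \<in> null_arrows T Y \<Longrightarrow> h \<in> null_arrows T X"
    and S: "S \<in> \<T>" and h: "h \<in> Hom E S X" "x \<bullet> h \<in> null_arrows S Y"
  shows "h \<in> null_arrows S X"
proof (rule null_from_T[OF S h(1)])
  fix k assume k: "k \<in> Hom E T S"
  have "x \<bullet> h \<bullet> k \<in> null_arrows T Y" using null_right[OF h(2) k] x h(1) k by (simp add: in_Hom)
  moreover have "h \<bullet> k \<in> Hom E T X" using h(1) k by (simp add: in_Hom)
  ultimately show "h \<bullet> k \<in> null_arrows T X" using m by blast
qed

end

section \<open>Realizing short exact sequences of modules by triangles\<close>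

context cluster_tilting_category
begin

lemma wic_inflation:
  assumes f: "f \<in> Hom E X Y" and g: "g \<in> Hom E Y Z" and t: "tri X (g \<bullet> f) Z b W d"
  obtains c C d' where "tri X f Y c C d'"
proof -
  have "inflation E (g \<bullet> f)" using t unfolding inflation_def by blast
  then have "inflation E f" using wic f g unfolding WIC_def in_Hom by metis
  then obtain X' Y' c C d' where t': "tri X' f Y' c C d'" unfolding inflation_def by blast
  then have "X' = X" "Y' = Y" using triD(4)[OF t'] f by (auto simp: in_Hom)
  then show ?thesis using that t' by simp
qed

lemma rigid:
  assumes "n \<ge> 2" "S \<in> \<T>" "S' \<in> \<T>" shows "ext_vanish S S'"
proof -
  have "\<forall>S \<in> \<T>. \<forall>i < n - 1. ext_vanish ((syzygy ^^ i) S) S'" using iffD1[OF T_right assms(3)] by blast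
  then have "ext_vanish ((syzygy ^^ 0) S) S'" using assms(1,2) by (metis Suc_1 diff_Suc_1 not_less_eq_eq le_0_eq neq0_conv less_le_trans zero_less_diff Suc_le_lessD)
  then show ?thesis by simp
qed

lemma inflation_into_injective:
  assumes "X \<in> objs E"
  obtains e I c U d where "I \<in> projectives E" "tri X e I c U d"
  using enough_injectives[OF assms] projectives_eq_injectives by metis

text \<open>
  Let \<open>T0 \<rightarrow> X0\<close> be an approximation and \<open>T1\<close> an approximation of its kernel.  Adding an injective object
  to \<open>T0\<close> makes \<open>T1 \<rightarrow> T0\<close> an inflation, and its cone \<open>X\<close> represents the same module as \<open>X0\<close>: both
  are the cokernel of \<open>H(T1) \<rightarrow> H(T0)\<close>.
\<close>

lemma presentation:
  assumes n: "n \<ge> 2" and X0: "X0 \<in> objs E"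
  obtains X T1 t T0 \<pi> \<delta> \<theta> where "tri T1 t T0 \<pi> X \<delta>" "T1 \<in> \<T>" "T0 \<in> \<T>" "\<theta> \<in> Hom E X X0"
    "\<And>h. h \<in> Hom E T X \<Longrightarrow> \<theta> \<bullet> h \<in> null_arrows T X0 \<Longrightarrow> h \<in> null_arrows T X"
    "\<And>k. k \<in> Hom E T X0 \<Longrightarrow> \<exists>h \<in> Hom E T X. \<theta> \<bullet> h = k"
proof -
  obtain K0 \<kappa> T0 a dX where t0: "tri K0 \<kappa> T0 a X0 dX" and T0: "T0 \<in> \<T>" and "right_approx E \<T> a"
    using ex_minimal_approx[OF X0] by metis
  then have a: "epic a" by (simp add: epic_of_approx)
  note D0 = triD[OF t0]
  obtain K1 \<kappa>1 T1 a1 d1 where t1: "tri K1 \<kappa>1 T1 a1 K0 d1" and T1: "T1 \<in> \<T>" and "right_approx E \<T> a1"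
    using ex_minimal_approx[OF D0(1)] by metis
  then have a1: "epic a1" by (simp add: epic_of_approx)
  note D1 = triD[OF t1]
  define \<tau> where "\<tau> = \<kappa> \<bullet> a1"
  have \<tau>: "\<tau> \<in> Hom E T1 T0" using D0 D1 by (simp add: \<tau>_def in_Hom)
  have a\<tau>: "a \<bullet> \<tau> = zarr E T1 X0"
    using cmp_zero_middle[OF tri_cmp_zero[OF t0] D0(4,5), of a1] D1 by (simp add: \<tau>_def in_Hom)
  obtain e I c U dU where I: "I \<in> projectives E" and tU: "tri T1 e I c U dU"
    using inflation_into_injective[OF D1(2)] .
  note DU = triD[OF tU]
  obtain W i1 i2 p1 p2 where b: "biproduct E T0 I W i1 i2 p1 p2"
    using biproducts[OF D0(2) DU(2)] unfolding is_dsum_def by blast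
  note B = biproductD[OF b]
  have W: "W \<in> \<T>" using T_dsum[OF T0 projective_in_T[OF I]] b unfolding is_dsum_def by blast
  define t where "t = aplus E (i1 \<bullet> \<tau>) (i2 \<bullet> e)"
  have t: "t \<in> Hom E T1 W" using B \<tau> DU by (simp add: t_def in_Hom)
  have p2t: "p2 \<bullet> t = e"
    using B(1-11) \<tau> DU cmp_zero_middle[OF B(10,4,7), of \<tau>] cmp_cancel_middle[OF B(9,5,7), of e]
    by (simp add: t_def in_Hom)
  have p1t: "p1 \<bullet> t = \<tau>"
    using B(1-11) \<tau> DU cmp_zero_middle[OF B(11,5,6), of e] cmp_cancel_middle[OF B(8,4,6), of \<tau>]
    by (simp add: t_def in_Hom)
  have "tri T1 (p2 \<bullet> t) I c U dU" using tU p2t by simp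
  from wic_inflation[OF t B(7) this]
  obtain \<pi> X \<delta> where tX: "tri T1 t W \<pi> X \<delta>" .
  note DX = triD[OF tX]
  have \<pi>: "epic \<pi>" using epic_of_vanish[OF tX] rigid[OF n _ T1] by blast
  have ap: "a \<bullet> p1 \<in> Hom E W X0" using D0 B by (simp add: in_Hom)
  have "(a \<bullet> p1) \<bullet> t = a \<bullet> p1 \<bullet> t" using D0(5) B(6) t by (simp add: in_Hom)
  also have "\<dots> = zarr E T1 X0" unfolding p1t by (rule a\<tau>)
  finally have apt: "(a \<bullet> p1) \<bullet> t = zarr E T1 X0" .
  obtain \<theta> where \<theta>: "\<theta> \<in> Hom E X X0" "\<theta> \<bullet> \<pi> = a \<bullet> p1" using extend_to_cokernel[OF tX ap apt] .
  have \<theta>\<pi>: "\<theta> \<bullet> \<pi> \<bullet> k = a \<bullet> p1 \<bullet> k" if "k \<in> Hom E T W" for k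
    using cmp_eq_middle[OF \<theta>(2) DX(5) \<theta>(1) B(6) D0(5), of k] that by (simp add: in_Hom)
  have surj: "\<exists>h \<in> Hom E T X. \<theta> \<bullet> h = k" if k: "k \<in> Hom E T X0" for k
  proof -
    obtain k0 where k0: "k0 \<in> Hom E T T0" "a \<bullet> k0 = k" using epicE[OF a D0(5) T_in_T k] .
    have ik: "i1 \<bullet> k0 \<in> Hom E T W" using B k0 by (simp add: in_Hom)
    have "\<theta> \<bullet> \<pi> \<bullet> i1 \<bullet> k0 = k"
      using \<theta>\<pi>[OF ik] cmp_cancel_middle[OF B(8,4,6), of k0] k0 by (simp add: in_Hom)
    moreover have "\<pi> \<bullet> i1 \<bullet> k0 \<in> Hom E T X" using ik DX by (simp add: in_Hom)
    ultimately show ?thesis by blast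
  qed
  have inj: "h \<in> null_arrows T X" if h: "h \<in> Hom E T X" "\<theta> \<bullet> h \<in> null_arrows T X0" for h
  proof -
    obtain k where k: "k \<in> Hom E T W" "\<pi> \<bullet> k = h" using epicE[OF \<pi> DX(5) T_in_T h(1)] .
    have "a \<bullet> p1 \<bullet> k \<in> null_arrows T X0" using h(2) \<theta>\<pi>[OF k(1)] k(2) by simp
    then obtain z where z: "z \<in> null_arrows T T0" "a \<bullet> z = a \<bullet> p1 \<bullet> k" using null_lift[OF t0] by metis
    note z' = null_Hom[OF z(1)]
    have pk: "p1 \<bullet> k \<in> Hom E T T0" "p2 \<bullet> k \<in> Hom E T I" using B k by (simp_all add: in_Hom)
    have "aplus E (p1 \<bullet> k) (neg z) \<in> Hom E T T0" using pk z' by (simp add: in_Hom)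
    moreover have "a \<bullet> aplus E (p1 \<bullet> k) (neg z) = zarr E T X0"
      using pk z' D0(5) z(2) by (simp add: in_Hom)
    ultimately obtain y where y: "y \<in> Hom E T K0" "\<kappa> \<bullet> y = aplus E (p1 \<bullet> k) (neg z)"
      using lift_to_kernel[OF t0] by metis
    obtain y1 where y1: "y1 \<in> Hom E T T1" "a1 \<bullet> y1 = y" using epicE[OF a1 D1(5) T_in_T y(1)] .
    have \<tau>y: "\<tau> \<bullet> y1 = aplus E (p1 \<bullet> k) (neg z)"
      using y y1 D0(4) D1(5) by (simp add: \<tau>_def in_Hom)
    have ty: "\<pi> \<bullet> t \<bullet> y1 = zarr E T X"
      using cmp_zero_middle[OF tri_cmp_zero[OF tX] DX(4,5), of y1] y1 by (simp add: in_Hom)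
    \<comment> \<open>\<open>k - t y1\<close> has the null component \<open>z\<close> in \<open>T0\<close>, and its other component lies in \<open>I\<close>\<close>
    have "t \<bullet> y1 = aplus E (i1 \<bullet> \<tau> \<bullet> y1) (i2 \<bullet> e \<bullet> y1)"
      using B(4,5) \<tau> DU y1(1) by (simp add: t_def in_Hom)
    then have ty': "t \<bullet> y1 = aplus E (i1 \<bullet> p1 \<bullet> k) (aplus E (neg (i1 \<bullet> z)) (i2 \<bullet> e \<bullet> y1))"
      unfolding \<tau>y using B(4,5) pk z' DU y1(1) by (simp add: in_Hom)
    define r where "r = aplus E (i1 \<bullet> z) (i2 \<bullet> aplus E (p2 \<bullet> k) (neg (e \<bullet> y1)))"
    have r: "r \<in> Hom E T W" using B pk z' DU y1(1) by (simp add: r_def in_Hom)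
    have "k = aplus E (i1 \<bullet> p1) (i2 \<bullet> p2) \<bullet> k" unfolding B(12) using k by (simp add: in_Hom)
    also have "\<dots> = aplus E (i1 \<bullet> p1 \<bullet> k) (i2 \<bullet> p2 \<bullet> k)" using B(4-7) k by (simp add: in_Hom)
    also have "\<dots> = aplus E (t \<bullet> y1) r"
      unfolding ty' r_def using B(4,5) pk z' DU y1(1)
      by (simp add: in_Hom plus_left_comm[of "i2 \<bullet> e \<bullet> y1" "i1 \<bullet> z"] plus_left_comm[of "i2 \<bullet> e \<bullet> y1" "i2 \<bullet> p2 \<bullet> k"])
    finally have "k = aplus E (t \<bullet> y1) r" .
    then have "h = \<pi> \<bullet> aplus E (t \<bullet> y1) r" using k(2) by simp
    also have "\<dots> = \<pi> \<bullet> r" using DX y1(1) r ty T_obj by (simp add: in_Hom)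
    finally have h': "h = \<pi> \<bullet> r" .
    have "aplus E (p2 \<bullet> k) (neg (e \<bullet> y1)) \<in> Hom E T I" using pk DU y1(1) by (simp add: in_Hom)
    then have "r \<in> null_arrows T W" unfolding r_def using null_plus null_left[OF z(1) B(4)] nullI[OF I _ B(5)] by blast
    then show ?thesis unfolding h' using null_left DX(5) by blast
  qed
  show ?thesis using that[OF tX T1 W \<theta>(1) inj surj] .
qed

text \<open>\<open>H\<close> is full on the cones \<open>X\<close> of arrows in \<open>\<T>\<close>: lift to \<open>T0\<close> by Yoneda; on \<open>T1\<close> the
  lift is null, and as null arrows extend along inflations it can be corrected to vanish there.\<close>

lemma full_on_presented:
  assumes t: "tri T1 t T0 \<pi> X \<delta>" and T1: "T1 \<in> \<T>" and T0: "T0 \<in> \<T>" and \<pi>: "epic \<pi>"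
    and N: "N \<in> objs E" and \<psi>: "\<psi> \<in> module_hom \<R> (H X) (H N)"
  obtains \<phi> where "\<phi> \<in> Hom E X N" "\<And>h. h \<in> Hom E T X \<Longrightarrow> \<psi> (stab h) = stab (\<phi> \<bullet> h)"
proof -
  note D = triD[OF t]
  obtain b where b: "b \<in> Hom E T0 N" and "\<And>k. k \<in> Hom E T T0 \<Longrightarrow> (\<psi> \<circ> Hmap \<pi>) (stab k) = stab (b \<bullet> k)"
    using hom_from_T[OF T0 N module_hom_compose[OF Hmap_hom[OF D(5)] \<psi>]] by blast
  then have b': "\<psi> (stab (\<pi> \<bullet> k)) = stab (b \<bullet> k)" if "k \<in> Hom E T T0" for k using Hmap[OF D(5)] that by simp
  have "b \<bullet> t \<in> null_arrows T1 N"
  proof (rule null_from_T[OF T1])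
    show "b \<bullet> t \<in> Hom E T1 N" using b D by (simp add: in_Hom)
    fix h assume h: "h \<in> Hom E T T1"
    have th: "t \<bullet> h \<in> Hom E T T0" using h D by (simp add: in_Hom)
    have "\<pi> \<bullet> t \<bullet> h = zarr E T X"
      using cmp_zero_middle[OF tri_cmp_zero[OF t] D(4,5), of h] h by (simp add: in_Hom)
    then have "stab (b \<bullet> t \<bullet> h) = stab (zarr E T N)" using b'[OF th] hom_zero[OF \<psi> D(3) N] by simp
    moreover have "b \<bullet> t \<bullet> h \<in> Hom E T N" using th b by (simp add: in_Hom)
    ultimately have "b \<bullet> t \<bullet> h \<in> null_arrows T N" using stab_eq_zero by blast
    then show "(b \<bullet> t) \<bullet> h \<in> null_arrows T N" using h b D by (simp add: in_Hom)
  qed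
  then obtain P d c where P: "P \<in> projectives E" "d \<in> Hom E T1 P" "c \<in> Hom E P N" "b \<bullet> t = c \<bullet> d" by (rule nullE)
  obtain d' where d': "d' \<in> Hom E T0 P" "d' \<bullet> t = d" using injective_extend[OF t P(1,2)] .
  define b2 where "b2 = aplus E b (neg (c \<bullet> d'))"
  have b2: "b2 \<in> Hom E T0 N" using b P d' by (simp add: b2_def in_Hom)
  have "b2 \<bullet> t = zarr E T1 N"
    using b P(2-4) d' D N by (simp add: b2_def in_Hom)
  then obtain \<phi> where \<phi>: "\<phi> \<in> Hom E X N" "\<phi> \<bullet> \<pi> = b2" using extend_to_cokernel[OF t b2] by metis
  have "\<psi> (stab h) = stab (\<phi> \<bullet> h)" if h: "h \<in> Hom E T X" for h
  proof -
    obtain k where k: "k \<in> Hom E T T0" "\<pi> \<bullet> k = h" using epicE[OF \<pi> D(5) T_in_T h] .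
    have "\<phi> \<bullet> h = b2 \<bullet> k" using cmp_reduce[OF \<phi>(2) D(5) \<phi>(1), of k] k by (simp add: in_Hom)
    then have e: "\<phi> \<bullet> h = aplus E (b \<bullet> k) (neg (c \<bullet> d' \<bullet> k))" using b P(3) d'(1) k(1) by (simp add: b2_def in_Hom)
    have bk: "b \<bullet> k \<in> Hom E T N" "c \<bullet> d' \<bullet> k \<in> Hom E T N" "d' \<bullet> k \<in> Hom E T P"
      using b P(3) d'(1) k(1) by (simp_all add: in_Hom)
    have "c \<bullet> d' \<bullet> k \<in> null_arrows T N" using nullI[OF P(1) bk(3) P(3)] .
    moreover have "aplus E (b \<bullet> k) (neg (\<phi> \<bullet> h)) = c \<bullet> d' \<bullet> k" unfolding e using bk by (simp add: in_Hom)
    moreover have "\<phi> \<bullet> h \<in> Hom E T N" unfolding e using bk by (simp add: in_Hom)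
    ultimately have "stab (b \<bullet> k) = stab (\<phi> \<bullet> h)" using stab_eq[OF bk(1)] by simp
    then show ?thesis using b'[OF k(1)] k(2) by simp
  qed
  then show ?thesis using that \<phi>(1) by blast
qed

text \<open>
  Let \<open>U\<close> be the suspension of \<open>T1\<close>.  The connecting arrow \<open>w : X \<rightarrow> U\<close> of \<open>T1 \<rightarrow> T0 \<rightarrow> X\<close> is a left
  approximation of \<open>X\<close> by such suspensions, which \<open>H\<close> does not see.  Adding it to \<open>\<phi>\<close> does not change the
  induced homomorphism, and makes the cokernel of the resulting inflation \<open>\<mu>\<close> compatible
  with \<open>H\<close>: an extension of \<open>S\<close> by \<open>X\<close> killed by \<open>w\<close> comes from \<open>T0\<close>, hence is zero.
\<close>

lemma exact_triangle:
  assumes n: "n \<ge> 2" and t: "tri T1 t T0 \<pi> X \<delta>" and T1: "T1 \<in> \<T>" and T0: "T0 \<in> \<T>"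
    and \<phi>: "\<phi> \<in> Hom E X L" and mono: "\<And>h. h \<in> Hom E T X \<Longrightarrow> \<phi> \<bullet> h \<in> null_arrows T L \<Longrightarrow> h \<in> null_arrows T X"
  obtains Y \<mu> \<nu> M \<rho> d where "tri X \<mu> Y \<nu> M d" "epic \<nu>" "\<rho> \<in> Hom E Y L" "\<rho> \<bullet> \<mu> = \<phi>"
    "\<And>h. h \<in> Hom E T X \<Longrightarrow> \<mu> \<bullet> h \<in> null_arrows T Y \<Longrightarrow> h \<in> null_arrows T X"
    "\<And>h. h \<in> Hom E T Y \<Longrightarrow> \<rho> \<bullet> h \<in> null_arrows T L \<Longrightarrow> h \<in> null_arrows T Y"
    "\<And>k. k \<in> Hom E T L \<Longrightarrow> \<exists>h \<in> Hom E T Y. \<rho> \<bullet> h = k"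
proof -
  note D = triD[OF t]
  have Lo: "L \<in> objs E" using Hom_obj[OF \<phi>] by simp
  obtain e I c U dU where I: "I \<in> projectives E" and tU: "tri T1 e I c U dU"
    using inflation_into_injective[OF D(1)] .
  note DU = triD[OF tU]
  obtain q where q: "q \<in> Hom E T0 I" "q \<bullet> t = e" using injective_extend[OF t I DU(4)] .
  have "ident E T1 \<in> Hom E T1 T1" "q \<bullet> t = e \<bullet> ident E T1" using D DU q by (simp_all add: in_Hom)
  then obtain w where w: "w \<in> Hom E X U" "push E (ident E T1) \<delta> = pull E w dU" "w \<bullet> \<pi> = c \<bullet> q"
    using ET3[OF t tU _ q(1)] by blast
  have w\<delta>: "pull E w dU = \<delta>" using w(2) push_ident[OF D(3,1,6)] by simp
  obtain j J c' U' dJ where J: "J \<in> projectives E" and tJ: "tri X j J c' U' dJ"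
    using inflation_into_injective[OF D(3)] .
  note DJ = triD[OF tJ]
  obtain V i1 i2 p1 p2 where b1: "biproduct E L U V i1 i2 p1 p2"
    using biproducts[OF Lo DU(3)] unfolding is_dsum_def by blast
  note B1 = biproductD[OF b1]
  obtain Y i3 i4 p3 p4 where b2: "biproduct E V J Y i3 i4 p3 p4"
    using biproducts[OF B1(3) DJ(2)] unfolding is_dsum_def by blast
  note B2 = biproductD[OF b2]
  define v where "v = aplus E (i1 \<bullet> \<phi>) (i2 \<bullet> w)"
  have v: "v \<in> Hom E X V" using B1 \<phi> w by (simp add: v_def in_Hom)
  define \<mu> where "\<mu> = aplus E (i3 \<bullet> v) (i4 \<bullet> j)"
  have \<mu>: "\<mu> \<in> Hom E X Y" using B2 v DJ by (simp add: \<mu>_def in_Hom)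
  have p3\<mu>: "p3 \<bullet> \<mu> = v" and p4\<mu>: "p4 \<bullet> \<mu> = j"
    using B2(1-11) v DJ cmp_zero_middle[OF B2(10,4,7), of v] cmp_zero_middle[OF B2(11,5,6), of j]
      cmp_cancel_middle[OF B2(8,4,6), of v] cmp_cancel_middle[OF B2(9,5,7), of j]
    by (simp_all add: \<mu>_def in_Hom)
  have p1v: "p1 \<bullet> v = \<phi>" and p2v: "p2 \<bullet> v = w"
    using B1(1-11) \<phi> w(1) cmp_zero_middle[OF B1(10,4,7), of \<phi>] cmp_zero_middle[OF B1(11,5,6), of w]
      cmp_cancel_middle[OF B1(8,4,6), of \<phi>] cmp_cancel_middle[OF B1(9,5,7), of w]
    by (simp_all add: v_def in_Hom)
  define \<rho> where "\<rho> = p1 \<bullet> p3"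
  have \<rho>: "\<rho> \<in> Hom E Y L" using B1 B2 by (simp add: \<rho>_def in_Hom)
  have \<rho>\<mu>: "\<rho> \<bullet> \<mu> = \<phi>" using B1(6) B2(6) \<mu> p3\<mu> p1v by (simp add: \<rho>_def in_Hom)
  have \<omega>: "p2 \<bullet> p3 \<in> Hom E Y U" "(p2 \<bullet> p3) \<bullet> \<mu> = w" using B1(7) B2(6) \<mu> p3\<mu> p2v by (simp_all add: in_Hom)
  have "tri X (p4 \<bullet> \<mu>) J c' U' dJ" using tJ p4\<mu> by simp
  from wic_inflation[OF \<mu> B2(7) this]
  obtain \<nu> M d where tM: "tri X \<mu> Y \<nu> M d" .
  note DM = triD[OF tM]
  have ep: "epic \<nu>"
  proof (rule epicI[OF DM(5)])
    fix S h assume S: "S \<in> \<T>" and h: "h \<in> Hom E S M"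
    have So: "S \<in> objs E" using T_objs[OF S] .
    define \<zeta> where "\<zeta> = pull E h d"
    have \<zeta>: "\<zeta> \<in> Ext E S X" using pull_closed[OF h DM(1,6)] by (simp add: \<zeta>_def)
    have "push E w d = ezero E M U" using extend_iff[OF tM w(1)] \<omega> by blast
    then have w\<zeta>: "push E w \<zeta> = ezero E S U"
      using push_pull[OF w(1) h DM(6)] pull_ezero[OF h DU(3)] by (simp add: \<zeta>_def)
    obtain a P p dS where P: "P \<in> projectives E" and tS: "tri (syzygy S) a P p S dS" using syzygy_tri[OF So] .
    note DS = triD[OF tS]
    have "pull E p \<zeta> = ezero E P X"
      using pull_closed[OF DS(5) DM(1) \<zeta>] projectiveD(2)[OF P DM(1)] by (simp add: ext_vanish_def)
    then obtain y where y: "y \<in> Hom E (syzygy S) X" "push E y dS = \<zeta>" using ext_from_pull[OF tS \<zeta> DM(1)] by metis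
    have wy: "w \<bullet> y \<in> Hom E (syzygy S) U" using w y by (simp add: in_Hom)
    have "push E (w \<bullet> y) dS = ezero E S U" using push_cmp[OF y(1) w(1) So DS(6)] y(2) w\<zeta> by simp
    then obtain z where z: "z \<in> Hom E P U" "z \<bullet> a = w \<bullet> y" using extend_iff[OF tS wy] by auto
    obtain z' where z': "z' \<in> Hom E P I" "c \<bullet> z' = z" using projective_lift[OF tU P z(1)] .
    have "c \<bullet> z' \<bullet> a = w \<bullet> y" using cmp_reduce[OF z'(2,1) DU(5), of a] DS z(2) by (simp add: in_Hom)
    moreover have "z' \<bullet> a \<in> Hom E (syzygy S) I" using z' DS by (simp add: in_Hom)
    ultimately have "pull E (w \<bullet> y) dU = ezero E (syzygy S) T1" using lift_iff[OF tU wy] by blast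
    then have "pull E y \<delta> = ezero E (syzygy S) T1" using pull_cmp[OF w(1) y(1) DU(1,6)] w\<delta> by simp
    then obtain y' where y': "y' \<in> Hom E (syzygy S) T0" "\<pi> \<bullet> y' = y" using lift_iff[OF t y(1)] by auto
    have "push E y' dS = ezero E S T0"
      using push_closed[OF y'(1) So DS(6)] rigid[OF n S T0] by (simp add: ext_vanish_def)
    then have "\<zeta> = ezero E S X"
      using push_cmp[OF y'(1) D(5) So DS(6)] y'(2) y(2) push_ezero[OF D(5) So] by simp
    then show "\<exists>k \<in> Hom E S Y. \<nu> \<bullet> k = h" using lift_iff[OF tM h] by (simp add: \<zeta>_def)
  qed
  have mono': "h \<in> null_arrows T X" if h: "h \<in> Hom E T X" "\<mu> \<bullet> h \<in> null_arrows T Y" for h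
  proof (rule mono[OF h(1)])
    have "\<rho> \<bullet> \<mu> \<bullet> h = \<phi> \<bullet> h" using cmp_reduce[OF \<rho>\<mu> \<mu> \<rho>, of h] h(1) by (simp add: in_Hom)
    then show "\<phi> \<bullet> h \<in> null_arrows T L" using null_left[OF h(2) \<rho>] by simp
  qed
  have Unul: "k \<in> null_arrows T U" if k: "k \<in> Hom E T U" for k
  proof -
    obtain k' where "k' \<in> Hom E T I" "c \<bullet> k' = k" using lift_of_vanish[OF tU rigid[OF n T_in_T T1] k] .
    then show ?thesis using nullI[OF I _ DU(5)] by blast
  qed
  have inj: "h \<in> null_arrows T Y" if h: "h \<in> Hom E T Y" "\<rho> \<bullet> h \<in> null_arrows T L" for h
  proof -
    have h3: "p3 \<bullet> h \<in> Hom E T V" "p4 \<bullet> h \<in> Hom E T J" using B2 h by (simp_all add: in_Hom)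
    have "p1 \<bullet> p3 \<bullet> h \<in> null_arrows T L" using h B1(6) B2(6) by (simp add: \<rho>_def in_Hom)
    then have 1: "i1 \<bullet> p1 \<bullet> p3 \<bullet> h \<in> null_arrows T V" using null_left B1(4) by blast
    have "p2 \<bullet> p3 \<bullet> h \<in> Hom E T U" using h3 B1 by (simp add: in_Hom)
    then have 2: "i2 \<bullet> p2 \<bullet> p3 \<bullet> h \<in> null_arrows T V" using Unul null_left B1(5) by blast
    have "p3 \<bullet> h = aplus E (i1 \<bullet> p1) (i2 \<bullet> p2) \<bullet> p3 \<bullet> h" unfolding B1(12) using h3 by (simp add: in_Hom)
    also have "\<dots> = aplus E (i1 \<bullet> p1 \<bullet> p3 \<bullet> h) (i2 \<bullet> p2 \<bullet> p3 \<bullet> h)" using B1(4-7) h3 by (simp add: in_Hom)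
    finally have "p3 \<bullet> h \<in> null_arrows T V" using null_plus[OF 1 2] by simp
    then have 3: "i3 \<bullet> p3 \<bullet> h \<in> null_arrows T Y" using null_left B2(4) by blast
    have 4: "i4 \<bullet> p4 \<bullet> h \<in> null_arrows T Y" using nullI[OF J h3(2) B2(5)] .
    have "h = aplus E (i3 \<bullet> p3) (i4 \<bullet> p4) \<bullet> h" unfolding B2(12) using h by (simp add: in_Hom)
    also have "\<dots> = aplus E (i3 \<bullet> p3 \<bullet> h) (i4 \<bullet> p4 \<bullet> h)" using B2(4-7) h by (simp add: in_Hom)
    finally show ?thesis using null_plus[OF 3 4] by simp
  qed
  have surj: "\<exists>h \<in> Hom E T Y. \<rho> \<bullet> h = k" if k: "k \<in> Hom E T L" for k
  proof -
    have "\<rho> \<bullet> i3 \<bullet> i1 \<bullet> k = k"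
      using B1(4,6) B2(4,6) k cmp_cancel_middle[OF B2(8,4,6), of "i1 \<bullet> k"] cmp_cancel_middle[OF B1(8,4,6), of k]
      by (simp add: \<rho>_def in_Hom)
    moreover have "i3 \<bullet> i1 \<bullet> k \<in> Hom E T Y" using B1 B2 k by (simp add: in_Hom)
    ultimately show ?thesis by blast
  qed
  show ?thesis using that[OF tM ep \<rho> \<rho>\<mu> mono' inj surj] .
qed

text \<open>Exactness of \<open>H\<close> in the middle: a null arrow into \<open>M\<close> lifts to a null arrow into \<open>Y\<close>, which is
  subtracted.\<close>

lemma null_in_cokernel:
  assumes t: "tri X \<mu> Y \<nu> M d" and r: "r \<in> Hom E T Y"
  shows "\<nu> \<bullet> r \<in> null_arrows T M \<longleftrightarrow> (\<exists>h \<in> Hom E T X. aplus E r (neg (\<mu> \<bullet> h)) \<in> null_arrows T Y)"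
proof
  note D = triD[OF t]
  assume "\<nu> \<bullet> r \<in> null_arrows T M"
  then obtain z where z: "z \<in> null_arrows T Y" "\<nu> \<bullet> z = \<nu> \<bullet> r" using null_lift[OF t] by metis
  note z' = null_Hom[OF z(1)]
  have rz: "aplus E r (neg z) \<in> Hom E T Y" using r z' by (simp add: in_Hom)
  have "\<nu> \<bullet> aplus E r (neg z) = zarr E T M" using r z' D(5) z(2) by (simp add: in_Hom)
  then obtain h where h: "h \<in> Hom E T X" "\<mu> \<bullet> h = aplus E r (neg z)" using lift_to_kernel[OF t rz] by metis
  have "aplus E r (neg (\<mu> \<bullet> h)) = z" unfolding h(2) using r z' by (simp add: in_Hom)
  then show "\<exists>h \<in> Hom E T X. aplus E r (neg (\<mu> \<bullet> h)) \<in> null_arrows T Y" using h(1) z(1) by auto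
next
  note D = triD[OF t]
  assume "\<exists>h \<in> Hom E T X. aplus E r (neg (\<mu> \<bullet> h)) \<in> null_arrows T Y"
  then obtain h where h: "h \<in> Hom E T X" "aplus E r (neg (\<mu> \<bullet> h)) \<in> null_arrows T Y" by blast
  have "\<nu> \<bullet> \<mu> \<bullet> h = zarr E T M"
    using cmp_zero_middle[OF tri_cmp_zero[OF t] D(4,5), of h] h by (simp add: in_Hom)
  then have "\<nu> \<bullet> aplus E r (neg (\<mu> \<bullet> h)) = \<nu> \<bullet> r" using D h(1) r T_obj by (simp add: in_Hom)
  then show "\<nu> \<bullet> r \<in> null_arrows T M" using null_left[OF h(2) D(5)] by simp
qed

lemma stable_iso:
  assumes \<rho>: "\<rho> \<in> Hom E Y L" and inj: "\<And>h. h \<in> Hom E T Y \<Longrightarrow> \<rho> \<bullet> h \<in> null_arrows T L \<Longrightarrow> h \<in> null_arrows T Y"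
    and surj: "\<And>k. k \<in> Hom E T L \<Longrightarrow> \<exists>h \<in> Hom E T Y. \<rho> \<bullet> h = k"
  shows "Hmap \<rho> \<in> module_hom \<R> (H Y) (H L)" "bij_betw (Hmap \<rho>) (carrier (H Y)) (carrier (H L))"
proof -
  show "Hmap \<rho> \<in> module_hom \<R> (H Y) (H L)" using Hmap_hom[OF \<rho>] .
  show "bij_betw (Hmap \<rho>) (carrier (H Y)) (carrier (H L))"
    unfolding bij_betw_def H_simps
  proof
    show "inj_on (Hmap \<rho>) (stab ` Hom E T Y)"
    proof (rule inj_onI)
      fix x y assume "x \<in> stab ` Hom E T Y" "y \<in> stab ` Hom E T Y" and eq: "Hmap \<rho> x = Hmap \<rho> y"
      then obtain a b where ab: "x = stab a" "y = stab b" "a \<in> Hom E T Y" "b \<in> Hom E T Y" by auto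
      have t: "\<rho> \<bullet> a \<in> Hom E T L" "\<rho> \<bullet> b \<in> Hom E T L" "aplus E a (neg b) \<in> Hom E T Y"
        using ab \<rho> by (simp_all add: in_Hom)
      have "stab (\<rho> \<bullet> a) = stab (\<rho> \<bullet> b)" using eq ab Hmap[OF \<rho>] by simp
      then have "aplus E (\<rho> \<bullet> a) (neg (\<rho> \<bullet> b)) \<in> null_arrows T L" using stab_eq[OF t(1,2)] by simp
      moreover have "\<rho> \<bullet> aplus E a (neg b) = aplus E (\<rho> \<bullet> a) (neg (\<rho> \<bullet> b))" using ab \<rho> by (simp add: in_Hom)
      ultimately have "aplus E a (neg b) \<in> null_arrows T Y" using inj[OF t(3)] by simp
      then show "x = y" using stab_eq[OF ab(3,4)] ab by simp
    qed
    show "Hmap \<rho> ` stab ` Hom E T Y = stab ` Hom E T L"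
    proof (intro equalityI subsetI)
      fix z assume "z \<in> Hmap \<rho> ` stab ` Hom E T Y"
      then obtain h where h: "h \<in> Hom E T Y" "z = stab (\<rho> \<bullet> h)" using Hmap[OF \<rho>] by auto
      then have "\<rho> \<bullet> h \<in> Hom E T L" using \<rho> by (simp add: in_Hom)
      then show "z \<in> stab ` Hom E T L" using h by blast
    next
      fix z assume "z \<in> stab ` Hom E T L"
      then obtain k where k: "k \<in> Hom E T L" "z = stab k" by blast
      obtain h where h: "h \<in> Hom E T Y" "\<rho> \<bullet> h = k" using surj[OF k(1)] by blast
      then have "z = Hmap \<rho> (stab h)" using k Hmap[OF \<rho> h(1)] by simp
      then show "z \<in> Hmap \<rho> ` stab ` Hom E T Y" using h(1) by blast
    qed
  qed
qed

end

section \<open>Additivity on short exact sequences\<close>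

lemma split_ses_dsum:
  assumes ses: "module_ses R x f l g m" and s: "s \<in> module_hom R m l" and gs: "\<And>y. y \<in> carrier m \<Longrightarrow> g (s y) = y"
  shows "module_dsum R x m l"
proof -
  have fg: "x \<in> fg_modules R" "l \<in> fg_modules R" "m \<in> fg_modules R" and f: "f \<in> module_hom R x l"
    and g: "g \<in> module_hom R l m" and inj: "inj_on f (carrier x)"
    and ker: "f ` carrier x = {v \<in> carrier l. g v = \<zero>\<^bsub>m\<^esub>}" using ses by (auto simp: module_ses_def)
  interpret x: left_module R x using fg_module[OF fg(1)] .
  interpret l: left_module R l using fg_module[OF fg(2)] .
  interpret m: left_module R m using fg_module[OF fg(3)] .
  have gf: "g (f a) = \<zero>\<^bsub>m\<^esub>" if "a \<in> carrier x" for a using that ker by blast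
  define k where "k = (\<lambda>(a, b). f a \<oplus>\<^bsub>l\<^esub> s b)"
  have gk: "g (k (a, b)) = b" if "a \<in> carrier x" "b \<in> carrier m" for a b
    using that gf gs module_homD(1)[OF f] module_homD(1)[OF s] module_homD(2)[OF g] by (simp add: k_def)
  have "k \<in> module_hom R (module_prod x m) l"
    unfolding module_hom_def
  proof (intro CollectI conjI ballI)
    show "k \<in> carrier (module_prod x m) \<rightarrow> carrier l"
      using module_homD(1)[OF f] module_homD(1)[OF s] by (auto simp: k_def module_prod_def)
    show "k (p \<oplus>\<^bsub>module_prod x m\<^esub> q) = k p \<oplus>\<^bsub>l\<^esub> k q"
      if pq: "p \<in> carrier (module_prod x m)" "q \<in> carrier (module_prod x m)" for p q
    proof -
      obtain a b a' b' where ab: "p = (a, b)" "q = (a', b')" "a \<in> carrier x" "b \<in> carrier m"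
        "a' \<in> carrier x" "b' \<in> carrier m" using pq by (auto simp: module_prod_def)
      have "f a \<in> carrier l" "f a' \<in> carrier l" "s b \<in> carrier l" "s b' \<in> carrier l"
        using ab module_homD(1)[OF f] module_homD(1)[OF s] by auto
      then show ?thesis
        using ab module_homD(2)[OF f] module_homD(2)[OF s] by (simp add: k_def module_prod_def l.a_ac)
    qed
    show "k (c \<odot>\<^bsub>module_prod x m\<^esub> p) = c \<odot>\<^bsub>l\<^esub> k p"
      if c: "c \<in> carrier R" and p: "p \<in> carrier (module_prod x m)" for c p
    proof -
      obtain a b where ab: "p = (a, b)" "a \<in> carrier x" "b \<in> carrier m" using p by (auto simp: module_prod_def)
      then show ?thesis
        using c module_homD(3)[OF f] module_homD(3)[OF s] module_homD(1)[OF f] module_homD(1)[OF s]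
        by (simp add: k_def module_prod_def l.smult_r_distr)
    qed
  qed
  moreover have "bij_betw k (carrier (module_prod x m)) (carrier l)"
    unfolding bij_betw_def
  proof
    show "inj_on k (carrier (module_prod x m))"
    proof (rule inj_onI)
      fix p q assume pq: "p \<in> carrier (module_prod x m)" "q \<in> carrier (module_prod x m)" "k p = k q"
      obtain a b a' b' where ab: "p = (a, b)" "q = (a', b')" "a \<in> carrier x" "b \<in> carrier m"
        "a' \<in> carrier x" "b' \<in> carrier m" using pq by (auto simp: module_prod_def)
      have b: "b = b'" using gk[OF ab(3,4)] gk[OF ab(5,6)] pq(3) ab by simp
      then have "f a = f a'"
        using pq(3) ab module_homD(1)[OF f] module_homD(1)[OF s] by (simp add: k_def)
      then show "p = q" using inj ab b by (auto simp: inj_on_def)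
    qed
    show "k ` carrier (module_prod x m) = carrier l"
    proof (intro equalityI subsetI)
      fix v assume "v \<in> k ` carrier (module_prod x m)"
      then show "v \<in> carrier l" using module_homD(1)[OF f] module_homD(1)[OF s] by (auto simp: k_def module_prod_def)
    next
      fix v assume v: "v \<in> carrier l"
      have gv: "g v \<in> carrier m" using module_homD(1)[OF g v] .
      have sv: "s (g v) \<in> carrier l" using module_homD(1)[OF s gv] .
      define u where "u = v \<ominus>\<^bsub>l\<^esub> s (g v)"
      have u: "u \<in> carrier l" "u \<oplus>\<^bsub>l\<^esub> s (g v) = v" using v sv by (simp_all add: u_def l.minus_eq l.a_assoc l.l_neg)
      have "g u \<oplus>\<^bsub>m\<^esub> g v = g v" using module_homD(2)[OF g u(1) sv] gs[OF gv] u(2) by simp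
      then have "g u = \<zero>\<^bsub>m\<^esub>"
        using iffD1[OF m.add.r_cancel_one[OF gv module_homD(1)[OF g u(1)]]] by blast
      then have "u \<in> f ` carrier x" unfolding ker using u(1) by simp
      then obtain a where "a \<in> carrier x" "f a = u" by (rule imageE) (rule that, simp_all)
      then have "(a, g v) \<in> carrier (module_prod x m)" "k (a, g v) = v" using gv u(2) by (simp_all add: module_prod_def k_def)
      then show "v \<in> k ` carrier (module_prod x m)" by force
    qed
  qed
  ultimately show ?thesis by (auto simp: module_dsum_def module_iso_def)
qed

context cluster_tilting_category
begin

text \<open>The homomorphism \<open>x \<rightarrow> l\<close> lifts to an arrow \<open>\<phi>\<close>, to which the triangle \<open>X \<rightarrow> Y \<rightarrow> M\<close> is attached.  Since
  \<open>H(Y) \<cong> H(L)\<close>, both \<open>m\<close> and \<open>H(M)\<close> are quotients of \<open>l\<close> by the image of \<open>x\<close>.\<close>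

lemma ses_realized:
  assumes n: "n \<ge> 2" and ses: "module_ses \<R> x f l g m"
    and X0: "X0 \<in> objs E" "module_iso \<R> x (H X0)" and L: "L \<in> objs E" "module_iso \<R> l (H L)"
  obtains X Y M where "X \<in> objs E" "Y \<in> objs E" "M \<in> objs E"
    "module_iso \<R> x (H X)" "module_iso \<R> l (H Y)" "module_iso \<R> m (H M)"
    "\<Theta> Y = \<Theta> X \<otimes>\<^bsub>\<K>\<^esub> \<Theta> M"
proof -
  have fg: "x \<in> fg_modules \<R>" "l \<in> fg_modules \<R>" "m \<in> fg_modules \<R>" and f: "f \<in> module_hom \<R> x l"
    and g: "g \<in> module_hom \<R> l m" "g ` carrier l = carrier m" and finj: "inj_on f (carrier x)"
    and ker: "f ` carrier x = {v \<in> carrier l. g v = \<zero>\<^bsub>m\<^esub>}" using ses by (auto simp: module_ses_def)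
  interpret l: left_module \<R> l using fg_module[OF fg(2)] .
  interpret m: left_module \<R> m using fg_module[OF fg(3)] .
  have xc: "module_closed \<R> x" and lc: "module_closed \<R> l"
    using left_module_closed fg_module fg by blast+
  obtain X T1 t T0 \<pi> \<delta> \<theta> where tX: "tri T1 t T0 \<pi> X \<delta>" and T1: "T1 \<in> \<T>" and T0: "T0 \<in> \<T>"
    and \<theta>: "\<theta> \<in> Hom E X X0"
    and \<theta>i: "\<And>h. h \<in> Hom E T X \<Longrightarrow> \<theta> \<bullet> h \<in> null_arrows T X0 \<Longrightarrow> h \<in> null_arrows T X"
    and \<theta>s: "\<And>k. k \<in> Hom E T X0 \<Longrightarrow> \<exists>h \<in> Hom E T X. \<theta> \<bullet> h = k"
    by (rule presentation[OF n X0(1)]) (rule that)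
  note DX = triD[OF tX]
  have \<pi>: "epic \<pi>" using epic_of_vanish[OF tX] rigid[OF n _ T1] by blast
  have "module_iso \<R> (H X) (H X0)" using stable_iso[OF \<theta> \<theta>i \<theta>s] by (auto simp: module_iso_def)
  then have xX: "module_iso \<R> x (H X)" using module_iso_trans[OF X0(2)] module_iso_sym H_closed by blast
  then obtain \<xi> where \<xi>: "\<xi> \<in> module_hom \<R> x (H X)" "bij_betw \<xi> (carrier x) (carrier (H X))"
    by (auto simp: module_iso_def)
  obtain \<Lambda> where \<Lambda>: "\<Lambda> \<in> module_hom \<R> l (H L)" "bij_betw \<Lambda> (carrier l) (carrier (H L))"
    using L(2) by (auto simp: module_iso_def)
  define \<xi>' where "\<xi>' = inv_into (carrier x) \<xi>"
  have \<xi>': "\<xi>' \<in> module_hom \<R> (H X) x" using module_hom_inverse[OF \<xi> xc] by (simp add: \<xi>'_def)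
  have \<xi>\<xi>: "\<xi>' y \<in> carrier x" "\<xi> (\<xi>' y) = y" if "y \<in> carrier (H X)" for y
    using that \<xi>(2) by (auto simp: \<xi>'_def bij_betw_def inv_into_into f_inv_into_f)
  define \<psi> where "\<psi> = \<Lambda> \<circ> (f \<circ> \<xi>')"
  have \<psi>: "\<psi> \<in> module_hom \<R> (H X) (H L)"
    unfolding \<psi>_def by (intro module_hom_compose[OF _ \<Lambda>(1)] module_hom_compose[OF \<xi>' f])
  obtain \<phi> where \<phi>: "\<phi> \<in> Hom E X L" and \<psi>\<phi>: "\<And>h. h \<in> Hom E T X \<Longrightarrow> \<psi> (stab h) = stab (\<phi> \<bullet> h)"
    using full_on_presented[OF tX T1 T0 \<pi> L(1) \<psi>] by blast
  have mono: "h \<in> null_arrows T X" if h: "h \<in> Hom E T X" "\<phi> \<bullet> h \<in> null_arrows T L" for h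
  proof -
    have z: "zarr E T X \<in> Hom E T X" using T_obj DX by (simp add: in_Hom)
    have c: "stab h \<in> carrier (H X)" "stab (zarr E T X) \<in> carrier (H X)" using h(1) z by (auto simp: H_simps)
    have "\<psi> (stab h) = \<psi> (stab (zarr E T X))"
      using \<psi>\<phi>[OF h(1)] hom_zero[OF \<psi> DX(3) L(1)] stab_eq_zero[of "\<phi> \<bullet> h" T L] h null_Hom[OF h(2)] by simp
    moreover have "f (\<xi>' (stab h)) \<in> carrier l" "f (\<xi>' (stab (zarr E T X))) \<in> carrier l"
      using module_homD(1)[OF f] \<xi>\<xi>(1) c by auto
    ultimately have "f (\<xi>' (stab h)) = f (\<xi>' (stab (zarr E T X)))"
      using inj_onD[OF bij_betw_imp_inj_on[OF \<Lambda>(2)]] unfolding \<psi>_def comp_apply by blast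
    then have "\<xi>' (stab h) = \<xi>' (stab (zarr E T X))" by (rule inj_onD[OF finj _ \<xi>\<xi>(1)[OF c(1)] \<xi>\<xi>(1)[OF c(2)]])
    then have "stab h = stab (zarr E T X)" using \<xi>\<xi>(2)[OF c(1)] \<xi>\<xi>(2)[OF c(2)] by metis
    then show ?thesis using stab_eq_zero[OF h(1)] by simp
  qed
  obtain Y \<mu> \<nu> M \<rho> d where tM: "tri X \<mu> Y \<nu> M d" and ep: "epic \<nu>" and \<rho>: "\<rho> \<in> Hom E Y L" "\<rho> \<bullet> \<mu> = \<phi>"
    and \<mu>i: "\<And>h. h \<in> Hom E T X \<Longrightarrow> \<mu> \<bullet> h \<in> null_arrows T Y \<Longrightarrow> h \<in> null_arrows T X"
    and \<rho>i: "\<And>h. h \<in> Hom E T Y \<Longrightarrow> \<rho> \<bullet> h \<in> null_arrows T L \<Longrightarrow> h \<in> null_arrows T Y"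
    and \<rho>s: "\<And>k. k \<in> Hom E T L \<Longrightarrow> \<exists>h \<in> Hom E T Y. \<rho> \<bullet> h = k"
    by (rule exact_triangle[OF n tX T1 T0 \<phi> mono]) (assumption, assumption, rule that)
  note DM = triD[OF tM] and iso = stable_iso[OF \<rho>(1) \<rho>i \<rho>s]
  define \<Lambda>' where "\<Lambda>' = inv_into (carrier (H Y)) (Hmap \<rho>) \<circ> \<Lambda>"
  have \<Lambda>': "\<Lambda>' \<in> module_hom \<R> l (H Y)" "bij_betw \<Lambda>' (carrier l) (carrier (H Y))"
    unfolding \<Lambda>'_def using module_hom_compose[OF \<Lambda>(1) module_hom_inverse[OF iso H_closed]]
      bij_betw_trans[OF \<Lambda>(2) bij_betw_inv_into[OF iso(2)]] by auto
  have \<Lambda>\<rho>: "\<Lambda> u = stab (\<rho> \<bullet> r)" if "u \<in> carrier l" "\<Lambda>' u = stab r" "r \<in> Hom E T Y" for u r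
  proof -
    have "\<Lambda> u \<in> Hmap \<rho> ` carrier (H Y)"
      using module_homD(1)[OF \<Lambda>(1) that(1)] iso(2) by (simp add: bij_betw_def)
    then have "Hmap \<rho> (\<Lambda>' u) = \<Lambda> u" by (simp add: \<Lambda>'_def f_inv_into_f)
    then show ?thesis using that Hmap[OF \<rho>(1)] by simp
  qed
  have rep: "\<exists>r \<in> Hom E T Y. \<Lambda>' u = stab r" if "u \<in> carrier l" for u
    using module_homD(1)[OF \<Lambda>'(1) that] by (auto simp: H_simps)
  define \<beta> where "\<beta> = Hmap \<nu> \<circ> \<Lambda>'"
  have \<beta>: "\<beta> \<in> module_hom \<R> l (H M)"
    unfolding \<beta>_def using module_hom_compose[OF \<Lambda>'(1) Hmap_hom[OF DM(5)]] .
  have \<beta>r: "\<beta> u = stab (\<nu> \<bullet> r)" if "\<Lambda>' u = stab r" "r \<in> Hom E T Y" for u r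
    using that Hmap[OF DM(5)] by (simp add: \<beta>_def)
  have \<beta>s: "\<beta> ` carrier l = carrier (H M)"
  proof -
    have "\<beta> ` carrier l = Hmap \<nu> ` carrier (H Y)"
      unfolding \<beta>_def image_comp[symmetric] bij_betw_imp_surj_on[OF \<Lambda>'(2)] ..
    also have "\<dots> = carrier (H M)"
    proof (intro equalityI subsetI)
      fix z assume "z \<in> Hmap \<nu> ` carrier (H Y)"
      then show "z \<in> carrier (H M)" using module_homD(1)[OF Hmap_hom[OF DM(5)]] by auto
    next
      fix z assume "z \<in> carrier (H M)"
      then obtain k where k: "k \<in> Hom E T M" "z = stab k" by (auto simp: H_simps)
      obtain h where h: "h \<in> Hom E T Y" "\<nu> \<bullet> h = k" using epicE[OF ep DM(5) T_in_T k(1)] .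
      then have "z = Hmap \<nu> (stab h)" using k Hmap[OF DM(5) h(1)] by simp
      then show "z \<in> Hmap \<nu> ` carrier (H Y)" using h(1) by (auto simp: H_simps)
    qed
    finally show ?thesis .
  qed
  \<comment> \<open>both kernels consist of the elements coming from \<open>x\<close>\<close>
  have kernels: "g u = \<zero>\<^bsub>m\<^esub> \<longleftrightarrow> \<nu> \<bullet> r \<in> null_arrows T M" if u: "u \<in> carrier l" "\<Lambda>' u = stab r" "r \<in> Hom E T Y" for u r
  proof -
    have \<mu>h: "\<mu> \<bullet> h \<in> Hom E T Y" "\<rho> \<bullet> \<mu> \<bullet> h = \<phi> \<bullet> h" "\<phi> \<bullet> h \<in> Hom E T L" if "h \<in> Hom E T X" for h
      using that DM(4) \<phi> cmp_reduce[OF \<rho>(2) DM(4) \<rho>(1), of h] by (simp_all add: in_Hom)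
    have *: "\<Lambda> (f (\<xi>' (stab h))) = \<Lambda> u \<longleftrightarrow> aplus E r (neg (\<mu> \<bullet> h)) \<in> null_arrows T Y" if h: "h \<in> Hom E T X" for h
    proof -
      have \<rho>r: "\<rho> \<bullet> r \<in> Hom E T L" using u \<rho> by (simp add: in_Hom)
      have "\<Lambda> (f (\<xi>' (stab h))) = stab (\<phi> \<bullet> h)" using \<psi>\<phi>[OF h] by (simp add: \<psi>_def)
      then have "\<Lambda> (f (\<xi>' (stab h))) = \<Lambda> u \<longleftrightarrow> stab (\<rho> \<bullet> r) = stab (\<phi> \<bullet> h)" using \<Lambda>\<rho>[OF u] by auto
      also have "\<dots> \<longleftrightarrow> aplus E (\<rho> \<bullet> r) (neg (\<phi> \<bullet> h)) \<in> null_arrows T L" using stab_eq[OF \<rho>r \<mu>h(3)[OF h]] .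
      also have "aplus E (\<rho> \<bullet> r) (neg (\<phi> \<bullet> h)) = \<rho> \<bullet> aplus E r (neg (\<mu> \<bullet> h))"
        using \<mu>h(1,2)[OF h] u(3) \<rho>(1) by (simp add: in_Hom)
      also have "\<dots> \<in> null_arrows T L \<longleftrightarrow> aplus E r (neg (\<mu> \<bullet> h)) \<in> null_arrows T Y"
      proof -
        have "aplus E r (neg (\<mu> \<bullet> h)) \<in> Hom E T Y" using \<mu>h(1)[OF h] u(3) by (simp add: in_Hom)
        then show ?thesis using \<rho>i null_left \<rho>(1) by blast
      qed
      finally show ?thesis .
    qed
    have "g u = \<zero>\<^bsub>m\<^esub> \<longleftrightarrow> u \<in> f ` carrier x" unfolding ker using u(1) by simp
    also have "\<dots> \<longleftrightarrow> (\<exists>y \<in> carrier x. f y = u)" by auto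
    also have "\<dots> \<longleftrightarrow> (\<exists>h \<in> Hom E T X. \<Lambda> (f (\<xi>' (stab h))) = \<Lambda> u)"
    proof
      assume "\<exists>y \<in> carrier x. f y = u"
      then obtain y where y: "y \<in> carrier x" "f y = u" by blast
      obtain h where h: "h \<in> Hom E T X" "\<xi> y = stab h" using module_homD(1)[OF \<xi>(1) y(1)] by (auto simp: H_simps)
      have "\<xi>' (stab h) = y" using h(2)[symmetric] y(1) \<xi>(2) by (simp add: \<xi>'_def bij_betw_def)
      then show "\<exists>h \<in> Hom E T X. \<Lambda> (f (\<xi>' (stab h))) = \<Lambda> u" using h y by auto
    next
      assume "\<exists>h \<in> Hom E T X. \<Lambda> (f (\<xi>' (stab h))) = \<Lambda> u"
      then obtain h where h: "h \<in> Hom E T X" "\<Lambda> (f (\<xi>' (stab h))) = \<Lambda> u" by blast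
      have y: "\<xi>' (stab h) \<in> carrier x" using \<xi>\<xi>(1) h(1) by (auto simp: H_simps)
      then have "f (\<xi>' (stab h)) = u"
        using inj_onD[OF bij_betw_imp_inj_on[OF \<Lambda>(2)] h(2) module_homD(1)[OF f y] u(1)] by simp
      then show "\<exists>y \<in> carrier x. f y = u" using y by blast
    qed
    also have "\<dots> \<longleftrightarrow> (\<exists>h \<in> Hom E T X. aplus E r (neg (\<mu> \<bullet> h)) \<in> null_arrows T Y)" using * by blast
    also have "\<dots> \<longleftrightarrow> \<nu> \<bullet> r \<in> null_arrows T M" using null_in_cokernel[OF tM u(3)] by simp
    finally show ?thesis .
  qed
  have eq: "g v = g w \<longleftrightarrow> \<beta> v = \<beta> w" if v: "v \<in> carrier l" and w: "w \<in> carrier l" for v w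
  proof -
    define u where "u = v \<ominus>\<^bsub>l\<^esub> w"
    have u: "u \<in> carrier l" "u \<oplus>\<^bsub>l\<^esub> w = v" using v w by (simp_all add: u_def l.minus_eq l.a_assoc l.l_neg)
    obtain r where r: "r \<in> Hom E T Y" "\<Lambda>' u = stab r" using rep[OF u(1)] by blast
    obtain k where k: "k \<in> Hom E T Y" "\<Lambda>' w = stab k" using rep[OF w] by blast
    have rk: "aplus E r k \<in> Hom E T Y" using r k by (simp add: in_Hom)
    have vk: "\<Lambda>' v = stab (aplus E r k)"
      using module_homD(2)[OF \<Lambda>'(1) u(1) w] u(2) r k by (simp add: H_simps)
    have gc: "g u \<in> carrier m" "g w \<in> carrier m" using module_homD(1)[OF g(1)] u(1) w by auto
    have "g v = g u \<oplus>\<^bsub>m\<^esub> g w" using module_homD(2)[OF g(1) u(1) w] u(2) by simp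
    then have "g v = g w \<longleftrightarrow> g u = \<zero>\<^bsub>m\<^esub>" using m.add.r_cancel_one[OF gc(2,1)] by metis
    also have "\<dots> \<longleftrightarrow> \<nu> \<bullet> r \<in> null_arrows T M" using kernels[OF u(1) r(2,1)] .
    also have "\<dots> \<longleftrightarrow> stab (\<nu> \<bullet> aplus E r k) = stab (\<nu> \<bullet> k)"
    proof -
      have c: "\<nu> \<bullet> aplus E r k \<in> Hom E T M" "\<nu> \<bullet> k \<in> Hom E T M" using r k rk DM(5) by (simp_all add: in_Hom)
      have "aplus E (\<nu> \<bullet> aplus E r k) (neg (\<nu> \<bullet> k)) = \<nu> \<bullet> r" using r(1) k(1) DM(5) by (simp add: in_Hom)
      then show ?thesis using stab_eq[OF c] by simp
    qed
    also have "\<dots> \<longleftrightarrow> \<beta> v = \<beta> w" using \<beta>r[OF vk rk] \<beta>r[OF k(2,1)] by simp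
    finally show ?thesis .
  qed
  have "module_iso \<R> m (H M)" using module_iso_of_kernel_pair[OF g \<beta> \<beta>s eq lc] .
  moreover have "module_iso \<R> l (H Y)" using \<Lambda>' by (auto simp: module_iso_def)
  moreover have "\<Theta> Y = \<Theta> X \<otimes>\<^bsub>\<K>\<^esub> \<Theta> M"
    using Theta_additive[OF tM ep] stably_monic_from_T[OF DM(4) \<mu>i] by blast
  ultimately show ?thesis using that DX(3) DM(2,3) xX by blast
qed

text \<open>For \<open>n = 1\<close> every object lies in \<open>\<T>\<close>, so every module is projective.\<close>

lemma ses_splits:
  assumes n: "n = 1" and ses: "module_ses \<R> x f l g m"
    and L: "L \<in> objs E" "module_iso \<R> l (H L)" and M: "M \<in> objs E" "module_iso \<R> m (H M)"
  shows "module_dsum \<R> x m l"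
proof -
  have fg: "x \<in> fg_modules \<R>" "l \<in> fg_modules \<R>" "m \<in> fg_modules \<R>"
    and g: "g \<in> module_hom \<R> l m" "g ` carrier l = carrier m" using ses by (auto simp: module_ses_def)
  have lc: "module_closed \<R> l" using left_module_closed[OF fg_module[OF fg(2)]] .
  have LT: "L \<in> \<T>" and MT: "M \<in> \<T>" using orth_top orth_0 n L M by auto
  obtain \<Lambda> where \<Lambda>: "\<Lambda> \<in> module_hom \<R> l (H L)" "bij_betw \<Lambda> (carrier l) (carrier (H L))"
    using L(2) by (auto simp: module_iso_def)
  obtain \<xi> where \<xi>: "\<xi> \<in> module_hom \<R> m (H M)" "bij_betw \<xi> (carrier m) (carrier (H M))"
    using M(2) by (auto simp: module_iso_def)
  define \<Lambda>' where "\<Lambda>' = inv_into (carrier l) \<Lambda>"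
  have \<Lambda>': "\<Lambda>' \<in> module_hom \<R> (H L) l" using module_hom_inverse[OF \<Lambda> lc] by (simp add: \<Lambda>'_def)
  define \<psi> where "\<psi> = \<xi> \<circ> (g \<circ> \<Lambda>')"
  have \<psi>: "\<psi> \<in> module_hom \<R> (H L) (H M)"
    unfolding \<psi>_def by (intro module_hom_compose[OF _ \<xi>(1)] module_hom_compose[OF \<Lambda>' g(1)])
  obtain \<phi> where \<phi>: "\<phi> \<in> Hom E L M" and \<psi>\<phi>: "\<And>h. h \<in> Hom E T L \<Longrightarrow> \<psi> (stab h) = stab (\<phi> \<bullet> h)"
    using hom_from_T[OF LT M(1) \<psi>] by blast
  have surj: "\<exists>h \<in> Hom E T L. aplus E (\<phi> \<bullet> h) (neg k) \<in> null_arrows T M" if k: "k \<in> Hom E T M" for k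
  proof -
    have "stab k \<in> \<xi> ` g ` carrier l" using k \<xi>(2) g(2) by (auto simp: bij_betw_def H_simps)
    then obtain v where v: "v \<in> carrier l" "stab k = \<xi> (g v)" by auto
    obtain h where h: "h \<in> Hom E T L" "\<Lambda> v = stab h" using module_homD(1)[OF \<Lambda>(1) v(1)] by (auto simp: H_simps)
    have "\<Lambda>' (stab h) = v" using h(2)[symmetric] v(1) \<Lambda>(2) by (simp add: \<Lambda>'_def bij_betw_def)
    then have "stab (\<phi> \<bullet> h) = stab k" using \<psi>\<phi>[OF h(1)] v(2) by (simp add: \<psi>_def)
    moreover have "\<phi> \<bullet> h \<in> Hom E T M" using \<phi> h by (simp add: in_Hom)
    ultimately show ?thesis using stab_eq[OF _ k] h(1) by blast
  qed
  have "\<exists>s \<in> Hom E M L. aplus E (\<phi> \<bullet> s) (neg (ident E M)) \<in> null_arrows M M"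
  proof (rule add_closure_induct[OF MT])
    fix u v assume u: "u \<in> Hom E T M" and v: "v \<in> Hom E M T"
    obtain h where h: "h \<in> Hom E T L" "aplus E (\<phi> \<bullet> h) (neg u) \<in> null_arrows T M" using surj[OF u] by blast
    have "aplus E (\<phi> \<bullet> h) (neg u) \<bullet> v = aplus E (\<phi> \<bullet> h \<bullet> v) (neg (u \<bullet> v))" using u v h(1) \<phi> by (simp add: in_Hom)
    then have "aplus E (\<phi> \<bullet> h \<bullet> v) (neg (u \<bullet> v)) \<in> null_arrows M M" using null_right[OF h(2) v] by simp
    moreover have "h \<bullet> v \<in> Hom E M L" using h v by (simp add: in_Hom)
    ultimately show "\<exists>s \<in> Hom E M L. aplus E (\<phi> \<bullet> s) (neg (u \<bullet> v)) \<in> null_arrows M M" by blast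
  next
    have "zarr E M L \<in> Hom E M L" "aplus E (\<phi> \<bullet> zarr E M L) (neg (zarr E M M)) = zarr E M M"
      using L(1) M(1) \<phi> by (simp_all add: in_Hom)
    then show "\<exists>s \<in> Hom E M L. aplus E (\<phi> \<bullet> s) (neg (zarr E M M)) \<in> null_arrows M M"
      using null_zero[OF M(1) M(1)] by metis
  next
    fix a b assume a: "a \<in> Hom E M M" and b: "b \<in> Hom E M M"
      and "\<exists>s \<in> Hom E M L. aplus E (\<phi> \<bullet> s) (neg a) \<in> null_arrows M M"
      and "\<exists>s \<in> Hom E M L. aplus E (\<phi> \<bullet> s) (neg b) \<in> null_arrows M M"
    then obtain s r where s: "s \<in> Hom E M L" "aplus E (\<phi> \<bullet> s) (neg a) \<in> null_arrows M M"
      and r: "r \<in> Hom E M L" "aplus E (\<phi> \<bullet> r) (neg b) \<in> null_arrows M M" by blast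
    have "aplus E (\<phi> \<bullet> aplus E s r) (neg (aplus E a b)) = aplus E (aplus E (\<phi> \<bullet> s) (neg a)) (aplus E (\<phi> \<bullet> r) (neg b))"
      using s(1) r(1) a b \<phi> plus_left_comm[of "neg a" "\<phi> \<bullet> r" "neg b"] by (simp add: in_Hom)
    then have "aplus E (\<phi> \<bullet> aplus E s r) (neg (aplus E a b)) \<in> null_arrows M M" using null_plus[OF s(2) r(2)] by simp
    moreover have "aplus E s r \<in> Hom E M L" using s r by (simp add: in_Hom)
    ultimately show "\<exists>s \<in> Hom E M L. aplus E (\<phi> \<bullet> s) (neg (aplus E a b)) \<in> null_arrows M M" by blast
  qed
  then obtain s where s: "s \<in> Hom E M L" "aplus E (\<phi> \<bullet> s) (neg (ident E M)) \<in> null_arrows M M" by blast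
  define \<sigma> where "\<sigma> = \<Lambda>' \<circ> (Hmap s \<circ> \<xi>)"
  have \<sigma>: "\<sigma> \<in> module_hom \<R> m l"
    unfolding \<sigma>_def by (intro module_hom_compose[OF _ \<Lambda>'] module_hom_compose[OF \<xi>(1) Hmap_hom[OF s(1)]])
  have "g (\<sigma> y) = y" if y: "y \<in> carrier m" for y
  proof -
    obtain k where k: "k \<in> Hom E T M" "\<xi> y = stab k" using module_homD(1)[OF \<xi>(1) y] by (auto simp: H_simps)
    have sk: "s \<bullet> k \<in> Hom E T L" "\<phi> \<bullet> s \<bullet> k \<in> Hom E T M" using s k \<phi> by (simp_all add: in_Hom)
    have "\<xi> (g (\<sigma> y)) = \<psi> (stab (s \<bullet> k))" using k Hmap[OF s(1)] by (simp add: \<sigma>_def \<psi>_def)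
    also have "\<dots> = stab (\<phi> \<bullet> s \<bullet> k)" using \<psi>\<phi>[OF sk(1)] .
    also have "\<dots> = stab k"
    proof -
      have "aplus E (\<phi> \<bullet> s) (neg (ident E M)) \<bullet> k = aplus E (\<phi> \<bullet> s \<bullet> k) (neg k)"
        using s(1) k(1) \<phi> M(1) by (simp add: in_Hom)
      then show ?thesis using null_right[OF s(2) k(1)] stab_eq[OF sk(2) k(1)] by simp
    qed
    finally have "\<xi> (g (\<sigma> y)) = \<xi> y" using k by simp
    moreover have "g (\<sigma> y) \<in> carrier m" using module_homD(1)[OF g(1)] module_homD(1)[OF \<sigma> y] by simp
    ultimately show ?thesis using inj_onD[OF bij_betw_imp_inj_on[OF \<xi>(2)]] y by blast
  qed
  then show ?thesis using split_ses_dsum[OF ses \<sigma>] by blast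
qed

lemma ses_additive:
  fixes \<Phi> :: "(('m set, 'm set) module set \<Rightarrow>\<^sub>0 int) set \<Rightarrow> ('o set \<Rightarrow>\<^sub>0 int) set"
  assumes dense: "\<And>m :: ('m set, 'm set) module. m \<in> fg_modules \<R> \<Longrightarrow> \<exists>M \<in> objs E. module_iso \<R> m (H M)"
    and hom: "\<Phi> \<in> hom (K0sp_mod \<R>) \<K>"
    and \<Phi>: "\<And>M. M \<in> objs E \<Longrightarrow> \<Phi> (class_mod \<R> (H M)) = \<Theta> M"
    and ses: "module_ses \<R> x f l g m"
  shows "\<Phi> (class_mod \<R> l) = \<Phi> (class_mod \<R> x) \<otimes>\<^bsub>\<K>\<^esub> \<Phi> (class_mod \<R> m)"
proof -
  have fg: "x \<in> fg_modules \<R>" "l \<in> fg_modules \<R>" "m \<in> fg_modules \<R>"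
    using ses by (auto simp: module_ses_def)
  obtain X0 L M0 where X0: "X0 \<in> objs E" "module_iso \<R> x (H X0)"
    and L: "L \<in> objs E" "module_iso \<R> l (H L)" and M0: "M0 \<in> objs E" "module_iso \<R> m (H M0)"
    using dense[OF fg(1)] dense[OF fg(2)] dense[OF fg(3)] by (elim bexE) (rule that)
  show ?thesis
  proof (cases "n = 1")
    case True
    have "class_mod \<R> l = class_mod \<R> x \<otimes>\<^bsub>K0sp_mod \<R>\<^esub> class_mod \<R> m"
      unfolding class_mod_def K0sp_mod_def
      by (rule K0_split_class_dsum[where S = "fg_modules \<R>" and eqv = "module_iso \<R>"
            and sumrel = "module_dsum \<R>" and x = x and y = m and z = l, OF fg(1,3,2) ses_splits[OF True ses L M0]])
    moreover have "class_mod \<R> x \<in> carrier (K0sp_mod \<R>)" "class_mod \<R> m \<in> carrier (K0sp_mod \<R>)"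
      using fg by (simp_all add: class_mod_def K0sp_mod_def K0_split_class_closed)
    ultimately show ?thesis using hom_mult[OF hom] by simp
  next
    case False
    then have n: "n \<ge> 2" using n_pos by simp
    have c: "class_mod \<R> y = class_mod \<R> (H Z)"
      if "y \<in> fg_modules \<R>" "module_iso \<R> y (H Z)" for y :: "('m set, 'm set) module" and Z
      using class_mod_iso[OF that(2) left_module_closed[OF fg_module[OF that(1)]]] .
    obtain X Y M where r: "X \<in> objs E" "Y \<in> objs E" "M \<in> objs E"
      "module_iso \<R> x (H X)" "module_iso \<R> l (H Y)" "module_iso \<R> m (H M)"
      "\<Theta> Y = \<Theta> X \<otimes>\<^bsub>\<K>\<^esub> \<Theta> M" using ses_realized[OF n ses X0 L] .
    show ?thesis
      unfolding c[OF fg(1) r(4)] c[OF fg(2) r(5)] c[OF fg(3) r(6)] \<Phi>[OF r(1)] \<Phi>[OF r(2)] \<Phi>[OF r(3)] by (rule r(7))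
  qed
qed

end

theorem theorem3p9:
  fixes K :: "('k, 'r) ring_scheme"
    and E :: "('o, 'm, 'k, 'e, 'z) extcat_scheme"
    and T :: 'o and n :: nat
    and \<Phi> :: "(('m set, 'm set) module set \<Rightarrow>\<^sub>0 int) set \<Rightarrow> ('o set \<Rightarrow>\<^sub>0 int) set"
  assumes k: "algebraically_closed K"
    and frobenius: "frobenius_extriangulated_category K E"
    and krull_schmidt: "krull_schmidt E"
    and WIC: "WIC E"
    and n: "n \<ge> 1"
    and T: "cluster_tilting_object E n T"
    and dense: "\<forall>m :: ('m set, 'm set) module. m \<in> fg_modules (stable_algebra E T) \<longrightarrow>
      (\<exists>M \<in> objs E. module_iso (stable_algebra E T) m (H_functor E T M))"
    and Phi_hom: "\<Phi> \<in> hom (K0sp_mod (stable_algebra E T)) (K0sp_sub E (add_closure E T))"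
    and Phi_H: "\<forall>M \<in> objs E.
      \<Phi> (class_mod (stable_algebra E T) (H_functor E T M)) = Theta E (add_closure E T) n M"
  shows "(\<forall>x f l g m. module_ses (stable_algebra E T) x f l g m \<longrightarrow>
      \<Phi> (class_mod (stable_algebra E T) x)
        \<otimes>\<^bsub>K0sp_sub E (add_closure E T)\<^esub>
      inv\<^bsub>K0sp_sub E (add_closure E T)\<^esub> \<Phi> (class_mod (stable_algebra E T) l)
        \<otimes>\<^bsub>K0sp_sub E (add_closure E T)\<^esub>
      \<Phi> (class_mod (stable_algebra E T) m)
      = \<one>\<^bsub>K0sp_sub E (add_closure E T)\<^esub>) \<and>
    (\<exists>\<Psi> \<in> hom (K0_mod (stable_algebra E T)) (K0sp_sub E (add_closure E T)).
      \<forall>v \<in> carrier (K0sp_mod (stable_algebra E T)).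
        \<Psi> (ses_relations (stable_algebra E T) #>\<^bsub>K0sp_mod (stable_algebra E T)\<^esub> v) = \<Phi> v)"
proof -
  interpret cluster_tilting_category K E T n
    using frobenius krull_schmidt WIC n T
    by (simp add: cluster_tilting_category_def cluster_tilting_category_axioms_def)
  interpret P: comm_group "K0sp_mod \<R> :: (('m set, 'm set) module set \<Rightarrow>\<^sub>0 int) set monoid"
    by (simp add: K0sp_mod_def K0_split_comm_group)
  interpret \<Phi>: group_hom "K0sp_mod \<R>" \<K> \<Phi>
    using Phi_hom by (simp add: group_hom_def group_hom_axioms_def P.is_group \<K>.is_group)
  have closed: "class_mod \<R> y \<in> carrier (K0sp_mod \<R>)" if "y \<in> fg_modules \<R>" for y :: "('m set, 'm set) module"
    using that by (simp add: class_mod_def K0sp_mod_def K0_split_class_closed)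
  have zero: "\<Phi> (class_mod \<R> x) \<otimes>\<^bsub>\<K>\<^esub> inv\<^bsub>\<K>\<^esub> \<Phi> (class_mod \<R> l) \<otimes>\<^bsub>\<K>\<^esub> \<Phi> (class_mod \<R> m) = \<one>\<^bsub>\<K>\<^esub>"
    if ses: "module_ses \<R> x f l g m" for x f l g m
  proof -
    have "x \<in> fg_modules \<R>" "m \<in> fg_modules \<R>" using ses by (auto simp: module_ses_def)
    then have c: "\<Phi> (class_mod \<R> x) \<in> carrier \<K>" "\<Phi> (class_mod \<R> m) \<in> carrier \<K>" using closed by auto
    have "\<Phi> (class_mod \<R> l) = \<Phi> (class_mod \<R> x) \<otimes>\<^bsub>\<K>\<^esub> \<Phi> (class_mod \<R> m)"
      using ses_additive[OF _ Phi_hom _ ses] dense Phi_H by blast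
    moreover have "a \<otimes>\<^bsub>\<K>\<^esub> b \<otimes>\<^bsub>\<K>\<^esub> e = (a \<otimes>\<^bsub>\<K>\<^esub> e) \<otimes>\<^bsub>\<K>\<^esub> b"
      if "a \<in> carrier \<K>" "b \<in> carrier \<K>" "e \<in> carrier \<K>" for a b e using that by (simp add: \<K>.m_ac)
    ultimately show ?thesis using c by (simp del: \<K>.inv_mult_group)
  qed
  define Rel where "Rel = {class_mod \<R> x \<otimes>\<^bsub>K0sp_mod \<R>\<^esub> inv\<^bsub>K0sp_mod \<R>\<^esub> class_mod \<R> l \<otimes>\<^bsub>K0sp_mod \<R>\<^esub> class_mod \<R> m
       | x f l g (m :: ('m set, 'm set) module). module_ses \<R> x f l g m}"
  have Rel: "Rel \<subseteq> carrier (K0sp_mod \<R>)" "\<And>r. r \<in> Rel \<Longrightarrow> \<Phi> r = \<one>\<^bsub>\<K>\<^esub>"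
  proof -
    have *: "r \<in> carrier (K0sp_mod \<R>) \<and> \<Phi> r = \<one>\<^bsub>\<K>\<^esub>" if r: "r \<in> Rel" for r
    proof -
      obtain x f l g and m :: "('m set, 'm set) module" where ses: "module_ses \<R> x f l g m"
        and r: "r = class_mod \<R> x \<otimes>\<^bsub>K0sp_mod \<R>\<^esub> inv\<^bsub>K0sp_mod \<R>\<^esub> class_mod \<R> l \<otimes>\<^bsub>K0sp_mod \<R>\<^esub> class_mod \<R> m"
        using r unfolding Rel_def by blast
      have "x \<in> fg_modules \<R>" "l \<in> fg_modules \<R>" "m \<in> fg_modules \<R>" using ses by (auto simp: module_ses_def)
      then have c: "class_mod \<R> x \<in> carrier (K0sp_mod \<R>)" "class_mod \<R> l \<in> carrier (K0sp_mod \<R>)"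
        "class_mod \<R> m \<in> carrier (K0sp_mod \<R>)" using closed by auto
      then show ?thesis using zero[OF ses] by (simp add: r)
    qed
    then show "Rel \<subseteq> carrier (K0sp_mod \<R>)" "\<And>r. r \<in> Rel \<Longrightarrow> \<Phi> r = \<one>\<^bsub>\<K>\<^esub>" by auto
  qed
  have rel: "ses_relations \<R> = generate (K0sp_mod \<R>) Rel" by (simp add: ses_relations_def Rel_def)
  have normal: "(ses_relations \<R> :: (('m set, 'm set) module set \<Rightarrow>\<^sub>0 int) set set) \<lhd> K0sp_mod \<R>"
    unfolding rel by (intro P.subgroup_imp_normal P.generate_is_subgroup Rel(1))
  have "Rel \<subseteq> kernel (K0sp_mod \<R>) \<K> \<Phi>" using Rel by (auto simp: kernel_def)
  then have ker: "ses_relations \<R> \<subseteq> kernel (K0sp_mod \<R>) \<K> \<Phi>"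
    unfolding rel using P.generate_subgroup_incl \<Phi>.subgroup_kernel by blast
  obtain \<Psi> where \<Psi>: "\<Psi> \<in> hom (K0sp_mod \<R> Mod ses_relations \<R>) \<K>"
    "\<And>v. v \<in> carrier (K0sp_mod \<R>) \<Longrightarrow> \<Psi> (ses_relations \<R> #>\<^bsub>K0sp_mod \<R>\<^esub> v) = \<Phi> v"
    using \<Phi>.FactGroup_universal_kernel[OF normal ker] by blast
  show ?thesis
  proof (intro conjI allI impI)
    fix x l m :: "('m set, 'm set) module" and f g assume "module_ses \<R> x f l g m"
    then show "\<Phi> (class_mod \<R> x) \<otimes>\<^bsub>\<K>\<^esub> inv\<^bsub>\<K>\<^esub> \<Phi> (class_mod \<R> l) \<otimes>\<^bsub>\<K>\<^esub> \<Phi> (class_mod \<R> m) = \<one>\<^bsub>\<K>\<^esub>"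
      by (rule zero)
  next
    show "\<exists>\<Psi> \<in> hom (K0_mod \<R>) \<K>. \<forall>v \<in> carrier (K0sp_mod \<R>).
        \<Psi> (ses_relations \<R> #>\<^bsub>K0sp_mod \<R>\<^esub> v) = \<Phi> v"
      unfolding K0_mod_def
    proof (rule bexI[OF _ \<Psi>(1)], rule ballI)
      fix v assume "v \<in> carrier (K0sp_mod \<R> :: (('m set, 'm set) module set \<Rightarrow>\<^sub>0 int) set monoid)"
      then show "\<Psi> (ses_relations \<R> #>\<^bsub>K0sp_mod \<R>\<^esub> v) = \<Phi> v" by (rule \<Psi>(2))
    qed
  qed
qed

end
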